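(* Let $R$ be a non-discrete irreducible, continuous ring. Then the topological group $\mathrm{PGL}(R)$ has topological bounded normal generation. In particular, $\mathrm{PGL}(R)$ is topologically simple.
   Context: All rings are unital. A ring $R$ is regular if for every $a \in R$ there is $b \in R$ with $aba=a$. For a regular ring $R$, the set $L(R)=\{aR : a\in R\}$, ordered by inclusion, is a complemented modular lattice. A continuous ring is a regular ring $R$ such that the lattice $L(R)$ is complete and satisfies $I\wedge\bigvee C=\bigvee\{I\wedge J : J\in C\}$ and $I\vee\bigwedge C=\bigwedge\{I\vee J : J\in C\}$ for every chain $C\subseteq L(R)$ and every $I\in L(R)$. A ring is irreducible if it is non-zero and not isomorphic to a direct product of two non-zero rings. A rank function on a regular ring $R$ is a map $\rho\colon R\to[0,1]$ with $\rho(1)=1$, $\rho(ab)\le\min\{\rho(a),\rho(b)\}$ for all $a,b \in R$, $\rho(e+f)=\rho(e)+\rho(f)$ for any idempotents $e,f$ with $ef=fe=0$, and $\rho(a)=0$ only if $a=0$. Every irreducible, continuous ring $R$ has a unique rank function, denoted $\mathrm{rk}_R$; the rank metric is $d_R(a,b)=\mathrm{rk}_R(a-b)$, and the topology it generates is the rank topology. $R$ is non-discrete if its rank topology is not discrete. $\mathrm{GL}(R)$ denotes the group of units of $R$, which is a topological group with the rank topology. $\mathrm{PGL}(R)=\mathrm{GL}(R)/Z(\mathrm{GL}(R))$, where $Z(\mathrm{GL}(R))$ is the center of the group $\mathrm{GL}(R)$, carries the quotient topology of the rank topology. For a group $G$ and $g\in G$, $\mathrm{Cl}_G(g)=\{hgh^{-1}: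 h\in G\}$. A topological group $G$ has topological bounded normal generation if for every $g\in G\setminus\{e\}$ there exists $n\in\mathbb{N}$ such that $G=\overline{(\mathrm{Cl}_G(g)\cup \mathrm{Cl}_G(g^{-1}))^n}$ (setwise power, closure in $G$). A topological group is topologically simple if it does not admit any non-trivial closed normal subgroup (i.e., its only closed normal subgroups are the obvious ones). *)

theory Defs
  imports "HOL-Algebra.Algebra" "HOL-Analysis.Abstract_Metric_Spaces"
begin

section \<open>Regular, continuous and irreducible rings\<close>

definition regular_ring :: "('a, 'm) ring_scheme \<Rightarrow> bool" where
  "regular_ring R \<longleftrightarrow>
     ring R \<and> (\<forall>a \<in> carrier R. \<exists>b \<in> carrier R. a \<otimes>\<^bsub>R\<^esub> b \<otimes>\<^bsub>R\<^esub> a = a)"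

definition principal_right_ideals :: "('a, 'm) ring_scheme \<Rightarrow> 'a set set" where
  "principal_right_ideals R = {a <#\<^bsub>R\<^esub> carrier R | a. a \<in> carrier R}"

definition right_ideal_lattice :: "('a, 'm) ring_scheme \<Rightarrow> 'a set gorder" where
  "right_ideal_lattice R = \<lparr>carrier = principal_right_ideals R, eq = (=), le = (\<subseteq>)\<rparr>"

text \<open>
  Joins and meets below are taken in the lattice of principal right ideals,
  so the supremum of a chain is in general larger than its union.
\<close>

definition continuous_ring :: "('a, 'm) ring_scheme \<Rightarrow> bool" where
  "continuous_ring R \<longleftrightarrow>
     regular_ring R \<and>
     (let L = right_ideal_lattice R in
        complete_lattice L \<and>
        (\<forall>I \<in> carrier L. \<forall>C \<subseteq> carrier L. chain\<^sub>\<subseteq> C \<longrightarrow>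
           I \<sqinter>\<^bsub>L\<^esub> \<Squnion>\<^bsub>L\<^esub> C = \<Squnion>\<^bsub>L\<^esub> {I \<sqinter>\<^bsub>L\<^esub> J | J. J \<in> C} \<and>
           I \<squnion>\<^bsub>L\<^esub> \<Sqinter>\<^bsub>L\<^esub> C = \<Sqinter>\<^bsub>L\<^esub> {I \<squnion>\<^bsub>L\<^esub> J | J. J \<in> C}))"

text \<open>
  Letting the two factors live on the type of \<open>R\<close> is no restriction: each factor
  of a product decomposition of \<open>R\<close> is isomorphic to a ring whose carrier is a
  subset of \<open>carrier R\<close>.
\<close>

definition irreducible_ring :: "('a, 'm) ring_scheme \<Rightarrow> bool" where
  "irreducible_ring R \<longleftrightarrow>
     carrier R \<noteq> {\<zero>\<^bsub>R\<^esub>} \<and>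
     \<not> (\<exists>(S :: 'a ring) (T :: 'a ring).
          ring S \<and> ring T \<and> carrier S \<noteq> {\<zero>\<^bsub>S\<^esub>} \<and> carrier T \<noteq> {\<zero>\<^bsub>T\<^esub>} \<and> R \<simeq> RDirProd S T)"

section \<open>The rank function and the rank topology\<close>

text \<open>
  Rank functions are maps on \<open>carrier R\<close>; the extensional function space fixes their
  values elsewhere, without which they could not be unique.
\<close>

definition rank_function :: "('a, 'm) ring_scheme \<Rightarrow> ('a \<Rightarrow> real) \<Rightarrow> bool" where
  "rank_function R \<rho> \<longleftrightarrow>
     \<rho> \<in> carrier R \<rightarrow>\<^sub>E {0..1} \<and>
     \<rho> \<one>\<^bsub>R\<^esub> = 1 \<and>
     (\<forall>a \<in> carrier R. \<forall>b \<in> carrier R. \<rho> (a \<otimes>\<^bsub>R\<^esub> b) \<le> min (\<rho> a) (\<rho> b)) \<and>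
     (\<forall>e \<in> carrier R. \<forall>f \<in> carrier R.
        e \<otimes>\<^bsub>R\<^esub> e = e \<and> f \<otimes>\<^bsub>R\<^esub> f = f \<and> e \<otimes>\<^bsub>R\<^esub> f = \<zero>\<^bsub>R\<^esub> \<and> f \<otimes>\<^bsub>R\<^esub> e = \<zero>\<^bsub>R\<^esub>
        \<longrightarrow> \<rho> (e \<oplus>\<^bsub>R\<^esub> f) = \<rho> e + \<rho> f) \<and>
     (\<forall>a \<in> carrier R. \<rho> a = 0 \<longrightarrow> a = \<zero>\<^bsub>R\<^esub>)"

text \<open>
  By a theorem of von Neumann, every irreducible, continuous ring has exactly one
  rank function; the definite description is meant for such rings.
\<close>

definition rk :: "('a, 'm) ring_scheme \<Rightarrow> 'a \<Rightarrow> real" where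
  "rk R = (THE \<rho>. rank_function R \<rho>)"

text \<open>
  The locale \<open>Metric_space\<close> asks for nonnegativity and symmetry on the whole type,
  hence the value 0 outside the carrier; this does not affect the topology.
\<close>

definition rank_dist :: "('a, 'm) ring_scheme \<Rightarrow> 'a \<Rightarrow> 'a \<Rightarrow> real" where
  "rank_dist R a b =
     (if a \<in> carrier R \<and> b \<in> carrier R then rk R (a \<ominus>\<^bsub>R\<^esub> b) else 0)"

definition rank_topology :: "('a, 'm) ring_scheme \<Rightarrow> 'a topology" where
  "rank_topology R = Metric_space.mtopology (carrier R) (rank_dist R)"

definition non_discrete_ring :: "('a, 'm) ring_scheme \<Rightarrow> bool" where
  "non_discrete_ring R \<longleftrightarrow> rank_topology R \<noteq> discrete_topology (carrier R)"

section \<open>Groups and topological groups\<close>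

definition group_center :: "('a, 'm) monoid_scheme \<Rightarrow> 'a set" where
  "group_center G = {z \<in> carrier G. \<forall>g \<in> carrier G. z \<otimes>\<^bsub>G\<^esub> g = g \<otimes>\<^bsub>G\<^esub> z}"

definition conj_class :: "('a, 'm) monoid_scheme \<Rightarrow> 'a \<Rightarrow> 'a set" where
  "conj_class G g = {h \<otimes>\<^bsub>G\<^esub> g \<otimes>\<^bsub>G\<^esub> inv\<^bsub>G\<^esub> h | h. h \<in> carrier G}"

primrec set_power :: "('a, 'm) monoid_scheme \<Rightarrow> 'a set \<Rightarrow> nat \<Rightarrow> 'a set" where
  "set_power G A 0 = {\<one>\<^bsub>G\<^esub>}"
| "set_power G A (Suc n) = set_power G A n <#>\<^bsub>G\<^esub> A"

definition quotient_topology :: "'a topology \<Rightarrow> ('a \<Rightarrow> 'b) \<Rightarrow> 'b topology" where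
  "quotient_topology T f =
     topology (\<lambda>V. V \<subseteq> f ` topspace T \<and> openin T {x \<in> topspace T. f x \<in> V})"

lemma openin_quotient_topology:
  "openin (quotient_topology T f) V \<longleftrightarrow>
     V \<subseteq> f ` topspace T \<and> openin T {x \<in> topspace T. f x \<in> V}"
proof -
  have "istopology (\<lambda>V. V \<subseteq> f ` topspace T \<and> openin T {x \<in> topspace T. f x \<in> V})"
    unfolding istopology_def
  proof (intro conjI allI impI)
    fix U W
    assume U: "U \<subseteq> f ` topspace T \<and> openin T {x \<in> topspace T. f x \<in> U}"
      and W: "W \<subseteq> f ` topspace T \<and> openin T {x \<in> topspace T. f x \<in> W}"
    have "{x \<in> topspace T. f x \<in> U \<inter> W} =
        {x \<in> topspace T. f x \<in> U} \<inter> {x \<in> topspace T. f x \<in> W}"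
      by blast
    then show "openin T {x \<in> topspace T. f x \<in> U \<inter> W}"
      using U W by auto
    show "U \<inter> W \<subseteq> f ` topspace T"
      using U by blast
  next
    fix \<K>
    assume K: "\<forall>K\<in>\<K>. K \<subseteq> f ` topspace T \<and> openin T {x \<in> topspace T. f x \<in> K}"
    have "{x \<in> topspace T. f x \<in> \<Union>\<K>} = (\<Union>K\<in>\<K>. {x \<in> topspace T. f x \<in> K})"
      by blast
    then show "openin T {x \<in> topspace T. f x \<in> \<Union>\<K>}"
      using K by auto
    show "\<Union>\<K> \<subseteq> f ` topspace T"
      using K by blast
  qed
  then show ?thesis
    by (simp add: quotient_topology_def)
qed

lemma topspace_quotient_topology [simp]:
  "topspace (quotient_topology T f) = f ` topspace T"
proof -
  have "{x \<in> topspace T. f x \<in> f ` topspace T} = topspace T"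
    by blast
  then have "openin (quotient_topology T f) (f ` topspace T)"
    by (simp add: openin_quotient_topology)
  then show ?thesis
    by (meson openin_quotient_topology openin_subset openin_topspace subset_antisym)
qed

lemma quotient_map_quotient_topology: "quotient_map T (quotient_topology T f) f"
  by (simp add: quotient_map_def openin_quotient_topology)

definition topological_group :: "('a, 'm) monoid_scheme \<Rightarrow> 'a topology \<Rightarrow> bool" where
  "topological_group G T \<longleftrightarrow>
     group G \<and> topspace T = carrier G \<and>
     continuous_map (prod_topology T T) T (\<lambda>(x, y). x \<otimes>\<^bsub>G\<^esub> y) \<and>
     continuous_map T T (\<lambda>x. inv\<^bsub>G\<^esub> x)"

definition top_bounded_normal_generation ::
    "('a, 'm) monoid_scheme \<Rightarrow> 'a topology \<Rightarrow> bool" where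
  "top_bounded_normal_generation G T \<longleftrightarrow>
     topological_group G T \<and>
     (\<forall>g \<in> carrier G - {\<one>\<^bsub>G\<^esub>}. \<exists>n.
        carrier G = T closure_of set_power G (conj_class G g \<union> conj_class G (inv\<^bsub>G\<^esub> g)) n)"

definition topologically_simple :: "('a, 'm) monoid_scheme \<Rightarrow> 'a topology \<Rightarrow> bool" where
  "topologically_simple G T \<longleftrightarrow>
     topological_group G T \<and>
     (\<forall>N. N \<lhd> G \<and> closedin T N \<longrightarrow> N = {\<one>\<^bsub>G\<^esub>} \<or> N = carrier G)"

section \<open>Unit groups\<close>

abbreviation GL :: "('a, 'm) ring_scheme \<Rightarrow> 'a monoid" where
  "GL R \<equiv> units_of R"

definition GL_topology :: "('a, 'm) ring_scheme \<Rightarrow> 'a topology" where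
  "GL_topology R = subtopology (rank_topology R) (carrier (GL R))"

definition PGL :: "('a, 'm) ring_scheme \<Rightarrow> 'a set monoid" where
  "PGL R = GL R Mod group_center (GL R)"

definition PGL_topology :: "('a, 'm) ring_scheme \<Rightarrow> 'a set topology" where
  "PGL_topology R =
     quotient_topology (GL_topology R) (\<lambda>g. group_center (GL R) #>\<^bsub>GL R\<^esub> g)"

end

theory Submission
  imports Defs
begin

text \<open>
  Write \<open>e \<asymp> f\<close> for isomorphism of the right ideals generated by the idempotents \<open>e\<close> and \<open>f\<close>.
  Continuity of the lattice gives, by Zorn's lemma applied to triples of right ideals that are
  pairwise complements in their sum, the comparability of idempotents, and it excludes infinitely many
  orthogonal equivalent idempotents. Counting orthogonal copies of repeatedly halved idempotents then
  yields the unique rank function.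

  If a unit \<open>g\<close> is not central, then a commutator of \<open>g\<close> with a transvection is a transvection \<open>1 + z\<close>,
  \<open>z\<^sup>2 = 0 \<noteq> z\<close>, which is a product of a conjugate of \<open>g\<close> and one of its inverse. Square-zero
  elements of equal rank are conjugate, and the rank of \<open>z\<close> can be enlarged by writing an element as
  a sum of two annihilating square-zero elements with overlapping parts that cancel; so
  all transvections are products of boundedly many conjugates. Finally every
  unit is arbitrarily close to a product of 45 transvections: up to boundedly many transvections,
  which Whitehead's lemma provides, a unit supported on an idempotent is moved to one supported
  on half of it, and the factors used in successive steps live on orthogonal
  idempotents and hence combine to boundedly many.
\<close>

section \<open>Idempotents in regular rings\<close>

text \<open>The axioms control limits of right ideals, not of maps. An isomorphism is therefore
  stored through its graph, a third right ideal, and limits are taken of graphs. Halving a unit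
  again and again would call for a limit of units. The induction stops after \<open>m\<close> steps
  instead and bounds the rank of what remains, so completeness of the rank metric is never touched.
  The obstacle is a number of factors that does not grow with \<open>m\<close>: a Whitehead element
  needs a second corner for the inverse, and the corners of consecutive levels overlap. Routing the
  inverse through an auxiliary idempotent \<open>c\<close> separates the levels. The number 45 is 9
  + 9 + 27: two halvings of the unit make room for the auxiliary idempotents, and each of the three
  factors of \<open>swindle\<close> costs 9. One halving costs 9 = 1 + 1 + 6 + 1: a preliminary row
  operation, the two triangular factors of a block LDU decomposition, and six transvections for
  Whitehead's lemma. Non-discreteness enters only by excluding minimal idempotents: if there were
  one, all ranks would be multiples of a fixed 1 / M.\<close>

lemma mult_assoc_subst: "a * b = c \<Longrightarrow> a * (b * x) = c * (x :: 'b :: semigroup_mult)"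
  by (simp add: mult.assoc[symmetric])

lemma mult_zero_via_orth:
  "x * e = x \<Longrightarrow> f * y = y \<Longrightarrow> e * f = 0 \<Longrightarrow> x * y = (0 :: 'b :: ring)"
  by (metis mult.assoc mult_zero_left mult_zero_right)

text \<open>The unit belongs to the subset and not to the type, because a ring given by a carrier is
  realised below as a direct factor of a type of class \<open>ring\<close>, a class that asks for no
  unit.\<close>

locale unital_subring =
  fixes A :: "'b :: ring set" and u :: 'b
  assumes add_in [simp, intro]: "x \<in> A \<Longrightarrow> y \<in> A \<Longrightarrow> x + y \<in> A"
    and uminus_in [simp, intro]: "x \<in> A \<Longrightarrow> - x \<in> A"
    and mult_in [simp, intro]: "x \<in> A \<Longrightarrow> y \<in> A \<Longrightarrow> x * y \<in> A"
    and unit_in [simp, intro]: "u \<in> A"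
    and unit_left [simp]: "x \<in> A \<Longrightarrow> u * x = x"
    and unit_right [simp]: "x \<in> A \<Longrightarrow> x * u = x"
begin

lemma diff_in [simp, intro]: "x \<in> A \<Longrightarrow> y \<in> A \<Longrightarrow> x - y \<in> A"
  by (metis add_in uminus_in add_uminus_conv_diff)

lemma zero_in [simp, intro]: "0 \<in> A"
  using diff_in[OF unit_in unit_in] by simp

lemma sum_in [simp, intro]: "(\<And>i. i \<in> S \<Longrightarrow> f i \<in> A) \<Longrightarrow> sum f S \<in> A"
  by (induction S rule: infinite_finite_induct) auto

section \<open>Idempotents, equivalence and subordination\<close>

definition idem :: "'b \<Rightarrow> bool" where
  "idem e \<longleftrightarrow> e \<in> A \<and> e * e = e"

definition right_ideal :: "'b \<Rightarrow> 'b set" where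
  "right_ideal a = {a * x | x. x \<in> A}"

definition below :: "'b \<Rightarrow> 'b \<Rightarrow> bool"  (infix \<open>\<preceq>\<close> 50) where
  "a \<preceq> b \<longleftrightarrow> (\<exists>x\<in>A. \<exists>y\<in>A. a = x * b * y)"

text \<open>The isomorphisms between the two right ideals are the left multiplications by
  \<open>x\<close> and \<open>y\<close>. The four absorption laws place them in off-diagonal
  corners, so that cross terms vanish when orthogonal idempotents are added.\<close>

definition eqv :: "'b \<Rightarrow> 'b \<Rightarrow> bool"  (infix \<open>\<asymp>\<close> 50) where
  "e \<asymp> f \<longleftrightarrow> (\<exists>x\<in>A. \<exists>y\<in>A. x * y = e \<and> y * x = f \<and> e * x = x \<and> x * f = x \<and> f * y = y \<and> y * e = y)"

lemma idem_in [simp, dest]: "idem e \<Longrightarrow> e \<in> A"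
  by (simp add: idem_def)

lemma idemI: "e \<in> A \<Longrightarrow> e * e = e \<Longrightarrow> idem e"
  by (simp add: idem_def)

lemma idem_mult: "idem e \<Longrightarrow> e * e = e"
  by (simp add: idem_def)

lemma idem_zero [simp]: "idem 0" and idem_unit [simp]: "idem u"
  by (auto intro!: idemI)

lemma idem_diff:
  assumes "idem e" "idem f" "e * f = f" "f * e = f"
  shows "idem (e - f)" "(e - f) * f = 0" "f * (e - f) = 0" "e * (e - f) = e - f" "(e - f) * e = e - f"
  using assms by (auto intro!: idemI simp: idem_mult algebra_simps)

lemma idem_compl: "idem e \<Longrightarrow> idem (u - e)"
  by (rule idem_diff) auto

lemma idem_add:
  assumes "idem e" "idem f" "e * f = 0" "f * e = 0"
  shows "idem (e + f)"
  using assms by (auto intro!: idemI simp: idem_mult algebra_simps)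

lemma eqvE:
  assumes "e \<asymp> f"
  obtains x y where "x \<in> A" "y \<in> A" "x * y = e" "y * x = f" "e * x = x" "x * f = x" "f * y = y" "y * e = y"
  using assms unfolding eqv_def by blast

text \<open>The absorption laws come for free: \<open>x * y * x * y * x\<close> and its mirror image
  absorb the idempotents on both sides and have the same products.\<close>

lemma eqvI:
  assumes "x \<in> A" "y \<in> A" "x * y = e" "y * x = f" "idem e" "idem f"
  shows "e \<asymp> f"
proof -
  have "x * (y * (x * y)) = x * y" "y * (x * (y * x)) = y * x"
    using idem_mult[OF assms(5)] idem_mult[OF assms(6)] unfolding assms(3,4)[symmetric] by (simp_all add: mult.assoc)
  note R = this this[THEN mult_assoc_subst, simplified mult.assoc]
  show ?thesis unfolding eqv_def assms(3,4)[symmetric]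
    by (rule bexI[of _ "x * y * x * y * x"], rule bexI[of _ "y * x * y * x * y"])
      (use assms(1,2) in \<open>auto simp: mult.assoc R\<close>)
qed

lemma eqv_refl: "idem e \<Longrightarrow> e \<asymp> e"
  by (rule eqvI[of e e]) (auto simp: idem_mult)

lemma eqv_sym: "e \<asymp> f \<Longrightarrow> f \<asymp> e"
  unfolding eqv_def by blast

lemma eqv_idem: assumes "e \<asymp> f" shows "idem e" "idem f"
proof -
  obtain x y where *: "x \<in> A" "y \<in> A" "x * y = e" "y * x = f" "e * x = x" "x * f = x" "f * y = y" "y * e = y"
    using assms by (rule eqvE)
  then show "idem e" "idem f"
    unfolding idem_def by (auto, metis mult.assoc, metis mult.assoc)
qed

lemma eqv_trans:
  assumes "e \<asymp> f" "f \<asymp> g" shows "e \<asymp> g"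
proof -
  obtain x y where *: "x \<in> A" "y \<in> A" "x * y = e" "y * x = f" "e * x = x" "x * f = x" "f * y = y" "y * e = y"
    using assms(1) by (rule eqvE)
  obtain x' y' where **: "x' \<in> A" "y' \<in> A" "x' * y' = f" "y' * x' = g" "f * x' = x'" "x' * g = x'" "g * y' = y'" "y' * f = y'"
    using assms(2) by (rule eqvE)
  show ?thesis
  proof (rule eqvI[of "x * x'" "y' * y"])
    show "x * x' * (y' * y) = e" "y' * y * (x * x') = g"
      using * ** *(3,4)[THEN mult_assoc_subst] **(3,4)[THEN mult_assoc_subst] by (simp_all add: mult.assoc)
  qed (use * ** eqv_idem[OF assms(1)] eqv_idem[OF assms(2)] in auto)
qed

lemma eqv_add:
  assumes "e \<asymp> e'" "f \<asymp> f'" "e * f = 0" "f * e = 0" "e' * f' = 0" "f' * e' = 0"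
  shows "e + f \<asymp> e' + f'"
proof -
  obtain x y where x: "x \<in> A" "y \<in> A" "x * y = e" "y * x = e'" "e * x = x" "x * e' = x" "e' * y = y" "y * e = y"
    using assms(1) by (rule eqvE)
  obtain x' y' where x': "x' \<in> A" "y' \<in> A" "x' * y' = f" "y' * x' = f'" "f * x' = x'" "x' * f' = x'" "f' * y' = y'" "y' * f = y'"
    using assms(2) by (rule eqvE)
  have 0: "x * y' = 0" "x' * y = 0" "y * x' = 0" "y' * x = 0"
    using mult_zero_via_orth[OF x(6) x'(7)] mult_zero_via_orth[OF x'(6) x(7)]
      mult_zero_via_orth[OF x(8) x'(5)] mult_zero_via_orth[OF x'(8) x(5)] assms(3-6) by auto
  show ?thesis
    by (rule eqvI[of "x + x'" "y + y'"])
      (use x(1-4) x'(1-4) 0 assms(3-6) eqv_idem[OF assms(1)] eqv_idem[OF assms(2)] in \<open>auto intro!: idem_add simp: distrib_left distrib_right\<close>)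
qed

lemma eqv_below: assumes "e \<asymp> f" shows "e \<preceq> f"
proof -
  obtain x y where *: "x \<in> A" "y \<in> A" "x * y = e" "y * x = f" "e * x = x" "x * f = x" "f * y = y" "y * e = y"
    using assms by (rule eqvE)
  then show ?thesis unfolding below_def by metis
qed

lemma below_refl: "a \<in> A \<Longrightarrow> a \<preceq> a"
  unfolding below_def by (metis unit_in unit_left unit_right)

lemma below_trans: assumes "a \<preceq> b" "b \<preceq> c" shows "a \<preceq> c"
proof -
  obtain x y x' y' where "x\<in>A" "y\<in>A" "x'\<in>A" "y'\<in>A" "a = x * b * y" "b = x' * c * y'"
    using assms unfolding below_def by blast
  then have "a = (x * x') * c * (y' * y)" by (simp add: mult.assoc)
  then show ?thesis unfolding below_def using \<open>x\<in>A\<close> \<open>y\<in>A\<close> \<open>x'\<in>A\<close> \<open>y'\<in>A\<close> by blast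
qed

lemma below_mult_left: "a \<in> A \<Longrightarrow> b \<in> A \<Longrightarrow> a * b \<preceq> b"
  and below_mult_right: "a \<in> A \<Longrightarrow> b \<in> A \<Longrightarrow> a * b \<preceq> a"
  unfolding below_def by (metis unit_in unit_right mult_in, metis unit_in unit_left mult_in)

lemma below_zero: "a \<preceq> 0 \<Longrightarrow> a = 0"
  unfolding below_def by auto

lemma zero_below: "0 \<preceq> a"
  unfolding below_def by (metis mult_zero_left mult_zero_right zero_in)

text \<open>A factorisation of \<open>e\<close> through \<open>f\<close> is compressed to the
  corners of \<open>e\<close> and \<open>f\<close>. One product of the compressed factors is still
  \<open>e\<close>, and the opposite product is the subidempotent of \<open>f\<close>.\<close>

lemma below_subidem:
  assumes "idem e" "idem f" "e \<preceq> f"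
  obtains f' where "idem f'" "f * f' = f'" "f' * f = f'" "e \<asymp> f'"
proof -
  obtain x y where xy: "x\<in>A" "y\<in>A" "e = x * f * y"
    using assms(3) unfolding below_def by blast
  define x' y' where "x' = e * x * f" and "y' = f * y * e"
  note i = idem_mult[OF assms(1)] idem_mult[OF assms(2)]
  have ff: "f * (f * z) = f * z" and ee: "e * (e * z) = e * z" for z
    using i by (simp_all add: mult_assoc_subst)
  have "x' * y' = e * (x * f * y) * e"
    by (simp add: x'_def y'_def mult.assoc ff)
  then have 1: "x' * y' = e" using xy(3) i by simp
  have x'e: "e * x' = x'" "x' * f = x'" "f * y' = y'" "y' * e = y'"
    using i by (simp_all add: x'_def y'_def mult.assoc ff ee)
  have in': "x' \<in> A" "y' \<in> A" using xy assms by (auto simp: x'_def y'_def)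
  have f': "idem (y' * x')"
    by (rule idemI) (use in' 1 x'e 1[THEN mult_assoc_subst] in \<open>auto simp: mult.assoc\<close>)
  show thesis
  proof (rule that[of "y' * x'"])
    show "e \<asymp> y' * x'" by (rule eqvI[OF in' 1 refl assms(1) f'])
    show "f * (y' * x') = y' * x'" "(y' * x') * f = y' * x'" using x'e x'e[THEN mult_assoc_subst] by (simp_all add: mult.assoc)
  qed (fact f')
qed

lemma subidem_below: "idem e \<Longrightarrow> idem f \<Longrightarrow> f * e = e \<Longrightarrow> e \<preceq> f"
  by (metis below_mult_right idem_in)

text \<open>Both summands are first moved inside \<open>e'\<close> and \<open>f'\<close>, where
  orthogonality allows the isomorphisms to be added.\<close>

lemma below_add:
  assumes "idem e" "idem f" "idem e'" "idem f'" "e \<preceq> e'" "f \<preceq> f'"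
    "e * f = 0" "f * e = 0" "e' * f' = 0" "f' * e' = 0"
  shows "e + f \<preceq> e' + f'"
proof -
  obtain p where p: "idem p" "e' * p = p" "p * e' = p" "e \<asymp> p" using below_subidem assms by metis
  obtain q where q: "idem q" "f' * q = q" "q * f' = q" "f \<asymp> q" using below_subidem assms by metis
  have 0: "p * q = 0" "q * p = 0" "e' * q = 0" "f' * p = 0"
    using mult_zero_via_orth[OF p(3) q(2)] mult_zero_via_orth[OF q(3) p(2)]
      mult_zero_via_orth[OF idem_mult q(2)] mult_zero_via_orth[OF idem_mult p(2)] assms by auto
  then have "(e' + f') * (p + q) = p + q" using p q by (simp add: algebra_simps)
  then have "p + q \<preceq> e' + f'" using p q assms 0 by (intro subidem_below idem_add)
  moreover have "e + f \<asymp> p + q" using p q assms 0 by (intro eqv_add)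
  ultimately show ?thesis using eqv_below below_trans by blast
qed

section \<open>Principal right ideals as sets\<close>

lemma right_ideal_memI: "x \<in> A \<Longrightarrow> a * x \<in> right_ideal a"
  unfolding right_ideal_def by blast

lemma right_ideal_idem: "idem e \<Longrightarrow> x \<in> right_ideal e \<longleftrightarrow> x \<in> A \<and> e * x = x"
  unfolding right_ideal_def by (auto simp: idem_mult mult_assoc_subst) metis

lemma right_ideal_in: "a \<in> A \<Longrightarrow> x \<in> right_ideal a \<Longrightarrow> x \<in> A"
  unfolding right_ideal_def by auto

lemma right_ideal_self: "a \<in> A \<Longrightarrow> a \<in> right_ideal a"
  unfolding right_ideal_def by (metis (mono_tags, lifting) mem_Collect_eq unit_in unit_right)

lemma right_ideal_least: "a \<in> right_ideal b \<Longrightarrow> b \<in> A \<Longrightarrow> right_ideal a \<subseteq> right_ideal b"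
  unfolding right_ideal_def by (auto simp: mult.assoc)

lemma right_ideal_add: "x \<in> right_ideal a \<Longrightarrow> y \<in> right_ideal a \<Longrightarrow> x + y \<in> right_ideal a"
  unfolding right_ideal_def by (auto simp: distrib_left[symmetric])

lemma right_ideal_uminus: "x \<in> right_ideal a \<Longrightarrow> - x \<in> right_ideal a"
  unfolding right_ideal_def by (auto simp del: mult_minus_right simp: mult_minus_right[symmetric])

lemma right_ideal_mult: "x \<in> right_ideal a \<Longrightarrow> y \<in> A \<Longrightarrow> x * y \<in> right_ideal a"
  unfolding right_ideal_def by (auto simp: mult.assoc)

lemma right_ideal_zero: "0 \<in> right_ideal a"
  unfolding right_ideal_def by (metis (mono_tags, lifting) mem_Collect_eq mult_zero_right zero_in)

lemma right_ideal_0 [simp]: "right_ideal 0 = {0}"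
  unfolding right_ideal_def by auto

end

locale regular_subring = unital_subring A u for A :: "'b :: ring set" and u +
  assumes regular: "a \<in> A \<Longrightarrow> \<exists>b\<in>A. a * b * a = a"
begin

lemma quasi_inverse:
  assumes "a \<in> A"
  obtains b where "b \<in> A" "a * b * a = a" "b * a * b = b"
proof -
  obtain c where c: "c \<in> A" "a * c * a = a" using regular[OF assms] by blast
  show thesis
    by (rule that[of "c * a * c"]) (use c assms c(2)[simplified mult.assoc] c(2)[THEN mult_assoc_subst, simplified mult.assoc] in \<open>auto simp: mult.assoc\<close>)
qed

lemma quasi_inverse_idem:
  assumes "a \<in> A" "b \<in> A" "a * b * a = a"
  shows "idem (a * b)" "idem (b * a)"
  using assms assms(3)[THEN mult_assoc_subst, simplified mult.assoc] by (auto intro!: idemI simp: idem_mult mult.assoc)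

lemma quasi_inverse_eqv:
  assumes "a \<in> A" "b \<in> A" "a * b * a = a"
  shows "a * b \<asymp> b * a"
  by (rule eqvI[of a b]) (use assms quasi_inverse_idem in auto)

lemma idem_generator:
  assumes "a \<in> A"
  obtains e b where "idem e" "b \<in> A" "a * b = e" "e * a = a" "right_ideal e = right_ideal a" "e \<preceq> a" "a \<preceq> e"
proof -
  obtain b where b: "b \<in> A" "a * b * a = a" using regular[OF assms] by blast
  have e: "idem (a * b)" using quasi_inverse_idem assms b by blast
  show thesis
  proof (rule that[of "a*b" b])
    show "right_ideal (a * b) = right_ideal a"
      by (metis assms b e idem_in right_ideal_least right_ideal_memI subset_antisym)
    show "a * b \<preceq> a" "a \<preceq> a * b" using assms b
      by (metis below_mult_right, metis below_mult_right mult_in)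
  qed (use assms b e in auto)
qed

text \<open>The idempotent \<open>e + g\<close> generates the sum of the right ideals of
  \<open>e\<close> and \<open>b\<close>; the equation for \<open>g\<close> in terms of
  \<open>s\<close> and \<open>t\<close> certifies that \<open>g\<close> lies in that sum.\<close>

lemma join:
  assumes "idem e" "b \<in> A"
  obtains g s t where "idem g" "e * g = 0" "g * e = 0" "s \<in> A" "t \<in> A" "g = b * s + e * t" "(e + g) * b = b" "g \<preceq> b"
    "\<forall>c\<in>A. e * b * c = b * c \<longrightarrow> g * (b * c) = 0"
proof -
  define a where "a = (u - e) * b"
  have a: "a \<in> A" using assms by (auto simp: a_def)
  obtain c where c: "c \<in> A" "a * c * a = a" using regular[OF a] by blast
  \<comment> \<open>The idempotent \<open>h\<close> generates the right ideal of
    \<open>(u - e) * b\<close>, but need not kill \<open>e\<close> from the left. Multiplying by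
    \<open>u - e\<close> repairs this without changing the right ideal.\<close>
  define h g where "h = a * c" and "g = h * (u - e)"
  note ee = idem_mult[OF assms(1)]
  note ee' = ee[THEN mult_assoc_subst]
  have ea: "e * a = 0" using assms by (simp add: a_def algebra_simps ee ee')
  have eh: "e * h = 0" using ea by (simp add: h_def mult_assoc_subst)
  have h: "h \<in> A" "h * h = h" "h * a = a"
    using c a c(2)[simplified mult.assoc] c(2)[THEN mult_assoc_subst, simplified mult.assoc] by (auto simp: h_def mult.assoc)
  have g: "g \<in> A" using h assms by (auto simp: g_def)
  have gexp: "g = h - h * e" using h by (simp add: g_def algebra_simps)
  have gg: "g * g = g"
    unfolding gexp using h eh eh[THEN mult_assoc_subst] h(2)[THEN mult_assoc_subst]
    by (simp add: algebra_simps)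
  have eg: "e * g = 0" unfolding gexp using eh eh[THEN mult_assoc_subst] by (simp add: algebra_simps)
  have ge: "g * e = 0" unfolding gexp using ee assms by (simp add: algebra_simps)
  have ga: "g * a = a" unfolding gexp using h ea by (simp add: algebra_simps)
  have bexp: "b = e * b + a" using assms by (simp add: a_def algebra_simps)
  have gb: "g * b = a"
  proof -
    have "g * b = g * (e * b) + g * a" using bexp by (metis distrib_left)
    then show ?thesis using ga ge ge[THEN mult_assoc_subst] by simp
  qed
  have "g = a * (c * (u - e))" by (simp add: g_def h_def mult.assoc)
  also have "\<dots> = b * (c * (u - e)) + e * (- (b * (c * (u - e))))"
    unfolding a_def using assms c by (simp add: algebra_simps)
  finally have gst: "g = b * (c * (u - e)) + e * (- (b * (c * (u - e))))" .
  show thesis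
  proof (rule that[of g "c * (u - e)" "- (b * (c * (u - e)))"])
    show "(e + g) * b = b" using gb bexp by (metis distrib_right)
    have "g = (u - e) * b * (c * (u - e))" by (simp add: g_def h_def a_def mult.assoc)
    then show "g \<preceq> b" unfolding below_def using assms c by blast
    show "\<forall>c\<in>A. e * b * c = b * c \<longrightarrow> g * (b * c) = 0"
    proof (intro ballI impI)
      fix c assume "e * b * c = b * c"
      then have "g * (b * c) = g * (e * (b * c))" by (simp add: mult.assoc)
      also have "\<dots> = 0" using ge[THEN mult_assoc_subst] by simp
      finally show "g * (b * c) = 0" .
    qed
    show "g = b * (c * (u - e)) + e * (- (b * (c * (u - e))))" by (fact gst)
  qed (use gg g eg ge c assms in \<open>auto intro!: idemI\<close>)
qed

text \<open>The intersection of the two right ideals is the kernel of left multiplication by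
  \<open>u - f\<close> on the right ideal of \<open>e\<close>, and a quasi-inverse of
  \<open>(u - f) * e\<close> cuts it out. The generator is a subidempotent of \<open>e\<close>,
  whereas \<open>f\<close> is absorbed from the left only.\<close>

lemma meet:
  assumes "idem e" "idem f"
  obtains m where "idem m" "e * m = m" "m * e = m" "f * m = m"
    "\<And>x. x \<in> A \<Longrightarrow> e * x = x \<Longrightarrow> f * x = x \<Longrightarrow> m * x = x"
proof -
  define a where "a = (u - f) * e"
  have a: "a \<in> A" using assms by (auto simp: a_def)
  obtain b where b: "b \<in> A" "a * b * a = a" using regular[OF a] by blast
  define h where "h = b * a"
  note ee = idem_mult[OF assms(1)]
  note ff = idem_mult[OF assms(2)]
  have ae: "a * e = a" by (simp add: a_def ee mult.assoc)
  have he: "h * e = h" by (simp add: h_def ae mult.assoc)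
  have hh: "h * h = h" using b by (simp add: h_def mult.assoc)
  have ah: "a * h = a" using b by (simp add: h_def mult.assoc)
  have fea: "e - f * e = a" using assms by (simp add: a_def algebra_simps)
  have h: "h \<in> A" using a b by (simp add: h_def)
  note R = ee he hh ee[THEN mult_assoc_subst] he[THEN mult_assoc_subst] hh[THEN mult_assoc_subst]
  show thesis
  proof (rule that[of "e - e * h"])
    show "idem (e - e * h)" using assms h by (auto intro!: idemI simp: idem_mult algebra_simps R)
    show "e * (e - e * h) = e - e * h" "(e - e * h) * e = e - e * h"
      by (simp_all add: algebra_simps R)
    have "(e - f * e) * (u - h) = 0" unfolding fea using ah a by (simp add: algebra_simps)
    then show "f * (e - e * h) = e - e * h" using assms h by (simp add: algebra_simps)
    show "(e - e * h) * x = x" if "x \<in> A" "e * x = x" "f * x = x" for x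
    proof -
      have "a * x = 0" using that unfolding a_def by (simp add: algebra_simps)
      then have "h * x = 0" by (simp add: h_def mult.assoc)
      then show ?thesis using that by (simp add: algebra_simps)
    qed
  qed
qed

end

section \<open>Triples of principal right ideals\<close>

definition isum :: "'b :: ring set \<Rightarrow> 'b set \<Rightarrow> 'b set" where
  "isum V Y = {w. \<exists>x\<in>V. \<exists>y\<in>Y. w = x + y}"

lemma isumI: "x \<in> V \<Longrightarrow> y \<in> Y \<Longrightarrow> x + y \<in> isum V Y"
  unfolding isum_def by blast

lemma isumE:
  assumes "w \<in> isum V Y"
  obtains x y where "x \<in> V" "y \<in> Y" "w = x + y"
  using assms unfolding isum_def by blast

lemma isum_mono: "V \<subseteq> V' \<Longrightarrow> Y \<subseteq> Y' \<Longrightarrow> isum V Y \<subseteq> isum V' Y'"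
  unfolding isum_def by blast

lemma isum_left: "0 \<in> Y \<Longrightarrow> V \<subseteq> isum V Y"
  unfolding isum_def by (force intro: exI[of _ 0])

lemma isum_right: "0 \<in> V \<Longrightarrow> Y \<subseteq> isum V Y"
  unfolding isum_def by (force intro: exI[of _ 0])

lemma isum_isum_subset:
  assumes "P \<subseteq> isum Q R" "P' \<subseteq> isum Q' R'"
  shows "isum P P' \<subseteq> isum (isum Q Q') (isum R R')"
proof
  fix w assume "w \<in> isum P P'"
  then obtain p p' where "p \<in> P" "p' \<in> P'" and w: "w = p + p'" by (rule isumE)
  moreover obtain q r where "q \<in> Q" "r \<in> R" "p = q + r"
    by (rule isumE[OF subsetD[OF assms(1) \<open>p \<in> P\<close>]])
  moreover obtain q' r' where "q' \<in> Q'" "r' \<in> R'" "p' = q' + r'"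
    by (rule isumE[OF subsetD[OF assms(2) \<open>p' \<in> P'\<close>]])
  ultimately have "w = (q + q') + (r + r')" using w by simp
  then show "w \<in> isum (isum Q Q') (isum R R')"
    using \<open>q \<in> Q\<close> \<open>r \<in> R\<close> \<open>q' \<in> Q'\<close> \<open>r' \<in> R'\<close> by (auto intro!: isumI)
qed

section \<open>The lattice of principal right ideals, and perspectivity\<close>

context regular_subring
begin

definition L :: "'b set set" where "L = right_ideal ` A"

lemma L_idem:
  assumes "V \<in> L" obtains e where "idem e" "V = right_ideal e"
proof -
  obtain a where a: "a \<in> A" "V = right_ideal a" using assms by (auto simp: L_def)
  show thesis by (rule idem_generator[OF a(1)]) (use that a in auto)
qed

lemma L_subset: "V \<in> L \<Longrightarrow> x \<in> V \<Longrightarrow> x \<in> A"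
  using right_ideal_in unfolding L_def by blast
lemma L_zero [simp]: "V \<in> L \<Longrightarrow> 0 \<in> V"
  using right_ideal_zero unfolding L_def by blast
lemma L_add: "V \<in> L \<Longrightarrow> x \<in> V \<Longrightarrow> y \<in> V \<Longrightarrow> x + y \<in> V"
  using right_ideal_add unfolding L_def by blast
lemma L_uminus: "V \<in> L \<Longrightarrow> x \<in> V \<Longrightarrow> - x \<in> V"
  using right_ideal_uminus unfolding L_def by blast
lemma L_diff: "V \<in> L \<Longrightarrow> x \<in> V \<Longrightarrow> y \<in> V \<Longrightarrow> x - y \<in> V"
  using L_add[of V x "- y"] L_uminus by simp
lemma L_mult: "V \<in> L \<Longrightarrow> x \<in> V \<Longrightarrow> y \<in> A \<Longrightarrow> x * y \<in> V"
  using right_ideal_mult unfolding L_def by blast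
lemma L_right_ideal_subset: "V \<in> L \<Longrightarrow> x \<in> V \<Longrightarrow> right_ideal x \<subseteq> V"
  using L_mult[of V x] by (auto simp: right_ideal_def[of x])
lemma right_ideal_L [simp, intro]: "a \<in> A \<Longrightarrow> right_ideal a \<in> L"
  unfolding L_def by blast

lemma isum_least: "Z \<in> L \<Longrightarrow> V \<subseteq> Z \<Longrightarrow> Y \<subseteq> Z \<Longrightarrow> isum V Y \<subseteq> Z"
  unfolding isum_def using L_add by blast

lemma isum_L [simp, intro]: assumes "V \<in> L" "Y \<in> L" shows "isum V Y \<in> L"
proof -
  obtain e where e: "idem e" "V = right_ideal e" using assms(1) by (rule L_idem)
  obtain b where b: "b \<in> A" "Y = right_ideal b" using assms(2) unfolding L_def by blast
  obtain g s t where g: "idem g" "e * g = 0" "g * e = 0" "s \<in> A" "t \<in> A" "g = b * s + e * t" "(e + g) * b = b"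
    using join[OF e(1) b(1)] by metis
  have eg: "e + g \<in> A" using e g by auto
  have ege: "(e + g) * e = e" using g(3) idem_mult[OF e(1)] by (simp add: distrib_right)
  have "isum V Y = right_ideal (e + g)"
  proof
    have "e \<in> right_ideal (e + g)" "b \<in> right_ideal (e + g)"
      using right_ideal_memI[OF idem_in[OF e(1)], of "e+g"] right_ideal_memI[OF b(1), of "e+g"] ege g(7) by auto
    then show "isum V Y \<subseteq> right_ideal (e + g)"
      unfolding e b by (intro isum_least right_ideal_L right_ideal_least eg)
    show "right_ideal (e + g) \<subseteq> isum V Y"
    proof
      fix w assume "w \<in> right_ideal (e + g)"
      then obtain x where x: "x \<in> A" "w = (e + g) * x" unfolding right_ideal_def by blast
      have "w = e * x + (b * s + e * t) * x" using x(2) g(6) by (simp add: distrib_right)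
      also have "\<dots> = e * (x + t * x) + b * (s * x)" by (simp add: algebra_simps)
      finally show "w \<in> isum V Y" unfolding e b
        using x g by (auto intro!: isumI right_ideal_memI)
    qed
  qed
  then show ?thesis using eg by simp
qed

text \<open>Containment yields absorption of \<open>e\<close> from the left only. Multiplying the
  generator by \<open>e\<close> on the right keeps the right ideal and adds the missing
  absorption.\<close>

lemma sub_generator:
  assumes "idem e" "V \<in> L" "V \<subseteq> right_ideal e"
  obtains a where "idem a" "V = right_ideal a" "e * a = a" "a * e = a"
proof -
  obtain a where a: "idem a" "V = right_ideal a" using L_idem assms by metis
  have "a \<in> right_ideal e" using a assms right_ideal_self by auto
  then have ea: "e * a = a" using assms right_ideal_idem by blast
  note aa = idem_mult[OF a(1)] idem_mult[OF assms(1)]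
  note R = aa ea aa[THEN mult_assoc_subst] ea[THEN mult_assoc_subst]
  show thesis
  proof (rule that[of "a * e"])
    have in': "a * e \<in> A" using a assms by auto
    show "idem (a * e)" using in' by (rule idemI) (simp add: mult.assoc R)
    have "a * e * a = a" by (simp add: mult.assoc R)
    then have "a \<in> right_ideal (a * e)" using right_ideal_memI[of a "a * e"] a by auto
    moreover have "a * e \<in> right_ideal a" using assms a by (auto intro: right_ideal_memI)
    ultimately show "V = right_ideal (a * e)"
      unfolding a using a(1) in' by (intro equalityI right_ideal_least) auto
  qed (simp_all add: mult.assoc R)
qed

text \<open>The last hypothesis makes left multiplication by \<open>k\<close> injective on the right
  ideal of \<open>a\<close>; a quasi-inverse of \<open>k * a\<close> then recovers \<open>a\<close>
  from \<open>k * a\<close>.\<close>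

lemma annihilator_below:
  assumes "a \<in> A" "k \<in> A" "\<And>w. w \<in> A \<Longrightarrow> k * (a * w) = 0 \<Longrightarrow> a * w = 0"
  shows "a \<preceq> k"
proof -
  have t: "k * a \<in> A" using assms by auto
  obtain b where b: "b \<in> A" "k * a * b * (k * a) = k * a" using regular[OF t] by blast
  have "a * (u - b * (k * a)) = 0"
    using assms(1,2) b by (intro assms(3)) (auto simp: algebra_simps)
  then have "a = (a * b) * k * a" using assms by (simp add: algebra_simps)
  then show ?thesis unfolding below_def using assms b by blast
qed

text \<open>Left multiplication by \<open>e * x * f\<close> is a nonzero map between the two right
  ideals. A quasi-inverse, compressed to the opposite corner, makes it an isomorphism from a
  complement of its kernel onto its image.\<close>

lemma nonzero_hom:
  assumes "idem e" "idem f" "x \<in> A" "e * x * f \<noteq> 0"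
  obtains a b where "idem a" "idem b" "e * a = a" "a * e = a" "f * b = b" "b * f = b" "a \<asymp> b" "a \<noteq> 0"
proof -
  define t where "t = e * x * f"
  have t: "t \<in> A" using assms by (auto simp: t_def)
  obtain c0 where c0: "c0 \<in> A" "t * c0 * t = t" using regular[OF t] by blast
  define c where "c = f * c0 * e"
  have c: "c \<in> A" using c0 assms by (auto simp: c_def)
  note ee = idem_mult[OF assms(1)] idem_mult[OF assms(2)]
  have te: "e * t = t" "t * f = t" "f * c = c" "c * e = c"
    using ee ee[THEN mult_assoc_subst] by (simp_all add: t_def c_def mult.assoc)
  have "t * c * t = (t * f) * c0 * (e * t)" by (simp add: c_def mult.assoc)
  then have tct: "t * c * t = t" using te c0 by simp
  show thesis
  proof (rule that[of "t * c" "c * t"])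
    show "idem (t * c)" "idem (c * t)" using quasi_inverse_idem[OF t c tct] by auto
    show "t * c \<asymp> c * t" by (rule quasi_inverse_eqv[OF t c tct])
    show "t * c \<noteq> 0" using tct assms(4) unfolding t_def[symmetric] by auto
  qed (use te te[THEN mult_assoc_subst] in \<open>simp_all add: mult.assoc\<close>)
qed

text \<open>In lattice terms \<open>V\<close> and \<open>Y\<close> are perspective with axis
  \<open>Z\<close>, and \<open>Z\<close> is the graph of the isomorphism up to sign. The conditions
  are symmetric in the three ideals and refer to the lattice alone, so chains of triples have
  suprema.\<close>

definition triple :: "'b set \<Rightarrow> 'b set \<Rightarrow> 'b set \<Rightarrow> bool" where
  "triple V Y Z \<longleftrightarrow> V \<in> L \<and> Y \<in> L \<and> Z \<in> L \<and> V \<inter> Y = {0} \<and> V \<inter> Z = {0} \<and> Y \<inter> Z = {0} \<and>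
     V \<subseteq> isum Y Z \<and> Y \<subseteq> isum V Z \<and> Z \<subseteq> isum V Y"

text \<open>The isomorphism is projection along \<open>Z\<close>: \<open>x\<close> comes from the
  component of \<open>b\<close> in the ideal of \<open>a\<close>, and \<open>y\<close> from that of
  \<open>a\<close> in the ideal of \<open>b\<close>. Going back and forth changes \<open>a\<close>
  by an element of \<open>Z\<close> that also lies in the ideal of \<open>a\<close>, hence by
  zero.\<close>

lemma triple_eqv:
  assumes "triple (right_ideal a) (right_ideal b) Z" "idem a" "idem b"
  shows "a \<asymp> b"
proof -
  have Z: "Z \<in> L" "right_ideal a \<inter> Z = {0}" "right_ideal b \<inter> Z = {0}"
    "right_ideal a \<subseteq> isum (right_ideal b) Z" "right_ideal b \<subseteq> isum (right_ideal a) Z"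
    using assms(1) by (auto simp: triple_def)
  have aA: "a \<in> A" "b \<in> A" using assms by auto
  obtain y0 c0 where y0: "y0 \<in> right_ideal b" "c0 \<in> Z" "a = y0 + c0"
    using Z(4) right_ideal_self[OF aA(1)] by (meson isumE subsetD)
  obtain x0 d0 where x0: "x0 \<in> right_ideal a" "d0 \<in> Z" "b = x0 + d0"
    using Z(5) right_ideal_self[OF aA(2)] by (meson isumE subsetD)
  define x y where "x = x0 * b" and "y = y0 * a"
  have xA: "x0 \<in> A" "y0 \<in> A" using x0 y0 aA right_ideal_in by blast+
  have xy: "x \<in> A" "y \<in> A" using xA aA by (auto simp: x_def y_def)
  have ax: "a * x = x" "b * y = y"
    using x0(1) y0(1) right_ideal_idem assms xA by (auto simp: x_def y_def mult_assoc_subst)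
  have xb: "x * b = x" "y * a = y"
    using assms idem_mult by (auto simp: x_def y_def mult.assoc)
  have "(y0 + c0) * a = a * a" "(x0 + d0) * b = b * b" using x0(3) y0(3) by auto
  then have "a - y = c0 * a" "b - x = d0 * b"
    using assms by (auto simp: x_def y_def idem_mult distrib_right algebra_simps)
  then have cZ: "a - y \<in> Z" "b - x \<in> Z" using L_mult Z(1) x0 y0 aA by auto
  have "(b - x) * y \<in> Z" "(a - y) * x \<in> Z" using cZ xy L_mult Z(1) by auto
  then have "(a - y) + (b - x) * y \<in> Z" "(b - x) + (a - y) * x \<in> Z" using cZ L_add Z(1) by auto
  then have "a - x * y \<in> Z" "b - y * x \<in> Z" using ax by (auto simp: algebra_simps)
  moreover have "a - x * y \<in> right_ideal a" "b - y * x \<in> right_ideal b"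
    using assms xy aA ax ax[THEN mult_assoc_subst] by (auto simp: right_ideal_idem algebra_simps idem_mult)
  ultimately have "a - x * y = 0" "b - y * x = 0" using Z by blast+
  then show ?thesis by (intro eqvI[OF xy] assms) auto
qed

text \<open>The axis is generated by \<open>a - y\<close>; it is the graph of minus the isomorphism
  given by \<open>y\<close>.\<close>

lemma eqv_triple:
  assumes "a \<asymp> b" "a * b = 0" "b * a = 0"
  shows "\<exists>Z. triple (right_ideal a) (right_ideal b) Z"
proof -
  obtain x y where x: "x \<in> A" "y \<in> A" "x * y = a" "y * x = b" "a * x = x" "x * b = x" "b * y = y" "y * a = y"
    using assms(1) by (rule eqvE)
  have i: "idem a" "idem b" using eqv_idem assms by auto
  then have aA: "a \<in> A" "b \<in> A" by auto
  have ay: "a * y = 0" using assms(2) x(7) by (metis mult.assoc mult_zero_left)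
  have bx: "b * x = 0" using assms(3) x(5) by (metis mult.assoc mult_zero_left)
  note R = x(3-8) assms(2,3) ay bx idem_mult[OF i(1)] idem_mult[OF i(2)]
  note RR = R R[THEN mult_assoc_subst]
  let ?Z = "right_ideal (a - y)"
  have 1: "right_ideal a \<inter> right_ideal b \<subseteq> {0}"
    using right_ideal_idem[OF i(1)] right_ideal_idem[OF i(2)] RR by (auto, metis mult_zero_left)
  have 2: "right_ideal a \<inter> ?Z \<subseteq> {0}"
  proof
    fix w assume w: "w \<in> right_ideal a \<inter> ?Z"
    then obtain s where s: "s \<in> A" "w = (a - y) * s" "a * w = w"
      using right_ideal_idem[OF i(1)] unfolding right_ideal_def by blast
    have "b * w = 0" using s(3) RR by (metis mult_zero_left)
    then have "y * s = 0" unfolding s(2) by (simp add: algebra_simps RR)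
    then have "a * s = 0" using x(3)[THEN mult_assoc_subst, of s] by simp
    then show "w \<in> {0}" using s(2) \<open>y * s = 0\<close> by (simp add: left_diff_distrib)
  qed
  have 3: "right_ideal b \<inter> ?Z \<subseteq> {0}"
  proof
    fix w assume w: "w \<in> right_ideal b \<inter> ?Z"
    then obtain s where s: "s \<in> A" "w = (a - y) * s" "b * w = w"
      using right_ideal_idem[OF i(2)] unfolding right_ideal_def by blast
    have "a * w = 0" using s(3) RR by (metis mult_zero_left)
    then have as: "a * s = 0" unfolding s(2) by (simp add: algebra_simps RR)
    then have "y * s = 0" using x(8)[THEN mult_assoc_subst, of s] by simp
    then show "w \<in> {0}" using s(2) as by (simp add: left_diff_distrib)
  qed
  have 4: "right_ideal a \<subseteq> isum (right_ideal b) ?Z"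
  proof
    fix w assume w: "w \<in> right_ideal a"
    then have wA: "w \<in> A" "a * w = w" using right_ideal_idem[OF i(1)] by auto
    have "w = b * (y * w) + (a - y) * w" using wA by (simp add: RR algebra_simps)
    then show "w \<in> isum (right_ideal b) ?Z" using isumI right_ideal_memI wA x by (metis mult_in)
  qed
  have 5: "right_ideal b \<subseteq> isum (right_ideal a) ?Z"
  proof
    fix w assume w: "w \<in> right_ideal b"
    then have wA: "w \<in> A" "b * w = w" using right_ideal_idem[OF i(2)] by auto
    have "w = a * (x * w) + (a - y) * (- (x * w))" using wA by (simp add: RR algebra_simps)
    then show "w \<in> isum (right_ideal a) ?Z" using isumI right_ideal_memI wA x by (metis mult_in uminus_in)
  qed
  have 6: "?Z \<subseteq> isum (right_ideal a) (right_ideal b)"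
  proof
    fix w assume w: "w \<in> ?Z"
    then obtain s where s: "s \<in> A" "w = (a - y) * s" unfolding right_ideal_def by blast
    have "w = a * s + b * (- (y * s))" using s by (simp add: RR algebra_simps)
    then show "w \<in> isum (right_ideal a) (right_ideal b)" using isumI right_ideal_memI s x by (metis mult_in uminus_in)
  qed
  have "triple (right_ideal a) (right_ideal b) ?Z"
    unfolding triple_def using 1 2 3 4 5 6 aA x by (auto simp: right_ideal_zero)
  then show ?thesis by blast
qed

text \<open>The sum of \<open>S\<close> and \<open>G\<close> is direct, so two decompositions of one
  element agree in each component.\<close>

lemma isum_disjoint:
  assumes "P \<in> L" "Q \<in> L" "P' \<in> L" "Q' \<in> L" "S \<in> L" "G \<in> L" "P \<subseteq> S" "Q \<subseteq> S" "P' \<subseteq> G" "Q' \<subseteq> G"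
    "G \<inter> S = {0}" "P \<inter> Q = {0}" "P' \<inter> Q' = {0}"
  shows "isum P P' \<inter> isum Q Q' = {0}"
proof -
  have "w = 0" if w: "w \<in> isum P P'" "w \<in> isum Q Q'" for w
  proof -
    obtain p p' where p: "p \<in> P" "p' \<in> P'" "w = p + p'" using w(1) by (rule isumE)
    obtain q q' where q: "q \<in> Q" "q' \<in> Q'" "w = q + q'" using w(2) by (rule isumE)
    have d: "p - q \<in> S" "q' - p' \<in> G" using p q assms(5-10) L_diff by (meson subsetD)+
    have "p = q + q' - p'" using p(3) q(3) by (metis add_diff_cancel_right')
    then have "p - q = q' - p'" by simp
    then have "p - q \<in> G \<inter> S" using d by simp
    then have "p - q = 0" unfolding assms(11) by simp
    then have pq: "p = q" by simp
    then have "p' = q'" using p(3) q(3) by simp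
    then have "p = 0" "p' = 0" using pq p(1,2) q(1,2) assms(12,13) by auto
    then show "w = 0" using p by simp
  qed
  moreover have "0 \<in> isum P P'" "0 \<in> isum Q Q'" using assms by auto
  ultimately show ?thesis by blast
qed

text \<open>The added triple lies in \<open>G\<close>, which is independent of the sum of the old
  one; this keeps the three pairwise intersections trivial.\<close>

lemma triple_isum:
  assumes "triple V Y Z" "triple V' Y' Z'" "G \<in> L" "V' \<subseteq> G" "Y' \<subseteq> G" "G \<inter> isum V Y = {0}"
  shows "triple (isum V V') (isum Y Y') (isum Z Z')"
proof -
  note t = assms(1)[unfolded triple_def] note t' = assms(2)[unfolded triple_def]
  have S: "isum V Y \<in> L" using t by auto
  have sub: "V \<subseteq> isum V Y" "Y \<subseteq> isum V Y" "Z \<subseteq> isum V Y"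
    using t isum_left[OF L_zero[of Y], of V] isum_right[OF L_zero[of V], of Y] by blast+
  have "isum V' Y' \<subseteq> G" by (rule isum_least[OF assms(3-5)])
  moreover have "Z' \<subseteq> isum V' Y'" using t' by (elim conjE)
  ultimately have Z': "Z' \<subseteq> G" by (rule order_trans[rotated])
  show ?thesis unfolding triple_def
  proof (intro conjI)
    note disj = isum_disjoint[where S = "isum V Y" and G = G]
    show "isum V V' \<inter> isum Y Y' = {0}" by (rule disj) (use t t' S sub Z' assms(3-6) in simp_all)
    show "isum V V' \<inter> isum Z Z' = {0}" by (rule disj) (use t t' S sub Z' assms(3-6) in simp_all)
    show "isum Y Y' \<inter> isum Z Z' = {0}" by (rule disj) (use t t' S sub Z' assms(3-6) in simp_all)
    show "isum V V' \<subseteq> isum (isum Y Y') (isum Z Z')" "isum Y Y' \<subseteq> isum (isum V V') (isum Z Z')"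
       "isum Z Z' \<subseteq> isum (isum V V') (isum Y Y')"
      using t t' by (simp_all add: isum_isum_subset)
  qed (use t t' in \<open>simp_all only: isum_L\<close>)
qed

section \<open>Suprema, infima and continuity\<close>

definition is_lub :: "'b set set \<Rightarrow> 'b set \<Rightarrow> bool" where
  "is_lub C s \<longleftrightarrow> s \<in> L \<and> (\<forall>I\<in>C. I \<subseteq> s) \<and> (\<forall>t\<in>L. (\<forall>I\<in>C. I \<subseteq> t) \<longrightarrow> s \<subseteq> t)"

definition is_glb :: "'b set set \<Rightarrow> 'b set \<Rightarrow> bool" where
  "is_glb C s \<longleftrightarrow> s \<in> L \<and> (\<forall>I\<in>C. s \<subseteq> I) \<and> (\<forall>t\<in>L. (\<forall>I\<in>C. t \<subseteq> I) \<longrightarrow> t \<subseteq> s)"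

lemma is_lub_in: "is_lub C s \<Longrightarrow> s \<in> L"
  and is_lub_upper: "is_lub C s \<Longrightarrow> I \<in> C \<Longrightarrow> I \<subseteq> s"
  and is_lub_least: "is_lub C s \<Longrightarrow> t \<in> L \<Longrightarrow> (\<And>I. I \<in> C \<Longrightarrow> I \<subseteq> t) \<Longrightarrow> s \<subseteq> t"
  by (simp_all add: is_lub_def)

lemma is_glb_in: "is_glb C s \<Longrightarrow> s \<in> L"
  and is_glb_lower: "is_glb C s \<Longrightarrow> I \<in> C \<Longrightarrow> s \<subseteq> I"
  and is_glb_greatest: "is_glb C s \<Longrightarrow> t \<in> L \<Longrightarrow> (\<And>I. I \<in> C \<Longrightarrow> t \<subseteq> I) \<Longrightarrow> t \<subseteq> s"
  by (simp_all add: is_glb_def)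

end

text \<open>The last two axioms are the continuity laws with meets and joins eliminated: lying below
  a meet is replaced by lying below both sides, and \<open>t\<close> stands for any bound of the
  family on the right-hand side. Only the inequality that can fail in a complete lattice is
  expressed.\<close>

locale continuous_subring = regular_subring A u for A :: "'b :: ring set" and u +
  assumes lub_ex: "C \<subseteq> L \<Longrightarrow> \<exists>s. is_lub C s"
    and glb_ex: "C \<subseteq> L \<Longrightarrow> \<exists>s. is_glb C s"
    and meet_lub: "\<lbrakk>C \<subseteq> L; chain\<^sub>\<subseteq> C; is_lub C s; I \<in> L; t \<in> L;
          \<And>J K. J \<in> C \<Longrightarrow> K \<in> L \<Longrightarrow> K \<subseteq> I \<Longrightarrow> K \<subseteq> J \<Longrightarrow> K \<subseteq> t; K \<in> L; K \<subseteq> I; K \<subseteq> s\<rbrakk> \<Longrightarrow> K \<subseteq> t"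
    and join_glb: "\<lbrakk>C \<subseteq> L; chain\<^sub>\<subseteq> C; is_glb C s; I \<in> L; t \<in> L;
          \<And>J K. J \<in> C \<Longrightarrow> K \<in> L \<Longrightarrow> I \<subseteq> K \<Longrightarrow> J \<subseteq> K \<Longrightarrow> t \<subseteq> K; K \<in> L; I \<subseteq> K; s \<subseteq> K\<rbrakk> \<Longrightarrow> t \<subseteq> K"
begin

lemma lub_disjoint:
  assumes "C \<subseteq> L" "chain\<^sub>\<subseteq> C" "is_lub C s" "V \<in> L" "\<And>J. J \<in> C \<Longrightarrow> V \<inter> J = {0}"
  shows "V \<inter> s = {0}"
proof -
  have "x = 0" if x: "x \<in> V" "x \<in> s" for x
  proof -
    have s: "s \<in> L" using assms(3) by (simp add: is_lub_def)
    have "right_ideal x \<subseteq> {0}"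
    proof (rule meet_lub[OF assms(1-4)])
      show "{0} \<in> L" using right_ideal_L[of 0] by simp
      show "K \<subseteq> {0}" if "J \<in> C" "K \<subseteq> V" "K \<subseteq> J" for J K
        using Int_greatest[OF that(2,3)] assms(5)[OF that(1)] by simp
      show "right_ideal x \<in> L" "right_ideal x \<subseteq> V" "right_ideal x \<subseteq> s"
        using right_ideal_L[OF L_subset[OF s x(2)]] L_right_ideal_subset[OF assms(4) x(1)] L_right_ideal_subset[OF s x(2)] by simp_all
    qed
    then show "x = 0" using right_ideal_self[OF L_subset[OF assms(4) x(1)]] by auto
  qed
  moreover have "s \<in> L" using assms(3) by (simp add: is_lub_def)
  ultimately show ?thesis using L_zero[OF assms(4)] L_zero[of s] by auto
qed

lemma glb_isum:
  assumes "C \<subseteq> L" "chain\<^sub>\<subseteq> C" "is_glb C s" "V \<in> L" "x \<in> A" "\<And>J. J \<in> C \<Longrightarrow> x \<in> isum V J"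
  shows "x \<in> isum V s"
proof -
  have s: "s \<in> L" using assms(3) by (simp add: is_glb_def)
  have "right_ideal x \<subseteq> isum V s"
  proof (rule join_glb[OF assms(1-4)])
    show "right_ideal x \<subseteq> K" if "J \<in> C" "K \<in> L" "V \<subseteq> K" "J \<subseteq> K" for J K
      using L_right_ideal_subset[OF that(2)] subsetD[OF isum_least[OF that(2-4)] assms(6)[OF that(1)]] by simp
    show "V \<subseteq> isum V s" "s \<subseteq> isum V s"
      using isum_left[OF L_zero[OF s]] isum_right[OF L_zero[OF assms(4)]] by blast+
  qed (use assms s in auto)
  then show ?thesis using right_ideal_self[OF assms(5)] by auto
qed

text \<open>A triple is stored as one set of tagged elements, so that Zorn's lemma for inclusion
  applies. The bound of a chain is the lattice supremum in each component, not the union;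
  independence survives by \<open>lub_disjoint\<close>. Maximality is recorded for the first
  component, which every later extension enlarges.\<close>

lemma maximal_triple:
  assumes "X0 \<in> L" "Y0 \<in> L"
  obtains V Y Z where "triple V Y Z" "V \<subseteq> X0" "Y \<subseteq> Y0"
    "\<And>V' Y' Z'. triple V' Y' Z' \<Longrightarrow> V' \<subseteq> X0 \<Longrightarrow> Y' \<subseteq> Y0 \<Longrightarrow> V \<subseteq> V' \<Longrightarrow> Y \<subseteq> Y' \<Longrightarrow> Z \<subseteq> Z' \<Longrightarrow> V' = V"
proof -
  define enc :: "'b set \<Rightarrow> 'b set \<Rightarrow> 'b set \<Rightarrow> (nat \<times> 'b) set"
    where "enc V Y Z = {0} \<times> V \<union> {1} \<times> Y \<union> {2} \<times> Z" for V Y Z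
  define pr :: "nat \<Rightarrow> (nat \<times> 'b) set \<Rightarrow> 'b set" where "pr i M = {x. (i, x) \<in> M}" for i M
  have pr_enc [simp]: "pr 0 (enc V Y Z) = V" "pr (Suc 0) (enc V Y Z) = Y" "pr 2 (enc V Y Z) = Z" for V Y Z
    by (auto simp: pr_def enc_def)
  have pr_mono: "M \<subseteq> N \<Longrightarrow> pr i M \<subseteq> pr i N" for M N i by (auto simp: pr_def)
  have enc_mono: "enc V Y Z \<subseteq> enc V' Y' Z' \<longleftrightarrow> V \<subseteq> V' \<and> Y \<subseteq> Y' \<and> Z \<subseteq> Z'" for V Y Z V' Y' Z'
    by (auto simp: enc_def)
  define S where "S = {enc V Y Z | V Y Z. triple V Y Z \<and> V \<subseteq> X0 \<and> Y \<subseteq> Y0}"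
  have "\<exists>U\<in>S. \<forall>M\<in>C. M \<subseteq> U" if "subset.chain S C" for C
  proof -
    have CS: "C \<subseteq> S" and ch: "\<And>M N. M \<in> C \<Longrightarrow> N \<in> C \<Longrightarrow> M \<subseteq> N \<or> N \<subseteq> M"
      using that by (auto simp: subset_chain_def)
    have tr: "triple (pr 0 M) (pr (Suc 0) M) (pr 2 M)" "pr 0 M \<subseteq> X0" "pr (Suc 0) M \<subseteq> Y0"
      "M = enc (pr 0 M) (pr (Suc 0) M) (pr 2 M)" if "M \<in> C" for M
    proof -
      obtain V Y Z where "M = enc V Y Z" "triple V Y Z" "V \<subseteq> X0" "Y \<subseteq> Y0"
        using CS \<open>M \<in> C\<close> unfolding S_def by blast
      then show "triple (pr 0 M) (pr (Suc 0) M) (pr 2 M)" "pr 0 M \<subseteq> X0" "pr (Suc 0) M \<subseteq> Y0"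
        "M = enc (pr 0 M) (pr (Suc 0) M) (pr 2 M)" by simp_all
    qed
    have prL: "(pr i) ` C \<subseteq> L" if "i \<in> {0, Suc 0, 2}" for i
    proof (rule image_subsetI)
      fix M assume "M \<in> C"
      from tr(1)[OF this] show "pr i M \<in> L" using that unfolding triple_def by (elim insertE) simp_all
    qed
    have prc: "chain\<^sub>\<subseteq> (pr i ` C)" for i
    proof (unfold chain_subset_def, intro ballI, elim imageE)
      fix V W M N assume "V = pr i M" "W = pr i N" "M \<in> C" "N \<in> C"
      then show "V \<subseteq> W \<or> W \<subseteq> V" using ch[of M N] pr_mono[of M N i] pr_mono[of N M i] by argo
    qed
    obtain s0 s1 s2 where s: "is_lub (pr 0 ` C) s0" "is_lub (pr (Suc 0) ` C) s1" "is_lub (pr 2 ` C) s2"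
      using lub_ex prL by (metis insertCI)
    have sL: "s0 \<in> L" "s1 \<in> L" "s2 \<in> L" using s by (auto simp: is_lub_def)
    have ub: "pr 0 M \<subseteq> s0" "pr (Suc 0) M \<subseteq> s1" "pr 2 M \<subseteq> s2" if "M \<in> C" for M
      using s that by (auto simp: is_lub_def)
    have disj: "si \<inter> sj = {0}"
      if ij: "i \<in> {0, Suc 0, 2}" "j \<in> {0, Suc 0, 2}" "\<And>M. M \<in> C \<Longrightarrow> pr i M \<inter> pr j M = {0}"
        "is_lub (pr i ` C) si" "is_lub (pr j ` C) sj" for i j si sj
    proof -
      \<comment> \<open>Components of two different members of the chain must be independent as
        well; the larger of the two members decides.\<close>
      have mn: "pr i M \<inter> pr j N = {0}" if "M \<in> C" "N \<in> C" for M N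
      proof -
        have "pr i M \<inter> pr j N \<subseteq> {0}" using ch[OF that]
        proof
          assume "M \<subseteq> N" then show ?thesis using pr_mono[of M N i] ij(3)[OF that(2)] by blast
        next
          assume "N \<subseteq> M" then show ?thesis using pr_mono[of N M j] ij(3)[OF that(1)] by blast
        qed
        moreover have "0 \<in> pr i M" "0 \<in> pr j N"
          using L_zero[OF subsetD[OF prL[OF ij(1)]]] L_zero[OF subsetD[OF prL[OF ij(2)]]] that by blast+
        ultimately show ?thesis by (intro subset_antisym) simp_all
      qed
      have siL: "si \<in> L" using ij by (auto simp: is_lub_def)
      have "pr j N \<inter> si = {0}" if "N \<in> C" for N
      proof (rule lub_disjoint[OF prL[OF ij(1)] prc ij(4)])
        show "pr j N \<in> L" using subsetD[OF prL[OF ij(2)]] that by simp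
        show "pr j N \<inter> J = {0}" if "J \<in> pr i ` C" for J
          using that mn[OF _ \<open>N \<in> C\<close>] by (metis Int_commute imageE)
      qed
      then have "J \<in> pr j ` C \<Longrightarrow> si \<inter> J = {0}" for J by (auto simp: Int_commute)
      then show ?thesis
        by (rule lub_disjoint[OF prL[OF ij(2)] prc ij(5) siL])
    qed
    have incl: "s0 \<subseteq> isum s1 s2" "s1 \<subseteq> isum s0 s2" "s2 \<subseteq> isum s0 s1"
    proof -
      have "pr 0 M \<subseteq> isum s1 s2" "pr (Suc 0) M \<subseteq> isum s0 s2" "pr 2 M \<subseteq> isum s0 s1" if "M \<in> C" for M
      proof -
        have ti: "pr 0 M \<subseteq> isum (pr (Suc 0) M) (pr 2 M)" "pr (Suc 0) M \<subseteq> isum (pr 0 M) (pr 2 M)"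
          "pr 2 M \<subseteq> isum (pr 0 M) (pr (Suc 0) M)" using tr(1)[OF that] unfolding triple_def by simp_all
        show "pr 0 M \<subseteq> isum s1 s2" "pr (Suc 0) M \<subseteq> isum s0 s2" "pr 2 M \<subseteq> isum s0 s1"
          using subset_trans[OF ti(1) isum_mono[OF ub(2,3)[OF that]]] subset_trans[OF ti(2) isum_mono[OF ub(1,3)[OF that]]]
            subset_trans[OF ti(3) isum_mono[OF ub(1,2)[OF that]]] by simp_all
      qed
      note H = this
      show "s0 \<subseteq> isum s1 s2" by (rule is_lub_least[OF s(1) isum_L[OF sL(2,3)]]) (metis H(1) imageE)
      show "s1 \<subseteq> isum s0 s2" by (rule is_lub_least[OF s(2) isum_L[OF sL(1,3)]]) (metis H(2) imageE)
      show "s2 \<subseteq> isum s0 s1" by (rule is_lub_least[OF s(3) isum_L[OF sL(1,2)]]) (metis H(3) imageE)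
    qed
    have trd: "pr 0 M \<inter> pr (Suc 0) M = {0}" "pr 0 M \<inter> pr 2 M = {0}" "pr (Suc 0) M \<inter> pr 2 M = {0}" if "M \<in> C" for M
      using tr(1)[OF that] unfolding triple_def by simp_all
    have "s0 \<inter> s1 = {0}" by (rule disj[OF _ _ trd(1) s(1,2)]) simp_all
    moreover have "s0 \<inter> s2 = {0}" by (rule disj[OF _ _ trd(2) s(1,3)]) simp_all
    moreover have "s1 \<inter> s2 = {0}" by (rule disj[OF _ _ trd(3) s(2,3)]) simp_all
    ultimately have "triple s0 s1 s2" unfolding triple_def using sL incl by simp
    moreover have "s0 \<subseteq> X0" by (rule is_lub_least[OF s(1) assms(1)]) (metis tr(2) imageE)
    moreover have "s1 \<subseteq> Y0" by (rule is_lub_least[OF s(2) assms(2)]) (metis tr(3) imageE)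
    ultimately have "enc s0 s1 s2 \<in> S" unfolding S_def by blast
    moreover have "M \<subseteq> enc s0 s1 s2" if "M \<in> C" for M
      by (subst tr(4)[OF that]) (use ub[OF that] enc_mono in simp)
    ultimately show ?thesis by blast
  qed
  from subset_Zorn[OF this] obtain M where M: "M \<in> S" "\<And>N. N \<in> S \<Longrightarrow> M \<subseteq> N \<Longrightarrow> N = M"
    by metis
  then obtain V Y Z where V: "M = enc V Y Z" "triple V Y Z" "V \<subseteq> X0" "Y \<subseteq> Y0" unfolding S_def by blast
  show thesis
  proof (rule that[OF V(2-4)])
    fix V' Y' Z' assume *: "triple V' Y' Z'" "V' \<subseteq> X0" "Y' \<subseteq> Y0" "V \<subseteq> V'" "Y \<subseteq> Y'" "Z \<subseteq> Z'"
    have "enc V' Y' Z' \<in> S" unfolding S_def using *(1-3) by blast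
    moreover have "M \<subseteq> enc V' Y' Z'" using V(1) enc_mono *(4-6) by simp
    ultimately have "enc V' Y' Z' = enc V Y Z" using M(2) V(1) by simp
    then show "V' = V" using pr_enc(1)[of V' Y' Z'] pr_enc(1)[of V Y Z] by simp
  qed
qed

end

section \<open>Finiteness, comparability and halving\<close>

context continuous_subring
begin

text \<open>Let \<open>x i\<close> carry \<open>e i\<close> to the next copy. The differences of
  \<open>e i\<close> and \<open>x i\<close> generate ideals whose supremum \<open>M\<close> is
  independent of \<open>e 0\<close>, by upper continuity. Modulo \<open>M\<close>, the idempotent
  \<open>e 0\<close> can be pushed along the sequence into every tail. The tails have infimum zero,
  so lower continuity puts \<open>e 0\<close> into \<open>M\<close>.\<close>

lemma no_infinite_copies:
  fixes e :: "nat \<Rightarrow> 'b"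
  assumes idem: "\<And>i. idem (e i)" and orth: "\<And>i j. i \<noteq> j \<Longrightarrow> e i * e j = 0"
    and eqv: "\<And>i. e i \<asymp> e (Suc i)"
  shows "e 0 = 0"
proof -
  have "\<exists>x y. x \<in> A \<and> y \<in> A \<and> y * x = e i \<and> e (Suc i) * x = x \<and> x * e i = x" for i
    using eqv[of i] unfolding eqv_def by blast
  then obtain x y where xy: "\<And>i. x i \<in> A" "\<And>i. y i \<in> A" "\<And>i. y i * x i = e i" "\<And>i. e (Suc i) * x i = x i" "\<And>i. x i * e i = x i"
    by metis
  have eA [simp]: "e i \<in> A" for i using idem by blast
  have ee: "e i * e j = (if i = j then e i else 0)" for i j using idem idem_mult orth by auto
  have xe: "x i * e j = (if i = j then x i else 0)" for i j
    using ee[of i j] xy(5)[of i] by (metis mult.assoc mult_zero_right)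
  have ex: "e (Suc j) * x i = (if i = j then x i else 0)" for i j
    using ee[of "Suc j" "Suc i"] xy(4)[of i] by (auto, metis mult.assoc mult_zero_left)
  define S where "S T = sum e T" for T
  have SA [simp]: "S T \<in> A" for T unfolding S_def by (intro sum_in) simp
  have eS: "e i * S T = (if i \<in> T then e i else 0)" if "finite T" for i T
    using that by (simp add: S_def sum_distrib_left ee)
  have Se: "S T * e i = (if i \<in> T then e i else 0)" if "finite T" for i T
    using that by (simp add: S_def sum_distrib_right ee)
  have SS: "S T * S T' = S (T \<inter> T')" if "finite T" "finite T'" for T T'
  proof -
    have "S T * S T' = (\<Sum>i\<in>T. if i \<in> T' then e i else 0)"
      using that by (simp add: S_def[of T] sum_distrib_right eS)
    also have "\<dots> = S (T \<inter> T')" using that by (simp add: S_def sum.inter_restrict)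
    finally show ?thesis .
  qed
  have Sidem: "idem (S T)" if "finite T" for T using SS[OF that that] by (auto intro: idemI)
  have Sdisj: "right_ideal (S T) \<inter> right_ideal (S T') = {0}" if "finite T" "finite T'" "T \<inter> T' = {}" for T T'
  proof -
    have "w = 0" if "S T * w = w" "S T' * w = w" for w
    proof -
      have "w = S T * (S T' * w)" using that by simp
      also have "\<dots> = (S T * S T') * w" by (simp add: mult.assoc)
      also have "\<dots> = 0" using SS \<open>finite T\<close> \<open>finite T'\<close> \<open>T \<inter> T' = {}\<close> by (simp add: S_def)
      finally show ?thesis .
    qed
    then show ?thesis
      using right_ideal_idem[OF Sidem[OF that(1)]] right_ideal_idem[OF Sidem[OF that(2)]]
        right_ideal_zero[of "S T"] right_ideal_zero[of "S T'"] by auto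
  qed
  have Smono: "right_ideal (S T) \<subseteq> right_ideal (S T')" if "finite T'" "T \<subseteq> T'" for T T'
  proof -
    have "finite T" using that finite_subset by blast
    then have "S T' * S T = S T" using SS that by (simp add: inf.absorb2)
    then show ?thesis using right_ideal_least right_ideal_memI[of "S T" "S T'"] by simp
  qed
  define c where "c n = (\<Sum>i<n. e i - x i)" for n
  have cA [simp]: "c n \<in> A" for n unfolding c_def by (intro sum_in) (auto simp: xy)
  have cSuc: "c (Suc n) = c n + (e n - x n)" for n by (simp add: c_def)
  have ce: "c n * e j = (if j < n then e j - x j else 0)" for n j
    by (induction n) (auto simp: c_def distrib_right left_diff_distrib ee xe less_Suc_eq)
  have cS: "c (Suc n) * S {..<n} = c n" for n
  proof -
    have "c (Suc n) * S {..<n} = (\<Sum>j<n. e j - x j)" by (simp add: S_def sum_distrib_left ce)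
    then show ?thesis by (simp add: c_def)
  qed
  have ec: "e (Suc n) * c (Suc n) = - x n" for n
  proof -
    have "e (Suc n) * c (Suc n) = (\<Sum>i<Suc n. if i = n then - x n else 0)"
      unfolding c_def sum_distrib_left
      by (rule sum.cong) (auto simp: right_diff_distrib ee ex)
    then show ?thesis by simp
  qed
  \<comment> \<open>The last component of \<open>c n * s\<close> must vanish because
    \<open>w\<close> lives on \<open>e 0\<close>; peeling off one index at a time leaves the empty
    sum.\<close>
  have c0: "w = 0" if "e 0 * w = w" "w = c n * s" for n w s using that
  proof (induction n)
    case 0 then show ?case by (simp add: c_def)
  next
    case (Suc n)
    have "e (Suc n) * w = e (Suc n) * (e 0 * w)" using Suc.prems by simp
    also have "\<dots> = 0" using ee[of "Suc n" 0] by (simp add: mult_assoc_subst)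
    finally have "x n * s = 0" unfolding Suc.prems(2) using ec[of n] by (simp add: mult_assoc_subst)
    then have "e n * s = 0" using xy(3)[THEN mult_assoc_subst, of n s] by simp
    then have "w = c n * s" using Suc.prems(2) \<open>x n * s = 0\<close> by (simp add: cSuc distrib_right left_diff_distrib)
    then show ?case using Suc by blast
  qed
  have chain: "chain\<^sub>\<subseteq> (range F)" if "\<And>n. F n \<subseteq> F (Suc n)" for F :: "nat \<Rightarrow> 'b set"
  proof (unfold chain_subset_def, intro ballI, elim rangeE)
    fix V W n m assume "V = F n" "W = F m"
    then show "V \<subseteq> W \<or> W \<subseteq> V"
      using nat_le_linear[of n m] lift_Suc_mono_le[of F n m, OF that] lift_Suc_mono_le[of F m n, OF that] by argo
  qed
  have chain': "chain\<^sub>\<subseteq> (range F)" if "\<And>n. F (Suc n) \<subseteq> F n" for F :: "nat \<Rightarrow> 'b set"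
  proof (unfold chain_subset_def, intro ballI, elim rangeE)
    fix V W n m assume "V = F n" "W = F m"
    then show "V \<subseteq> W \<or> W \<subseteq> V"
      using nat_le_linear[of n m] lift_Suc_antimono_le[of F n m, OF that] lift_Suc_antimono_le[of F m n, OF that] by argo
  qed
  define RC where "RC n = right_ideal (c n)" for n
  have RC: "range RC \<subseteq> L" by (auto simp: RC_def)
  have RCmono: "RC n \<subseteq> RC (Suc n)" for n
    unfolding RC_def using right_ideal_memI[of "S {..<n}" "c (Suc n)"] cS by (intro right_ideal_least) auto
  obtain M where M: "is_lub (range RC) M" using lub_ex RC by blast
  have M_in: "M \<in> L" using is_lub_in[OF M] .
  have e0M: "right_ideal (e 0) \<inter> M = {0}"
  proof (rule lub_disjoint[OF RC chain[of RC, OF RCmono] M])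
    fix J assume "J \<in> range RC"
    then obtain n where J: "J = right_ideal (c n)" by (auto simp: RC_def)
    have "w = 0" if w: "w \<in> right_ideal (e 0)" "w \<in> right_ideal (c n)" for w
    proof -
      obtain s where "w = c n * s" using w(2) by (auto simp: right_ideal_def)
      then show ?thesis using c0[of w n s] w(1) right_ideal_idem[OF idem] by simp
    qed
    then show "right_ideal (e 0) \<inter> J = {0}"
      unfolding J using right_ideal_zero[of "e 0"] right_ideal_zero[of "c n"] by auto
  qed auto
  define T where "T n m = right_ideal (S {n..<m})" for n m
  have TL: "range (T n) \<subseteq> L" for n by (auto simp: T_def)
  have Tmono: "T n m \<subseteq> T n (Suc m)" for n m unfolding T_def by (rule Smono) auto
  have "\<exists>B. is_lub (range (T n)) B" for n using lub_ex TL by blast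
  then obtain B where B: "\<And>n. is_lub (range (T n)) (B n)" by metis
  have BL: "B n \<in> L" for n using is_lub_in[OF B] .
  have TB: "T n m \<subseteq> B n" for n m using is_lub_upper[OF B] by simp
  have Bmono: "B (Suc n) \<subseteq> B n" for n
  proof -
    have "T (Suc n) m \<subseteq> T n m" for m unfolding T_def by (rule Smono) auto
    then have "T (Suc n) m \<subseteq> B n" for m using TB[of n m] by (rule order_trans)
    then show ?thesis by (intro is_lub_least[OF B BL]) auto
  qed
  have BRL: "range B \<subseteq> L" using BL by auto
  obtain D where D: "is_glb (range B) D" using glb_ex BRL by blast
  have DL: "D \<in> L" and DB: "\<And>n. D \<subseteq> B n"
    using is_glb_in[OF D] is_glb_lower[OF D] by auto
  \<comment> \<open>The first \<open>n\<close> copies are independent of the tail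
    \<open>B n\<close>, hence of \<open>D\<close>. The supremum over \<open>n\<close> makes
    \<open>D\<close> independent of \<open>B 0\<close>, which contains it.\<close>
  have "D \<inter> T 0 n = {0}" for n
  proof -
    have "T 0 n \<inter> B n = {0}"
    proof (rule lub_disjoint[OF TL chain[of "T n"] B])
      show "T n m \<subseteq> T n (Suc m)" for m by (rule Tmono)
      show "T 0 n \<in> L" by (auto simp: T_def)
      show "T 0 n \<inter> J = {0}" if "J \<in> range (T n)" for J
        using that Sdisj[of "{0..<n}" "{n..<m}" for m] by (auto simp: T_def)
    qed
    then show ?thesis using DB[of n] L_zero[OF DL] by auto
  qed
  then have "D \<inter> B 0 = {0}"
    by (intro lub_disjoint[OF TL[of 0] chain[of "T 0", OF Tmono] B DL]) auto
  then have D0: "D = {0}" using DB[of 0] L_zero[OF DL] by auto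
  \<comment> \<open>Telescoping: \<open>e 0\<close> is moved onto the \<open>n\<close>-th copy at
    the cost of an element of the ideal of \<open>c n\<close>.\<close>
  have "\<exists>s\<in>A. \<exists>z\<in>A. e 0 = c n * s + e n * z" for n
  proof (induction n)
    case 0 then show ?case by (intro bexI[of _ 0] bexI[of _ "e 0"]) (auto simp: ee)
  next
    case (Suc n)
    then obtain s z where s: "s \<in> A" "z \<in> A" "e 0 = c n * s + e n * z" by blast
    have "c (Suc n) * (S {..<n} * s + e n * z) + e (Suc n) * (x n * z) = c n * s + (e n - x n) * z + x n * z"
      by (simp add: distrib_left mult.assoc[symmetric] cS ce xy)
    also have "\<dots> = e 0" using s(3) by (simp add: left_diff_distrib)
    finally show ?case using s xy by (intro bexI[of _ "S {..<n} * s + e n * z"] bexI[of _ "x n * z"]) auto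
  qed
  moreover have "c n * s \<in> M" if "s \<in> A" for n s
    using subsetD[OF is_lub_upper[OF M, of "RC n"]] right_ideal_memI[OF that, of "c n"] by (simp add: RC_def)
  moreover have "e n * z \<in> B n" if "z \<in> A" for n z
  proof -
    have "e n * z \<in> T n (Suc n)" unfolding T_def using right_ideal_memI[OF that, of "e n"] by (simp add: S_def)
    then show ?thesis using TB[of n "Suc n"] by auto
  qed
  ultimately have "e 0 \<in> isum M (B n)" for n by (metis isumI)
  then have "e 0 \<in> isum M D"
    by (intro glb_isum[OF BRL chain'[of B, OF Bmono] D M_in]) auto
  then have "e 0 \<in> M" unfolding D0 by (auto elim: isumE)
  then show ?thesis using e0M right_ideal_self[of "e 0"] by auto
qed

text \<open>Repeated conjugation by the isomorphism turns the defect \<open>e - f\<close> into an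
  infinite sequence of orthogonal equivalent idempotents.\<close>

lemma directly_finite:
  assumes "e \<asymp> f" "e * f = f" "f * e = f"
  shows "f = e"
proof -
  obtain x y where x: "x \<in> A" "y \<in> A" "x * y = e" "y * x = f" "e * x = x" "x * f = x" "f * y = y" "y * e = y"
    using assms(1) by (rule eqvE)
  have i: "idem e" "idem f" using eqv_idem assms by auto
  define g where "g n = ((\<lambda>w. y * w * x) ^^ n) (e - f)" for n
  have g0: "g 0 = e - f" and gS: "g (Suc n) = y * g n * x" for n by (auto simp: g_def)
  have xe: "x * e = x"
  proof -
    have "x * e = x * (f * e)" using x by (simp add: mult.assoc[symmetric])
    also have "\<dots> = x" using x assms(3) by simp
    finally show ?thesis .
  qed
  have ey: "e * y = y"
  proof -
    have "e * y = (e * f) * y" using x by (simp add: mult.assoc)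
    also have "\<dots> = y" using x assms(2) by simp
    finally show ?thesis .
  qed
  have 1: "idem (g n) \<and> g n * e = g n \<and> e * g n = g n" for n
  proof (induction n)
    case 0 then show ?case unfolding g0 using idem_diff[OF i assms(2,3)] by auto
  next
    case (Suc n)
    have gn: "g n \<in> A" "g n * g n = g n" "g n * e = g n" using Suc idem_mult by auto
    have "g (Suc n) * g (Suc n) = y * (g n * (x * y)) * g n * x" by (simp add: gS mult.assoc)
    also have "\<dots> = y * (g n * g n) * x" using gn x by (simp add: mult.assoc)
    finally have "g (Suc n) * g (Suc n) = g (Suc n)" using gn gS by simp
    moreover have "g (Suc n) * e = g (Suc n)" using xe gS by (simp add: mult.assoc)
    moreover have "e * g (Suc n) = (e * y) * g n * x" by (simp only: gS mult.assoc)
    then have "e * g (Suc n) = g (Suc n)" by (simp only: ey gS)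
    ultimately show ?case using gn x gS by (auto intro!: idemI)
  qed
  have zero: "(e - f) * y = 0" "x * (e - f) = 0" using ey x xe by (auto simp: algebra_simps)
  have 2: "g n * g (n + Suc k) = 0 \<and> g (n + Suc k) * g n = 0" for n k
  proof (induction n)
    case 0
    have "g 0 * g (Suc k) = ((e - f) * y) * g k * x" "g (Suc k) * g 0 = y * g k * (x * (e - f))"
      by (simp_all only: g0 gS mult.assoc)
    then show ?case using zero by simp
  next
    case (Suc n)
    have "g (Suc n) * g (Suc n + Suc k) = y * (g n * (x * y)) * g (n + Suc k) * x"
      "g (Suc n + Suc k) * g (Suc n) = y * (g (n + Suc k) * (x * y)) * g n * x"
      by (simp_all add: gS mult.assoc)
    moreover have "g n * (x * y) = g n" "g (n + Suc k) * (x * y) = g (n + Suc k)" using 1 x by auto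
    ultimately have "g (Suc n) * g (Suc n + Suc k) = y * (g n * g (n + Suc k)) * x"
      "g (Suc n + Suc k) * g (Suc n) = y * (g (n + Suc k) * g n) * x" by (simp_all only: mult.assoc)
    then show ?case using Suc by simp
  qed
  have "g 0 = 0"
  proof (rule no_infinite_copies)
    show "g i * g j = 0" if "i \<noteq> j" for i j
    proof (cases "i < j")
      case True then show ?thesis using 2[of i "j - Suc i"] by auto
    next
      case False then show ?thesis using that 2[of j "i - Suc j"] by auto
    qed
    show "g i \<asymp> g (Suc i)" for i
    proof (rule eqvI[of "g i * x" "y * g i"])
      have "g i * x * (y * g i) = (g i * (x * y)) * g i" by (simp only: mult.assoc)
      then show "g i * x * (y * g i) = g i" using 1[of i] x idem_mult by auto
      have "y * g i * (g i * x) = y * (g i * g i) * x" by (simp only: mult.assoc)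
      then show "y * g i * (g i * x) = g (Suc i)" using 1[of i] idem_mult gS by auto
    qed (use 1 x in auto)
  qed (use 1 in auto)
  then show ?thesis using g0 by simp
qed

lemma below_proper:
  assumes "idem e" "idem f" "f * e = e" "e * f = e" "f \<preceq> e"
  shows "e = f"
proof -
  obtain e' where e': "idem e'" "e * e' = e'" "e' * e = e'" "f \<asymp> e'" using below_subidem assms by metis
  have "f * e' = e'" "e' * f = e'" using e' assms by (metis mult.assoc)+
  then have "e' = f" using directly_finite e' by blast
  then show ?thesis using e' assms by simp
qed

definition atom :: "'b \<Rightarrow> bool" where
  "atom a \<longleftrightarrow> idem a \<and> a \<noteq> 0 \<and> (\<forall>b. idem b \<longrightarrow> a * b = b \<longrightarrow> b * a = b \<longrightarrow> b = 0 \<or> b = a)"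

end

section \<open>Irreducibility: primeness, comparability and halving\<close>

locale irreducible_continuous_subring = continuous_subring A u for A :: "'b :: ring set" and u +
  assumes unit_nonzero: "u \<noteq> 0"
    and central_idem: "idem c \<Longrightarrow> (\<And>x. x \<in> A \<Longrightarrow> c * x = x * c) \<Longrightarrow> c = 0 \<or> c = u"
begin

text \<open>The elements annihilated by all \<open>e * x\<close> form an infimum of principal right
  ideals, hence a principal one, and this ideal is two-sided. By regularity its idempotent generator
  is central, so irreducibility leaves only 0 and \<open>u\<close> for it.\<close>

lemma prime:
  assumes "idem e" "f \<in> A" "\<And>x. x \<in> A \<Longrightarrow> e * x * f = 0"
  shows "e = 0 \<or> f = 0"
proof -
  define rann where "rann t = {x \<in> A. t * x = 0}" for t
  have rannL: "rann t \<in> L" if "t \<in> A" for t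
  proof -
    obtain b where b: "b \<in> A" "t * b * t = t" using regular[OF \<open>t \<in> A\<close>] by blast
    have "rann t = right_ideal (u - b * t)"
    proof
      show "rann t \<subseteq> right_ideal (u - b * t)"
      proof
        fix x assume "x \<in> rann t"
        then have "x \<in> A" "x = (u - b * t) * x" by (auto simp: rann_def left_diff_distrib mult.assoc)
        then show "x \<in> right_ideal (u - b * t)" using right_ideal_memI by metis
      qed
      have "t * (u - b * t) = 0" using that b by (simp add: algebra_simps)
      then show "right_ideal (u - b * t) \<subseteq> rann t"
        using that b by (auto simp: rann_def right_ideal_def mult_assoc_subst)
    qed
    then show ?thesis using that b by auto
  qed
  define C where "C = {rann (e * x) | x. x \<in> A}"
  have CL: "C \<subseteq> L" using rannL assms by (auto simp: C_def)
  obtain s where s: "is_glb C s" using glb_ex CL by blast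
  obtain c where c: "idem c" "s = right_ideal c" using L_idem[OF is_glb_in[OF s]] .
  have s_iff: "y \<in> s \<longleftrightarrow> y \<in> A \<and> (\<forall>x\<in>A. e * x * y = 0)" for y
  proof
    assume "y \<in> s"
    then have "y \<in> rann (e * x)" if "x \<in> A" for x
      using subsetD[OF is_glb_lower[OF s, of "rann (e * x)"], of y] that by (auto simp: C_def)
    then show "y \<in> A \<and> (\<forall>x\<in>A. e * x * y = 0)" using unit_in by (auto simp: rann_def)
  next
    assume y: "y \<in> A \<and> (\<forall>x\<in>A. e * x * y = 0)"
    have "right_ideal y \<subseteq> I" if I: "I \<in> C" for I
    proof -
      obtain x where x: "x \<in> A" "I = rann (e * x)" using I by (auto simp: C_def)
      then have "y \<in> I" using y by (auto simp: rann_def)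
      then show ?thesis using L_right_ideal_subset[of I y] CL I by auto
    qed
    then have "right_ideal y \<subseteq> s" using is_glb_greatest[OF s right_ideal_L] y by simp
    then show "y \<in> s" using right_ideal_self[of y] y by auto
  qed
  have cs: "c \<in> s" using c right_ideal_self[of c] by simp
  have rc: "c * (r * c) = r * c" if "r \<in> A" for r
  proof -
    have "e * (x * r) * c = 0" if "x \<in> A" for x
      using s_iff[of c] cs that \<open>r \<in> A\<close> by simp
    then have "r * c \<in> s" using s_iff that c by (auto simp: mult.assoc)
    then show ?thesis using c(2) right_ideal_idem[OF c(1)] by simp
  qed
  \<comment> \<open>By \<open>rc\<close>, the corner from \<open>c\<close> to \<open>u - c\<close>
    vanishes. An element \<open>x\<close> of the opposite corner then satisfies
    \<open>x * y * x = 0\<close> for every \<open>y\<close>, and regularity forces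
    \<open>x = 0\<close>.\<close>
  have cr: "c * r = r * c" if r: "r \<in> A" for r
  proof -
    define x where "x = c * r * (u - c)"
    have x: "x \<in> A" using r c by (auto simp: x_def)
    obtain y where y: "y \<in> A" "x * y * x = x" using regular[OF x] by blast
    have z: "(u - c) * (y * c) = 0" using rc[OF y(1)] y c by (simp add: left_diff_distrib)
    have "x * y * x = c * r * ((u - c) * (y * c)) * r * (u - c)" by (simp add: x_def mult.assoc)
    then have "x = 0" using z y by simp
    then have "c * r = c * (r * c)" using r c by (simp add: x_def right_diff_distrib mult.assoc)
    then show ?thesis using rc[OF r] by simp
  qed
  have "f \<in> s" using s_iff assms by simp
  then have cf: "c * f = f" using c(2) right_ideal_idem[OF c(1)] by simp
  consider "c = 0" | "c = u" using central_idem[OF c(1) cr] by blast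
  then show ?thesis
  proof cases
    case 1 then show ?thesis using cf by simp
  next
    case 2 then have "e * u * u = 0" using s_iff[of c] cs by simp
    then show ?thesis using assms by simp
  qed
qed

text \<open>Let \<open>e2\<close> and \<open>f2\<close> be what a maximal triple leaves of
  \<open>e\<close> and \<open>f\<close>. A nonzero map between them would supply another pair of
  isomorphic pieces and enlarge the triple, so by primeness one of them is zero.\<close>

lemma comparable_orth:
  assumes "idem e" "idem f" "e * f = 0" "f * e = 0"
  shows "e \<preceq> f \<or> f \<preceq> e"
proof -
  obtain P Q Z where P: "triple P Q Z" "P \<subseteq> right_ideal e" "Q \<subseteq> right_ideal f" and
    mx: "\<And>P' Q' Z'. triple P' Q' Z' \<Longrightarrow> P' \<subseteq> right_ideal e \<Longrightarrow> Q' \<subseteq> right_ideal f \<Longrightarrow> P \<subseteq> P' \<Longrightarrow> Q \<subseteq> Q' \<Longrightarrow> Z \<subseteq> Z' \<Longrightarrow> P' = P"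
    using maximal_triple[of "right_ideal e" "right_ideal f"] assms by blast
  have PL: "P \<in> L" "Q \<in> L" "Z \<in> L" using P by (auto simp: triple_def)
  obtain a where a: "idem a" "P = right_ideal a" "e * a = a" "a * e = a" using sub_generator[OF assms(1) PL(1) P(2)] .
  obtain b where b: "idem b" "Q = right_ideal b" "f * b = b" "b * f = b" using sub_generator[OF assms(2) PL(2) P(3)] .
  have ab: "a \<asymp> b" using triple_eqv P a b by blast
  define e2 f2 where "e2 = e - a" and "f2 = f - b"
  note e2 = idem_diff[OF assms(1) a(1,3,4), folded e2_def]
  note f2 = idem_diff[OF assms(2) b(1,3,4), folded f2_def]
  have z: "e2 * f2 = 0" "f2 * e2 = 0" "e2 * b = 0" "f2 * a = 0" "a * f2 = 0"
    using mult_zero_via_orth[OF e2(5) f2(4)] mult_zero_via_orth[OF f2(5) e2(4)] mult_zero_via_orth[OF e2(5) b(3)]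
       mult_zero_via_orth[OF f2(5) a(3)] mult_zero_via_orth[OF a(4) f2(4)] assms by auto
  have "e2 * x * f2 = 0" if x: "x \<in> A" for x
  proof (rule ccontr)
    assume n: "e2 * x * f2 \<noteq> 0"
    obtain a3 b3 where 3: "idem a3" "idem b3" "e2 * a3 = a3" "a3 * e2 = a3" "f2 * b3 = b3" "b3 * f2 = b3" "a3 \<asymp> b3" "a3 \<noteq> 0"
      using nonzero_hom[OF e2(1) f2(1) x n] by metis
    have o: "a3 * b3 = 0" "b3 * a3 = 0" using mult_zero_via_orth[OF 3(4,5)] mult_zero_via_orth[OF 3(6,3)] z by auto
    obtain Z' where Z': "triple (right_ideal a3) (right_ideal b3) Z'" using eqv_triple 3 o by blast
    \<comment> \<open>\<open>g\<close> contains the new pair and is independent of the old sum, as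
      \<open>triple_isum\<close> requires.\<close>
    define g where "g = e2 + f2"
    have g: "idem g" unfolding g_def using e2 f2 z by (intro idem_add)
    have a3e: "e * a3 = a3" using 3(3) e2(4) by (metis mult.assoc)
    have b3f: "f * b3 = b3" using 3(5) f2(4) by (metis mult.assoc)
    have "f2 * a3 = 0" using 3(3) z(2) by (metis mult.assoc mult_zero_left)
    then have ga3: "g * a3 = a3" using 3 by (simp add: g_def distrib_right)
    have "e2 * b3 = 0" using 3(5) z(1) by (metis mult.assoc mult_zero_left)
    then have gb3: "g * b3 = b3" using 3 by (simp add: g_def distrib_right)
    have gab: "g * a = 0" "g * b = 0" using z e2(2) f2(2) by (auto simp: g_def distrib_right)
    have G: "right_ideal g \<inter> isum P Q = {0}"
    proof -
      have "w = 0" if w: "w \<in> right_ideal g" "w \<in> isum P Q" for w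
      proof -
        obtain p q where "w = a * p + b * q" using w(2) unfolding a b right_ideal_def by (auto elim!: isumE)
        moreover have "w = g * w" using w(1) g right_ideal_idem by simp
        ultimately show "w = 0" using gab by (simp add: distrib_left mult_assoc_subst)
      qed
      moreover have "0 \<in> isum P Q" "0 \<in> right_ideal g" using PL g by (auto simp: right_ideal_zero)
      ultimately show ?thesis by blast
    qed
    have t: "triple (isum P (right_ideal a3)) (isum Q (right_ideal b3)) (isum Z Z')"
    proof (rule triple_isum[OF P(1) Z' _ _ _ G])
      show "right_ideal a3 \<subseteq> right_ideal g" "right_ideal b3 \<subseteq> right_ideal g"
        using right_ideal_least right_ideal_idem[OF g] ga3 gb3 g 3 by auto
    qed (use g in auto)
    have "isum P (right_ideal a3) = P"
    proof (rule mx[OF t])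
      show "isum P (right_ideal a3) \<subseteq> right_ideal e" "isum Q (right_ideal b3) \<subseteq> right_ideal f"
        using isum_least[OF right_ideal_L P(2) right_ideal_least[of a3 e]] isum_least[OF right_ideal_L P(3) right_ideal_least[of b3 f]]
          right_ideal_idem[OF assms(1), of a3] right_ideal_idem[OF assms(2), of b3] a3e b3f 3(1,2) assms(1,2) by simp_all
      have "Z' \<in> L" using Z' by (simp add: triple_def)
      then show "P \<subseteq> isum P (right_ideal a3)" "Q \<subseteq> isum Q (right_ideal b3)" "Z \<subseteq> isum Z Z'"
        by (auto intro!: isum_left[THEN subsetD] right_ideal_zero)
    qed
    then have "a3 \<in> P" using isum_right[of P "right_ideal a3"] right_ideal_self[of a3] 3(1) L_zero[OF PL(1)] by auto
    then have "a * a3 = a3" using a right_ideal_idem by blast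
    moreover have "a * e2 = 0" by (rule e2(3))
    ultimately have "a3 = 0" using 3(3) by (metis mult.assoc mult_zero_left)
    then show False using 3 by simp
  qed
  then consider "e2 = 0" | "f2 = 0" using prime[OF e2(1)] f2(1) by blast
  then show ?thesis
  proof cases
    case 1
    then have "e = a" by (simp add: e2_def)
    then have "e \<preceq> b" using ab eqv_below by blast
    moreover have "b \<preceq> f" using subidem_below assms b by blast
    ultimately show ?thesis using below_trans by blast
  next
    case 2
    then have "f = b" by (simp add: f2_def)
    then have "f \<preceq> a" using ab eqv_below eqv_sym by blast
    moreover have "a \<preceq> e" using subidem_below assms a by blast
    ultimately show ?thesis using below_trans by blast
  qed
qed

text \<open>The common part of the two right ideals is removed first. What remains of
  \<open>f\<close> need not be orthogonal to what remains of \<open>e\<close>, but it can be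
  exchanged for an orthogonal idempotent \<open>k\<close> of the same size, to which
  \<open>comparable_orth\<close> applies.\<close>

lemma comparable:
  assumes "idem e" "idem f"
  shows "e \<preceq> f \<or> f \<preceq> e"
proof -
  obtain m where m: "idem m" "e * m = m" "m * e = m" "f * m = m" and
    mm: "\<And>x. x \<in> A \<Longrightarrow> e * x = x \<Longrightarrow> f * x = x \<Longrightarrow> m * x = x" using meet[OF assms] by metis
  obtain m' where m': "idem m'" "f * m' = m'" "m' * f = m'" "e * m' = m'" and
    mm': "\<And>x. x \<in> A \<Longrightarrow> f * x = x \<Longrightarrow> e * x = x \<Longrightarrow> m' * x = x" using meet[OF assms(2,1)] by metis
  \<comment> \<open>\<open>m\<close> and \<open>m'\<close> generate the same right ideal and differ
    only in their kernels; each is a subidempotent of its own side.\<close>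
  have meq: "m \<asymp> m'"
    by (rule eqvI[of m' m]) (use mm[of m'] mm'[of m] m m' in auto)
  define g g' where "g = e - m" and "g' = f - m'"
  note g = idem_diff[OF assms(1) m(1-3), folded g_def]
  note g' = idem_diff[OF assms(2) m'(1-3), folded g'_def]
  have eg: "e = m + g" "f = m' + g'" by (simp_all add: g_def g'_def)
  obtain k s t where k: "idem k" "g * k = 0" "k * g = 0" "(g + k) * g' = g'" "k \<preceq> g'" using join[OF g(1)] g'(1) idem_in by metis
  \<comment> \<open>An element of the ideal of \<open>g'\<close> killed by \<open>k\<close> lies in
    the ideal of \<open>g\<close>, hence in the common part, and \<open>g\<close> is orthogonal to
    that part.\<close>
  have "g' \<preceq> k"
  proof (rule annihilator_below)
    fix w assume w: "w \<in> A" "k * (g' * w) = 0"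
    have "g' * w = (g + k) * (g' * w)" using k(4) by (simp add: mult_assoc_subst)
    then have 1: "g * (g' * w) = g' * w" using w by (simp add: distrib_right)
    have inA: "g' * w \<in> A" using g' w by auto
    have "e * (g' * w) = g' * w" using 1 g(4) by (metis mult.assoc)
    moreover have "f * (g' * w) = g' * w" using g'(4) by (simp add: mult_assoc_subst)
    ultimately have "m * (g' * w) = g' * w" using mm[OF inA] by simp
    then show "g' * w = 0" using 1 g(2,3) by (metis mult.assoc mult_zero_left)
  qed (use g' k in auto)
  have gk: "g \<preceq> k \<or> k \<preceq> g" using comparable_orth g(1) k by blast
  then show ?thesis
  proof
    assume "g \<preceq> k"
    then have "g \<preceq> g'" using k below_trans by blast
    then have "e \<preceq> f" unfolding eg using m m' g g' eqv_below[OF meq] by (intro below_add)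
    then show ?thesis by blast
  next
    assume "k \<preceq> g"
    then have "g' \<preceq> g" using \<open>g' \<preceq> k\<close> below_trans by blast
    then have "f \<preceq> e" unfolding eg using m m' g g' eqv_below[OF eqv_sym[OF meq]] by (intro below_add)
    then show ?thesis by blast
  qed
qed

text \<open>Both ideals of a maximal triple are sought inside \<open>e\<close>. A nonzero remainder
  is no atom, so it splits; by comparability the two pieces contain equivalent idempotents, which
  would enlarge the triple.\<close>

lemma halving:
  assumes "\<And>a. \<not> atom a" "idem e"
  obtains e1 e2 where "idem e1" "idem e2" "e1 * e2 = 0" "e2 * e1 = 0" "e = e1 + e2" "e1 \<asymp> e2"
proof -
  obtain P Q Z where P: "triple P Q Z" "P \<subseteq> right_ideal e" "Q \<subseteq> right_ideal e" and
    mx: "\<And>P' Q' Z'. triple P' Q' Z' \<Longrightarrow> P' \<subseteq> right_ideal e \<Longrightarrow> Q' \<subseteq> right_ideal e \<Longrightarrow> P \<subseteq> P' \<Longrightarrow> Q \<subseteq> Q' \<Longrightarrow> Z \<subseteq> Z' \<Longrightarrow> P' = P"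
    using maximal_triple[OF right_ideal_L[OF idem_in[OF assms(2)]] right_ideal_L[OF idem_in[OF assms(2)]]] by blast
  have PL: "P \<in> L" "Q \<in> L" "Z \<in> L" and PQ: "P \<inter> Q = {0}" using P by (auto simp: triple_def)
  have PQe: "isum P Q \<subseteq> right_ideal e" using P assms by (intro isum_least) auto
  obtain p where p: "idem p" "isum P Q = right_ideal p" "e * p = p" "p * e = p"
    using sub_generator[OF assms(2) _ PQe] PL by blast
  define g where "g = e - p"
  note g = idem_diff[OF assms(2) p(1,3,4), folded g_def]
  have "g = 0"
  proof (rule ccontr)
    assume "g \<noteq> 0"
    then obtain b where b: "idem b" "g * b = b" "b * g = b" "b \<noteq> 0" "b \<noteq> g"
      using assms(1)[of g] g(1) unfolding atom_def by blast
    note b' = idem_diff[OF g(1) b(1-3)]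
    have "\<exists>a3 b3. idem a3 \<and> idem b3 \<and> g * a3 = a3 \<and> g * b3 = b3 \<and> a3 \<asymp> b3 \<and> a3 \<noteq> 0 \<and> a3 * b3 = 0 \<and> b3 * a3 = 0"
    proof -
      have sub: "\<exists>a3 b3. idem a3 \<and> idem b3 \<and> g * a3 = a3 \<and> g * b3 = b3 \<and> a3 \<asymp> b3 \<and> a3 \<noteq> 0 \<and> a3 * b3 = 0 \<and> b3 * a3 = 0"
        if h: "idem h" "idem h'" "h * h' = 0" "h' * h = 0" "g * h = h" "g * h' = h'" "h \<noteq> 0" "h \<preceq> h'" for h h'
      proof -
        obtain h'' where h'': "idem h''" "h' * h'' = h''" "h'' * h' = h''" "h \<asymp> h''" using below_subidem h by metis
        have "g * h'' = h''" using h'' h by (metis mult.assoc)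
        moreover have "h * h'' = 0" "h'' * h = 0" using mult_zero_via_orth[OF idem_mult h''(2)] mult_zero_via_orth[OF h''(3) idem_mult] h by auto
        ultimately show ?thesis using h h'' by blast
      qed
      have "b \<preceq> g - b \<or> g - b \<preceq> b" using comparable_orth b b' by blast
      then show ?thesis using sub[of b "g - b"] sub[of "g - b" b] b b' by auto
    qed
    then obtain a3 b3 where 3: "idem a3" "idem b3" "g * a3 = a3" "g * b3 = b3" "a3 \<asymp> b3" "a3 \<noteq> 0" "a3 * b3 = 0" "b3 * a3 = 0"
      by blast
    obtain Z' where Z': "triple (right_ideal a3) (right_ideal b3) Z'" using eqv_triple 3 by blast
    have G: "right_ideal g \<inter> isum P Q = {0}"
    proof -
      have "w = 0" if "g * w = w" "p * w = w" for w using that g(2) by (metis mult.assoc mult_zero_left)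
      then show ?thesis unfolding p(2) using right_ideal_idem[OF g(1)] right_ideal_idem[OF p(1)] right_ideal_zero by blast
    qed
    have sub3: "right_ideal a3 \<subseteq> right_ideal g" "right_ideal b3 \<subseteq> right_ideal g" "right_ideal g \<subseteq> right_ideal e"
      using right_ideal_least right_ideal_idem[OF g(1)] right_ideal_idem[OF assms(2)] g 3 assms by auto
    have t: "triple (isum P (right_ideal a3)) (isum Q (right_ideal b3)) (isum Z Z')"
      by (rule triple_isum[OF P(1) Z' _ sub3(1,2) G]) (use g in auto)
    have "isum P (right_ideal a3) = P"
    proof (rule mx[OF t])
      show "isum P (right_ideal a3) \<subseteq> right_ideal e" "isum Q (right_ideal b3) \<subseteq> right_ideal e"
        using isum_least[OF right_ideal_L P(2)] isum_least[OF right_ideal_L P(3)] sub3 assms(2) by auto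
      have "Z' \<in> L" using Z' by (simp add: triple_def)
      then show "P \<subseteq> isum P (right_ideal a3)" "Q \<subseteq> isum Q (right_ideal b3)" "Z \<subseteq> isum Z Z'"
        by (auto intro!: isum_left[THEN subsetD] right_ideal_zero)
    qed
    then have "a3 \<in> P" using isum_right[of P "right_ideal a3"] right_ideal_self[of a3] 3(1) L_zero[OF PL(1)] by auto
    then have "a3 \<in> right_ideal p" using p(2) isum_left[of Q P] L_zero[OF PL(2)] by auto
    then have "p * a3 = a3" using right_ideal_idem p by blast
    then have "a3 = 0" using 3(3) g(3) by (metis mult.assoc mult_zero_left)
    then show False using 3 by simp
  qed
  then have pe: "isum P Q = right_ideal e" using p by (simp add: g_def)
  then have "e \<in> isum P Q" using right_ideal_self[OF idem_in[OF assms(2)]] by simp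
  \<comment> \<open>The two ideals span the ideal of \<open>e\<close> and are independent, so the
    components of \<open>e\<close> in them are orthogonal idempotents.\<close>
  then obtain a0 b0 where a0: "a0 \<in> P" "b0 \<in> Q" "e = a0 + b0" by (rule isumE)
  define e1 e2 where "e1 = a0 * e" and "e2 = b0 * e"
  have e12: "e = e1 + e2"
    using idem_mult[OF assms(2)] unfolding e1_def e2_def distrib_right[symmetric] a0(3)[symmetric] by simp
  have e1P: "e1 \<in> P" "e2 \<in> Q"
    using L_mult[OF PL(1) a0(1)] L_mult[OF PL(2) a0(2)] assms(2) by (auto simp: e1_def e2_def)
  have A12: "e1 \<in> A" "e2 \<in> A" using L_subset[OF PL(1) e1P(1)] L_subset[OF PL(2) e1P(2)] .
  have ex: "e1 * x + e2 * x = x" if "x \<in> right_ideal e" for x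
    using that right_ideal_idem[OF assms(2), of x] e12 by (simp add: distrib_right)
  have PQ0: "x = 0" if "x \<in> P" "x \<in> Q" for x using that PQ by auto
  have xP: "e1 * x = x \<and> e2 * x = 0" if "x \<in> P" for x
  proof -
    have xA: "x \<in> A" using L_subset[OF PL(1) that] .
    have 1: "e1 * x + e2 * x = x" using ex subsetD[OF P(2) that] by simp
    have "x - e1 * x \<in> P" using L_diff[OF PL(1) that L_mult[OF PL(1) e1P(1) xA]] .
    moreover have 2: "x - e1 * x = e2 * x" using 1 by (metis add_diff_cancel_left')
    ultimately have "e2 * x = 0" using PQ0[of "e2 * x"] L_mult[OF PL(2) e1P(2) xA] by simp
    then show ?thesis using 1 by simp
  qed
  have xQ: "e2 * x = x \<and> e1 * x = 0" if "x \<in> Q" for x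
  proof -
    have xA: "x \<in> A" using L_subset[OF PL(2) that] .
    have 1: "e1 * x + e2 * x = x" using ex subsetD[OF P(3) that] by simp
    have "x - e2 * x \<in> Q" using L_diff[OF PL(2) that L_mult[OF PL(2) e1P(2) xA]] .
    moreover have 2: "x - e2 * x = e1 * x" using 1 by (metis add_diff_cancel_right')
    ultimately have "e1 * x = 0" using PQ0[of "e1 * x"] L_mult[OF PL(1) e1P(1) xA] by simp
    then show ?thesis using 1 by simp
  qed
  have id: "idem e1" "idem e2" using xP xQ e1P A12 by (auto intro!: idemI)
  have PR: "P = right_ideal e1" "Q = right_ideal e2"
  proof -
    show "P = right_ideal e1"
      using L_right_ideal_subset[OF PL(1) e1P(1)] right_ideal_idem[OF id(1)] xP L_subset[OF PL(1)] by auto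
    show "Q = right_ideal e2"
      using L_right_ideal_subset[OF PL(2) e1P(2)] right_ideal_idem[OF id(2)] xQ L_subset[OF PL(2)] by auto
  qed
  show thesis
  proof (rule that[OF id _ _ e12])
    show "e1 * e2 = 0" "e2 * e1 = 0" using xP[OF e1P(1)] xQ[OF e1P(2)] by simp_all
    show "e1 \<asymp> e2" using triple_eqv[OF _ id, of Z] P(1) unfolding PR by simp
  qed
qed

end

section \<open>The rank function\<close>

context unital_subring
begin

text \<open>In contrast to \<open>rank_function\<close>, nothing is required outside
  \<open>A\<close>; uniqueness below is accordingly uniqueness on \<open>A\<close>.\<close>

definition is_rank :: "('b \<Rightarrow> real) \<Rightarrow> bool" where
  "is_rank \<rho> \<longleftrightarrow> (\<forall>a\<in>A. 0 \<le> \<rho> a \<and> \<rho> a \<le> 1) \<and> \<rho> u = 1 \<and>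
     (\<forall>a\<in>A. \<forall>b\<in>A. \<rho> (a * b) \<le> \<rho> a \<and> \<rho> (a * b) \<le> \<rho> b) \<and>
     (\<forall>e f. idem e \<longrightarrow> idem f \<longrightarrow> e * f = 0 \<longrightarrow> f * e = 0 \<longrightarrow> \<rho> (e + f) = \<rho> e + \<rho> f) \<and>
     (\<forall>a\<in>A. \<rho> a = 0 \<longrightarrow> a = 0)"

lemma is_rankD:
  assumes "is_rank \<rho>"
  shows "a \<in> A \<Longrightarrow> 0 \<le> \<rho> a" "a \<in> A \<Longrightarrow> \<rho> a \<le> 1" "\<rho> u = 1"
    "a \<in> A \<Longrightarrow> b \<in> A \<Longrightarrow> \<rho> (a * b) \<le> \<rho> a" "a \<in> A \<Longrightarrow> b \<in> A \<Longrightarrow> \<rho> (a * b) \<le> \<rho> b"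
    "idem e \<Longrightarrow> idem f \<Longrightarrow> e * f = 0 \<Longrightarrow> f * e = 0 \<Longrightarrow> \<rho> (e + f) = \<rho> e + \<rho> f"
    "a \<in> A \<Longrightarrow> \<rho> a = 0 \<Longrightarrow> a = 0"
  using assms unfolding is_rank_def by simp_all

lemma rank_zero: "is_rank \<rho> \<Longrightarrow> \<rho> 0 = 0"
  using is_rankD(6)[of \<rho> 0 0] by simp

lemma rank_below:
  assumes "is_rank \<rho>" "a \<preceq> b" "b \<in> A"
  shows "\<rho> a \<le> \<rho> b"
proof -
  obtain x y where "x \<in> A" "y \<in> A" "a = x * b * y" using assms(2) unfolding below_def by blast
  then show ?thesis
    using is_rankD(4)[OF assms(1), of "x * b" y] is_rankD(5)[OF assms(1), of x b] assms(3) by simp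
qed

lemma rank_eqv:
  assumes "is_rank \<rho>" "e \<asymp> f"
  shows "\<rho> e = \<rho> f"
  using rank_below[OF assms(1) eqv_below[OF assms(2)]] rank_below[OF assms(1) eqv_below[OF eqv_sym[OF assms(2)]]]
    idem_in[OF eqv_idem(1)[OF assms(2)]] idem_in[OF eqv_idem(2)[OF assms(2)]] by simp

inductive copies :: "'b \<Rightarrow> nat \<Rightarrow> 'b \<Rightarrow> bool" for p where
  zero: "copies p 0 0"
| Suc: "copies p n a \<Longrightarrow> b \<asymp> p \<Longrightarrow> a * b = 0 \<Longrightarrow> b * a = 0 \<Longrightarrow> copies p (Suc n) (a + b)"

lemma copies_idem: "copies p n a \<Longrightarrow> idem a"
proof (induction rule: copies.induct)
  case (Suc n a b) then show ?case using idem_add[of a b] eqv_idem(1)[of b p] by simp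
qed simp

lemma copies_eqv: "copies p n a \<Longrightarrow> copies p n b \<Longrightarrow> a \<asymp> b"
proof (induction arbitrary: b rule: copies.induct)
  case zero
  then show ?case using eqv_refl[of 0] by (auto elim: copies.cases)
next
  case (Suc n a c)
  from Suc.prems obtain a' c' where "copies p n a'" "c' \<asymp> p" "a' * c' = 0" "c' * a' = 0" "b = a' + c'"
    by (auto elim: copies.cases)
  then show ?case using Suc eqv_add[of a a' c c'] eqv_trans[OF Suc.hyps(2) eqv_sym] by simp
qed

lemma eqv_sum_split:
  assumes "a + b \<asymp> t" "idem a" "idem b" "a * b = 0" "b * a = 0"
  obtains a' b' where "t = a' + b'" "a \<asymp> a'" "b \<asymp> b'" "a' * b' = 0" "b' * a' = 0"
proof -
  obtain x y where x: "x \<in> A" "y \<in> A" "x * y = a + b" "y * x = t" "(a + b) * x = x" "x * t = x" "t * y = y" "y * (a + b) = y"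
    using assms(1) by (rule eqvE)
  have xy: "x * (y * z) = a * z + b * z" for z
    using x(3)[THEN mult_assoc_subst, of z] by (simp add: distrib_right)
  have aa: "a * (a * z) = a * z" "a * (b * z) = 0" "b * (a * z) = 0" "b * (b * z) = b * z" for z
    using assms idem_mult by (simp_all add: mult.assoc[symmetric])
  have A: "a \<in> A" "b \<in> A" using assms by auto
  have ia: "a * a = a" "b * b = b" using assms idem_mult by auto
  have A': "y * a * x \<in> A" "y * b * x \<in> A" using A x by auto
  have i: "idem (y * a * x)" "idem (y * b * x)"
    by (rule idemI[OF A'(1)], simp add: mult.assoc xy aa distrib_left, rule idemI[OF A'(2)], simp add: mult.assoc xy aa distrib_left)
  show thesis
  proof (rule that[of "y * a * x" "y * b * x"])
    have "t = y * ((a + b) * x)" using x by simp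
    then show "t = y * a * x + y * b * x" by (simp add: distrib_left distrib_right mult.assoc)
    show "a \<asymp> y * a * x" using A x assms
      by (intro eqvI[OF _ _ _ _ _ i(1), of "a * x" "y * a"]) (auto simp: mult.assoc xy aa ia distrib_left)
    show "b \<asymp> y * b * x" using A x assms
      by (intro eqvI[OF _ _ _ _ _ i(2), of "b * x" "y * b"]) (auto simp: mult.assoc xy aa ia distrib_left)
    show "y * a * x * (y * b * x) = 0" "y * b * x * (y * a * x) = 0"
      by (simp_all add: mult.assoc xy aa distrib_left)
  qed
qed

lemma copies_transfer: "copies p n a \<Longrightarrow> a \<asymp> t \<Longrightarrow> copies p n t"
proof (induction arbitrary: t rule: copies.induct)
  case zero
  then have "t = 0" by (auto elim!: eqvE)
  then show ?case by (simp add: copies.zero)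
next
  case (Suc n a b)
  obtain a' b' where *: "t = a' + b'" "a \<asymp> a'" "b \<asymp> b'" "a' * b' = 0" "b' * a' = 0"
    using eqv_sum_split[OF Suc.prems copies_idem[OF Suc.hyps(1)] eqv_idem(1)[OF Suc.hyps(2)] Suc.hyps(3,4)] by metis
  show ?case unfolding *(1)
    by (rule copies.Suc[OF Suc.IH[OF *(2)] eqv_trans[OF eqv_sym[OF *(3)] Suc.hyps(2)] *(4,5)])
qed

lemma orth_summand:
  assumes "idem b" "b * c = 0" "c * b = 0" "a * (b + c) = 0" "(b + c) * a = 0"
  shows "a * b = 0" "b * a = 0"
proof -
  have "a * b = a * (b + c) * b" "b * a = b * ((b + c) * a)"
    using assms(1-3) idem_mult[OF assms(1)] by (simp_all add: mult.assoc distrib_right distrib_left mult.assoc[symmetric, of b])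
  then show "a * b = 0" "b * a = 0" using assms(4,5) by simp_all
qed

lemma copies_add: "copies p m b \<Longrightarrow> copies p n a \<Longrightarrow> a * b = 0 \<Longrightarrow> b * a = 0 \<Longrightarrow> copies p (n + m) (a + b)"
proof (induction rule: copies.induct)
  case (Suc m b c)
  note ib = copies_idem[OF Suc.hyps(1)] and ic = eqv_idem(1)[OF Suc.hyps(2)]
  have ab: "a * b = 0" "b * a = 0" using orth_summand[OF ib Suc.hyps(3,4) Suc.prems(2,3)] .
  then have ac: "a * c = 0" "c * a = 0" using Suc.prems by (simp_all add: distrib_left distrib_right)
  have "copies p (Suc (n + m)) (a + b + c)"
    using Suc ab ac by (intro copies.Suc) (simp_all add: distrib_left distrib_right)
  then show ?case by (simp add: add.assoc)
qed simp

lemma copies_split: "copies p (n + m) w \<Longrightarrow> \<exists>a b. w = a + b \<and> a * b = 0 \<and> b * a = 0 \<and> copies p n a \<and> copies p m b"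
proof (induction m arbitrary: w)
  case 0 then show ?case using copies.zero by (intro exI[of _ w] exI[of _ 0]) auto
next
  case (Suc m)
  then obtain w' c where w: "copies p (n + m) w'" "c \<asymp> p" "w' * c = 0" "c * w' = 0" "w = w' + c"
    by (auto elim: copies.cases)
  obtain a b where ab: "w' = a + b" "a * b = 0" "b * a = 0" "copies p n a" "copies p m b" using Suc.IH[OF w(1)] by blast
  have o1: "c * a = 0" "a * c = 0"
    using orth_summand[OF copies_idem[OF ab(4)] ab(2,3), of c] w(3,4) ab(1) by simp_all
  have o2: "c * b = 0" "b * c = 0"
    using orth_summand[OF copies_idem[OF ab(5)] ab(3,2), of c] w(3,4) ab(1) by (simp_all add: add.commute)
  have "copies p (Suc m) (b + c)" by (rule copies.Suc[OF ab(5) w(2) o2(2,1)])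
  then show ?case using ab w o1 by (intro exI[of _ a] exI[of _ "b + c"]) (simp add: distrib_left distrib_right add.assoc)
qed

lemma copies_one: "idem p \<Longrightarrow> copies p 1 p"
  using copies.Suc[OF copies.zero, of p p] eqv_refl[of p] by simp

lemma copies_double:
  assumes "copies p n s" "copies q 2 p"
  shows "copies q (2 * n) s"
  using assms(1)
proof (induction rule: copies.induct)
  case (Suc n a b)
  have "copies q 2 b" using copies_transfer[OF assms(2) eqv_sym[OF Suc.hyps(2)]] .
  then show ?case using copies_add[of q 2 b "2 * n" a] Suc by simp
qed (simp add: copies.zero)

lemma copies_nonzero: "copies p n s \<Longrightarrow> p \<noteq> 0 \<Longrightarrow> n > 0 \<Longrightarrow> s \<noteq> 0"
proof (induction rule: copies.induct)
  case (Suc n a b)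
  have "b = 0" if "a + b = 0"
  proof -
    have "(a + b) * b = b" using Suc.hyps idem_mult[OF eqv_idem(1)] by (simp add: distrib_right)
    then show ?thesis using that by simp
  qed
  moreover have "b \<noteq> 0" using Suc by (auto elim!: eqvE)
  ultimately show ?case by blast
qed simp

lemma rank_copies: "copies p n s \<Longrightarrow> is_rank \<rho> \<Longrightarrow> \<rho> s = real n * \<rho> p"
proof (induction rule: copies.induct)
  case (Suc n a b)
  have "\<rho> (a + b) = \<rho> a + \<rho> b"
    using is_rankD(6)[OF Suc.prems copies_idem[OF Suc.hyps(1)] eqv_idem(1)[OF Suc.hyps(2)]] Suc by simp
  then show ?case using Suc rank_eqv[OF Suc.prems Suc.hyps(2)] by (simp add: distrib_right)
qed (simp add: rank_zero)

lemma rank_uminus: assumes "is_rank \<rho>" "a \<in> A" shows "\<rho> (- a) = \<rho> a"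
proof -
  have "\<rho> (- b) \<le> \<rho> b" if "b \<in> A" for b using is_rankD(5)[OF assms(1), of "- u" b] that by simp
  from this[OF assms(2)] this[of "- a"] assms(2) show ?thesis by simp
qed

end

context regular_subring
begin

text \<open>This is the source of subadditivity, which the rank axioms grant only for orthogonal
  idempotents.\<close>

lemma join_rank:
  assumes "is_rank \<rho>" "a \<in> A" "b \<in> A"
  obtains q where "idem q" "q * a = a" "q * b = b" "\<rho> q \<le> \<rho> a + \<rho> b"
proof -
  obtain e a' where e: "idem e" "a' \<in> A" "a * a' = e" "e * a = a" "right_ideal e = right_ideal a" "e \<preceq> a" "a \<preceq> e"
    by (rule idem_generator[OF assms(2)])
  obtain g s t where g: "idem g" "e * g = 0" "g * e = 0" "s \<in> A" "t \<in> A" "g = b * s + e * t" "(e + g) * b = b" "g \<preceq> b"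
    using join[OF e(1) assms(3)] by metis
  have "(e + g) * a = a"
    using e(4) mult_assoc_subst[OF g(3), of a] by (simp add: distrib_right)
  moreover have "\<rho> (e + g) \<le> \<rho> a + \<rho> b"
    using is_rankD(6)[OF assms(1) e(1) g(1-3)] rank_below[OF assms(1) e(6) assms(2)] rank_below[OF assms(1) g(8) assms(3)] by simp
  ultimately show thesis using that[OF idem_add[OF e(1) g(1-3)] _ g(7)] by simp
qed

lemma rank_subadditive:
  assumes "is_rank \<rho>" "a \<in> A" "b \<in> A" shows "\<rho> (a + b) \<le> \<rho> a + \<rho> b"
proof -
  obtain q where q: "idem q" "q * a = a" "q * b = b" "\<rho> q \<le> \<rho> a + \<rho> b" by (rule join_rank[OF assms])
  have "\<rho> (q * (a + b)) \<le> \<rho> q" using is_rankD(4)[OF assms(1)] q assms by simp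
  then show ?thesis using q by (simp add: distrib_left)
qed

end

context continuous_subring
begin

text \<open>With a surplus of copies, \<open>s\<close> would embed into a proper part of itself,
  against direct finiteness; \<open>p\<close> being nonzero makes the surplus nonzero.\<close>

lemma copies_le:
  assumes "copies p n s" "copies p m t" "s \<preceq> t" "p \<noteq> 0"
  shows "n \<le> m"
proof (rule ccontr)
  assume "\<not> n \<le> m"
  then have "copies p (m + (n - m)) s" using assms(1) by simp
  then obtain a b where ab: "s = a + b" "a * b = 0" "b * a = 0" "copies p m a" "copies p (n - m) b"
    using copies_split by blast
  have b: "b \<noteq> 0" using copies_nonzero[OF ab(5) assms(4)] \<open>\<not> n \<le> m\<close> by simp
  have i: "idem a" "idem s" using copies_idem ab assms by auto
  have "s * a = a" "a * s = a" using idem_mult[OF i(1)] ab(1-3) by (simp_all add: distrib_left distrib_right)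
  then have "a = s"
    using below_proper[OF i] below_trans[OF assms(3) eqv_below[OF copies_eqv[OF assms(2) ab(4)]]] by metis
  then show False using b ab(1) by simp
qed

lemma idem_equivalent:
  assumes "a \<in> A" obtains e where "idem e" "e \<preceq> a" "a \<preceq> e"
  using idem_generator[OF assms] by metis

end

section \<open>Existence and uniqueness of the rank function\<close>

context irreducible_continuous_subring
begin

text \<open>By comparability every nonzero idempotent contains a copy of the minimal one. Splitting
  off copies greedily must stop, since otherwise the copies form an infinite orthogonal
  sequence.\<close>

lemma atomic_copies:
  assumes "atom m" "idem e"
  obtains n where "copies m n e"
proof -
  have m: "idem m" "m \<noteq> 0" and min: "\<And>b. idem b \<Longrightarrow> m * b = b \<Longrightarrow> b * m = b \<Longrightarrow> b = 0 \<or> b = m"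
    using assms(1) unfolding atom_def by auto
  have below: "m \<preceq> f" if f: "idem f" "f \<noteq> 0" for f
  proof (rule ccontr)
    assume *: "\<not> m \<preceq> f"
    then have "f \<preceq> m" using comparable m f by blast
    then obtain f' where f': "idem f'" "m * f' = f'" "f' * m = f'" "f \<asymp> f'" using below_subidem f m by metis
    have "f' \<noteq> 0" using f f'(4) by (auto elim!: eqvE)
    then have "f' = m" using min f' by blast
    then show False using * eqv_below eqv_sym f' by blast
  qed
  have "\<exists>n. copies m n e"
  proof (rule ccontr)
    assume no: "\<nexists>n. copies m n e"
    define st where "st n s \<longleftrightarrow> copies m n s \<and> e * s = s \<and> s * e = s" for n s
    define nx where "nx n s t \<longleftrightarrow> (\<exists>b. t = s + b \<and> b \<asymp> m \<and> s * b = 0 \<and> b * s = 0)" for n :: nat and s t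
    \<comment> \<open>The choice runs over the partial sums; the copy added in each step is
      recovered from \<open>nx\<close>.\<close>
    have "\<exists>F. \<forall>n. st n (F n) \<and> nx n (F n) (F (Suc n))"
    proof (rule dependent_nat_choice)
      show "\<exists>s. st 0 s" unfolding st_def using copies.zero by (intro exI[of _ 0]) auto
      fix s n assume s: "st n s"
      then have si: "idem s" "e * s = s" "s * e = s" using copies_idem by (auto simp: st_def)
      have "e \<noteq> s" using s no by (auto simp: st_def)
      note r = idem_diff[OF assms(2) si]
      have "m \<preceq> e - s" using \<open>e \<noteq> s\<close> by (intro below r(1)) simp
      then obtain b where b: "idem b" "(e - s) * b = b" "b * (e - s) = b" "m \<asymp> b" using below_subidem[OF m(1) r(1)] by metis
      have o: "s * b = 0" "b * s = 0"
        using mult_zero_via_orth[OF idem_mult[OF si(1)] b(2) r(3)] mult_zero_via_orth[OF b(3) idem_mult[OF si(1)] r(2)] .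
      have "e * b = b" "b * e = b" using b(2,3) o by (simp_all add: left_diff_distrib right_diff_distrib)
      then have "st (Suc n) (s + b)" using s copies.Suc[of m n s b] eqv_sym[OF b(4)] o si
        by (simp add: st_def distrib_left distrib_right)
      moreover have "nx n s (s + b)" using eqv_sym[OF b(4)] o unfolding nx_def by blast
      ultimately show "\<exists>t. st (Suc n) t \<and> nx n s t" by blast
    qed
    then obtain F where F: "\<And>n. st n (F n)" "\<And>n. nx n (F n) (F (Suc n))" by blast
    obtain b where b: "\<And>n. F (Suc n) = F n + b n" "\<And>n. b n \<asymp> m" "\<And>n. F n * b n = 0" "\<And>n. b n * F n = 0"
      using F(2) unfolding nx_def by metis
    have ib: "idem (b n)" for n using eqv_idem(1)[OF b(2)] .
    have bF: "(F j * b i = b i \<longrightarrow> b j * b i = 0) \<and> (b i * F j = b i \<longrightarrow> b i * b j = 0)" for i j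
      using mult_zero_via_orth[of "b j" "b j" "F j" "b i"] mult_zero_via_orth[of "b i" "F j" "b j" "b j"]
        b(3,4)[of j] idem_mult[OF ib[of j]] by blast
    have Fb: "F (Suc (i + k)) * b i = b i \<and> b i * F (Suc (i + k)) = b i" for i k
    proof (induction k)
      case 0 then show ?case using b(3,4) idem_mult[OF ib] by (simp add: b(1) distrib_left distrib_right)
    next
      case (Suc k)
      have "b (Suc (i + k)) * b i = 0" "b i * b (Suc (i + k)) = 0"
        using bF[of "Suc (i + k)" i] Suc by auto
      then show ?case using Suc by (simp add: b(1)[of "Suc (i + k)"] distrib_left distrib_right)
    qed
    have lt: "b j * b i = 0 \<and> b i * b j = 0" if "i < j" for i j
    proof -
      obtain k where "j = Suc (i + k)" using \<open>i < j\<close> less_iff_Suc_add by auto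
      then show ?thesis
        using bF[of j i] Fb[of i k] by auto
    qed
    have "b 0 = 0"
    proof (rule no_infinite_copies[OF ib])
      show "b i * b j = 0" if "i \<noteq> j" for i j using lt[of i j] lt[of j i] that by (cases "i < j") auto
      show "b i \<asymp> b (Suc i)" for i using eqv_trans[OF b(2) eqv_sym[OF b(2)]] .
    qed
    then show False using b(2)[of 0] m(2) by (auto elim!: eqvE)
  qed
  then show thesis using that by blast
qed

text \<open>The rank counts copies of the atom, normalised by their number \<open>M\<close> in the
  unit. The bound \<delta> = 1 / M later forces the rank topology to be discrete.\<close>

lemma atomic_rank:
  assumes "atom m"
  shows "\<exists>\<rho> \<delta>. is_rank \<rho> \<and> \<delta> > 0 \<and> (\<forall>\<rho>'. is_rank \<rho>' \<longrightarrow> (\<forall>a\<in>A. \<rho>' a = \<rho> a)) \<and> (\<forall>a\<in>A. a \<noteq> 0 \<longrightarrow> \<rho> a \<ge> \<delta>)"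
proof -
  have m: "idem m" "m \<noteq> 0" using assms(1) unfolding atom_def by auto
  obtain M where M: "copies m M u" using atomic_copies[OF assms idem_unit] .
  have M0: "M > 0"
  proof (rule ccontr)
    assume "\<not> M > 0" then have "copies m 0 u" using M by simp
    then have "u = 0" by (auto elim: copies.cases)
    then show False using unit_nonzero by simp
  qed
  have ex: "\<exists>n s. copies m n s \<and> s \<preceq> a \<and> a \<preceq> s" if "a \<in> A" for a
    using idem_equivalent[OF that] atomic_copies[OF assms] by metis
  define N where "N a = (SOME n. \<exists>s. copies m n s \<and> s \<preceq> a \<and> a \<preceq> s)" for a
  have N: "\<exists>s. copies m (N a) s \<and> s \<preceq> a \<and> a \<preceq> s" if "a \<in> A" for a
    unfolding N_def by (rule someI_ex[OF ex[OF that]])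
  have Nle: "N a \<le> N b" if ab: "a \<preceq> b" "a \<in> A" "b \<in> A" for a b
  proof -
    obtain s where s: "copies m (N a) s" "s \<preceq> a" using N[OF ab(2)] by metis
    obtain t where t: "copies m (N b) t" "b \<preceq> t" using N[OF ab(3)] by metis
    show ?thesis using copies_le[OF s(1) t(1) below_trans[OF below_trans[OF s(2) that(1)] t(2)] m(2)] .
  qed
  have Neq: "N s = n" if "copies m n s" for s n
  proof -
    have "s \<in> A" using idem_in[OF copies_idem[OF that]] .
    then obtain t where t: "copies m (N s) t" "t \<preceq> s" "s \<preceq> t" using N by metis
    then show ?thesis using copies_le[OF t(1) that t(2) m(2)] copies_le[OF that t(1,3) m(2)] by simp
  qed
  define \<rho> where "\<rho> a = real (N a) / real M" for a
  have Nu: "N u = M" using Neq[OF M] .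
  have rank: "is_rank \<rho>" unfolding is_rank_def
  proof (intro conjI ballI allI impI)
    fix a assume a: "a \<in> A"
    show "0 \<le> \<rho> a" by (simp add: \<rho>_def)
    have "a \<preceq> u" using below_mult_left[of a u] a by simp
    then show "\<rho> a \<le> 1" using Nle[of a u] a Nu M0 by (simp add: \<rho>_def)
    show "a = 0" if "\<rho> a = 0"
    proof -
      have "N a = 0" using that M0 by (simp add: \<rho>_def)
      then obtain s where "copies m 0 s" "a \<preceq> s" using N[OF a] by auto
      then show ?thesis using below_zero by (auto elim: copies.cases)
    qed
    fix b assume b: "b \<in> A"
    show "\<rho> (a * b) \<le> \<rho> a" "\<rho> (a * b) \<le> \<rho> b"
      using Nle[OF below_mult_right[OF a b]] Nle[OF below_mult_left[OF a b]] a b M0 by (simp_all add: \<rho>_def divide_right_mono)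
  next
    show "\<rho> u = 1" using Nu M0 by (simp add: \<rho>_def)
    fix e f assume ef: "idem e" "idem f" "e * f = 0" "f * e = 0"
    obtain n k where nk: "copies m n e" "copies m k f" using atomic_copies[OF assms] ef by metis
    then have "copies m (n + k) (e + f)" using copies_add[OF nk(2,1) ef(3,4)] by simp
    then show "\<rho> (e + f) = \<rho> e + \<rho> f" using Neq nk by (simp add: \<rho>_def add_divide_distrib)
  qed
  have uniq: "\<rho>' a = \<rho> a" if r: "is_rank \<rho>'" "a \<in> A" for \<rho>' a
  proof -
    have "real M * \<rho>' m = 1" using rank_copies[OF M r(1)] is_rankD(3)[OF r(1)] by simp
    then have 1: "\<rho>' m = 1 / real M" using M0 by (simp add: field_simps)
    obtain s where s: "copies m (N a) s" "s \<preceq> a" "a \<preceq> s" using N[OF r(2)] by metis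
    have "s \<in> A" using idem_in[OF copies_idem[OF s(1)]] .
    then have "\<rho>' a = \<rho>' s" using rank_below[OF r(1) s(2)] rank_below[OF r(1) s(3)] r by simp
    then show ?thesis using rank_copies[OF s(1) r(1)] 1 by (simp add: \<rho>_def)
  qed
  have "\<rho> a \<ge> 1 / real M" if "a \<in> A" "a \<noteq> 0" for a
  proof -
    have "\<rho> a \<noteq> 0" using is_rankD(7)[OF rank that(1)] that(2) by metis
    then have "N a \<ge> 1" by (simp add: \<rho>_def)
    then show ?thesis using M0 by (simp add: \<rho>_def divide_right_mono)
  qed
  then have "\<forall>a\<in>A. a \<noteq> 0 \<longrightarrow> 1 / real M \<le> \<rho> a" by blast
  moreover have "\<forall>\<rho>'. is_rank \<rho>' \<longrightarrow> (\<forall>a\<in>A. \<rho>' a = \<rho> a)" using uniq by blast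
  moreover have "0 < 1 / real M" using M0 by simp
  ultimately show ?thesis using rank by blast
qed

text \<open>The discarded halves \<open>h k\<close> are kept as well: they are pairwise orthogonal,
  and a nonzero idempotent of rank zero would embed into all of them.\<close>

lemma halving_sequence:
  assumes "\<And>a. \<not> atom a"
  obtains p h where "p 0 = u" "\<And>k. idem (p k)" "\<And>k. idem (h k)" "\<And>k. p k = p (Suc k) + h k"
    "\<And>k. p (Suc k) * h k = 0" "\<And>k. h k * p (Suc k) = 0" "\<And>k. p (Suc k) \<asymp> h k"
proof -
  have "\<exists>p. \<forall>k. (idem (p k) \<and> (k = 0 \<longrightarrow> p k = u)) \<and> (\<exists>h. idem h \<and> p k = p (Suc k) + h \<and> p (Suc k) * h = 0 \<and> h * p (Suc k) = 0 \<and> p (Suc k) \<asymp> h)"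
  proof (rule dependent_nat_choice)
    show "\<exists>x. idem x \<and> ((0::nat) = 0 \<longrightarrow> x = u)" by (intro exI[of _ u]) simp
    fix x and n :: nat assume "idem x \<and> (n = 0 \<longrightarrow> x = u)"
    then obtain e1 e2 where "idem e1" "idem e2" "e1 * e2 = 0" "e2 * e1 = 0" "x = e1 + e2" "e1 \<asymp> e2"
      using halving[OF assms] by metis
    then show "\<exists>y. (idem y \<and> (Suc n = 0 \<longrightarrow> y = u)) \<and> (\<exists>h. idem h \<and> x = y + h \<and> y * h = 0 \<and> h * y = 0 \<and> y \<asymp> h)"
      by (intro exI[of _ e1]) auto
  qed
  then obtain p where P: "\<forall>k. (idem (p k) \<and> (k = 0 \<longrightarrow> p k = u)) \<and> (\<exists>h. idem h \<and> p k = p (Suc k) + h \<and> p (Suc k) * h = 0 \<and> h * p (Suc k) = 0 \<and> p (Suc k) \<asymp> h)" ..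
  have p: "idem (p k)" "p 0 = u"
    "\<exists>h. idem h \<and> p k = p (Suc k) + h \<and> p (Suc k) * h = 0 \<and> h * p (Suc k) = 0 \<and> p (Suc k) \<asymp> h" for k
    using P by metis+
  obtain h where h: "\<And>k. idem (h k) \<and> p k = p (Suc k) + h k \<and> p (Suc k) * h k = 0 \<and> h k * p (Suc k) = 0 \<and> p (Suc k) \<asymp> h k"
    using p(3) by metis
  show thesis by (rule that[of p h, OF p(2) p(1)]) (use h in metis)+
qed

text \<open>The rank of \<open>a\<close> is the supremum of the fractions n / 2^k for which
  \<open>n\<close> copies of \<open>p k\<close> fit below \<open>a\<close>. By comparability, a
  failure to fit gives an upper bound, so level \<open>k\<close> determines the rank up to 1 / 2^k.
  Additivity and uniqueness follow in the limit.\<close>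

lemma nonatomic_rank:
  assumes "\<And>a. \<not> atom a"
  shows "\<exists>\<rho>. is_rank \<rho> \<and> (\<forall>\<rho>'. is_rank \<rho>' \<longrightarrow> (\<forall>a\<in>A. \<rho>' a = \<rho> a))"
proof -
  obtain p h where p: "p 0 = u" "\<And>k. idem (p k)" "\<And>k. idem (h k)" "\<And>k. p k = p (Suc k) + h k"
    "\<And>k. p (Suc k) * h k = 0" "\<And>k. h k * p (Suc k) = 0" "\<And>k. p (Suc k) \<asymp> h k"
    using halving_sequence[OF assms] by metis
  have two: "copies (p (Suc k)) 2 (p k)" for k
    using copies.Suc[OF copies_one[OF p(2)] eqv_sym[OF p(7)] p(5,6), of k] p(4)[of k] by (simp add: numeral_2_eq_2)
  have up: "copies (p (k + l)) (2 ^ l * n) s" if "copies (p k) n s" for k l n s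
    using that
  proof (induction l)
    case (Suc l) then show ?case using copies_double[OF Suc.IH[OF Suc.prems] two] by (simp add: mult.assoc)
  qed simp
  have unit: "copies (p k) (2 ^ k) u" for k
    using up[of 0 1 u k] copies_one[of u] p(1) by simp
  have p0: "p k \<noteq> 0" for k
  proof
    have zero: "s = 0" if "copies 0 n s" for n s using that
      by (induction rule: copies.induct) (auto elim!: eqvE)
    assume "p k = 0"
    then show False using unit[of k] unit_nonzero zero by simp
  qed
  have pieces: "\<exists>s. copies (p k) n s" if "n \<le> 2 ^ k" for n k
    using copies_split[of "p k" n "2 ^ k - n" u] unit that by auto
  define lower where "lower k n a \<longleftrightarrow> (\<exists>s. copies (p k) n s \<and> s \<preceq> a)" for k n a
  have lower_mono: "lower k n b" if "lower k n a" "a \<preceq> b" for k n a b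
    using that(1) below_trans[OF _ that(2)] unfolding lower_def by metis
  have lower_up: "lower (k + l) (2 ^ l * n) a" if "lower k n a" for k l n a
    using that up unfolding lower_def by metis
  \<comment> \<open>Both counts are refined to the common level \<open>k + l\<close> and compared by
    \<open>copies_le\<close>.\<close>
  have lower_le: "real n / 2 ^ k \<le> real m / 2 ^ l" if lw: "lower k n a" "a \<preceq> t" "copies (p l) m t" for k n a t l m
  proof -
    obtain s where s: "copies (p k) n s" "s \<preceq> a" using lw(1) unfolding lower_def by metis
    have "2 ^ l * n \<le> 2 ^ k * m"
      using copies_le[OF up[OF s(1), of l] _ below_trans[OF s(2) that(2)] p0] up[OF that(3), of k] by (simp add: add.commute)
    then have "real (2 ^ l * n) \<le> real (2 ^ k * m)" by (simp only: of_nat_le_iff)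
    then show ?thesis by (simp add: field_simps)
  qed
  have below_u: "a \<preceq> u" if "a \<in> A" for a using below_mult_left[of a u] that by simp
  have lower_le1: "real n / 2 ^ k \<le> 1" if "lower k n a" "a \<in> A" for k n a
    using lower_le[OF that(1) below_u[OF that(2)] unit[of 0]] by simp
  have not_lower: "\<exists>t. copies (p k) n t \<and> a \<preceq> t" if "\<not> lower k n a" "n \<le> 2 ^ k" "a \<in> A" for k n a
  proof -
    obtain t where t: "copies (p k) n t" using pieces \<open>n \<le> 2 ^ k\<close> by blast
    obtain e where e: "idem e" "e \<preceq> a" "a \<preceq> e" using idem_equivalent \<open>a \<in> A\<close> .
    have "\<not> t \<preceq> e" using that(1) t below_trans[OF _ e(2)] unfolding lower_def by metis
    then have "e \<preceq> t" using comparable[OF e(1) copies_idem[OF t]] by simp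
    then show ?thesis using t below_trans[OF e(3)] by metis
  qed
  have max: "\<exists>n. lower k n a \<and> \<not> lower k (Suc n) a" if "a \<in> A" for k a
  proof (rule ccontr)
    assume *: "\<nexists>n. lower k n a \<and> \<not> lower k (Suc n) a"
    have "lower k n a" for n
    proof (induction n)
      case 0 show ?case unfolding lower_def using copies.zero[of "p k"] zero_below[of a] by metis
    qed (use * in metis)
    then have "real (2 ^ k + 1) / 2 ^ k \<le> 1" using lower_le1[OF _ that] by metis
    then show False by (simp add: field_simps)
  qed
  define Q where "Q a = {real n / 2 ^ k | k n. lower k n a}" for a
  define \<rho> where "\<rho> a = Sup (Q a)" for a
  have Q0: "0 \<in> Q a" for a
  proof -
    have "lower 0 0 a" unfolding lower_def using copies.zero zero_below by metis
    then show ?thesis unfolding Q_def by force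
  qed
  have bdd: "bdd_above (Q a)" if "a \<in> A" for a
    using lower_le1[OF _ that] unfolding Q_def by (intro bdd_aboveI[of _ 1]) auto
  have ge: "real n / 2 ^ k \<le> \<rho> a" if "lower k n a" "a \<in> A" for k n a
    unfolding \<rho>_def by (rule cSup_upper[OF _ bdd]) (use that in \<open>auto simp: Q_def\<close>)
  have le: "\<rho> a \<le> real m / 2 ^ l" if "a \<preceq> t" "copies (p l) m t" for a t l m
    unfolding \<rho>_def
  proof (rule cSup_least)
    show "Q a \<noteq> {}" using Q0[of a] by auto
    show "x \<le> real m / 2 ^ l" if "x \<in> Q a" for x
      using that lower_le[OF _ \<open>a \<preceq> t\<close> \<open>copies (p l) m t\<close>] by (auto simp: Q_def)
  qed
  have \<rho>1: "\<rho> a \<le> 1" if "a \<in> A" for a using le[OF below_u[OF that] unit[of 0]] by simp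
  have le': "\<rho> a \<le> real n / 2 ^ k" if "\<not> lower k n a" "a \<in> A" for k n a
  proof (cases "n \<le> 2 ^ k")
    case True then show ?thesis using not_lower[OF that(1) _ that(2)] le by metis
  next
    case False
    then have "real (2 ^ k) \<le> real n" by (simp only: of_nat_le_iff)
    then have "1 \<le> real n / 2 ^ k" by (simp add: field_simps)
    then show ?thesis using \<rho>1[OF that(2)] by linarith
  qed
  have \<rho>0: "0 \<le> \<rho> a" if "a \<in> A" for a unfolding \<rho>_def by (rule cSup_upper[OF Q0 bdd[OF that]])
  have \<rho>mono: "\<rho> a \<le> \<rho> b" if "a \<preceq> b" "b \<in> A" for a b
    unfolding \<rho>_def
  proof (rule cSup_subset_mono[OF _ bdd[OF that(2)]])
    show "Q a \<noteq> {}" using Q0[of a] by auto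
    show "Q a \<subseteq> Q b" using lower_mono[OF _ that(1)] by (auto simp: Q_def)
  qed
  have small: "x \<le> y" if "\<And>k. x \<le> y + c / 2 ^ k" for x y c :: real
  proof (rule tendsto_lowerbound[of "\<lambda>k. y + c / 2 ^ k" _ sequentially])
    have "(\<lambda>k. y + c * (1/2) ^ k) \<longlonglongrightarrow> y + c * 0" by (intro tendsto_intros LIMSEQ_realpow_zero) auto
    then show "(\<lambda>k. y + c / 2 ^ k) \<longlonglongrightarrow> y" by (simp add: power_one_over field_simps)
  qed (use that in auto)
  have additive: "\<rho> (e + f) = \<rho> e + \<rho> f" if ef: "idem e" "idem f" "e * f = 0" "f * e = 0" for e f
  proof -
    have eA: "e \<in> A" "f \<in> A" "e + f \<in> A" using ef by auto
    \<comment> \<open>At level \<open>k\<close>, counting whole copies loses at most 1 / 2^k for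
      each of \<open>e\<close> and \<open>f\<close>.\<close>
    have 1: "\<rho> e + \<rho> f \<le> \<rho> (e + f) + 2 / 2 ^ k \<and> \<rho> (e + f) \<le> \<rho> e + \<rho> f + 2 / 2 ^ k" for k
    proof -
      obtain n where n: "lower k n e" "\<not> lower k (Suc n) e" using max[OF eA(1)] by metis
      obtain m where m: "lower k m f" "\<not> lower k (Suc m) f" using max[OF eA(2)] by metis
      have b: "real n / 2 ^ k \<le> \<rho> e" "\<rho> e \<le> real (Suc n) / 2 ^ k" "real m / 2 ^ k \<le> \<rho> f" "\<rho> f \<le> real (Suc m) / 2 ^ k"
        using ge[OF n(1) eA(1)] le'[OF n(2) eA(1)] ge[OF m(1) eA(2)] le'[OF m(2) eA(2)] .
      have "lower k (n + m) (e + f)"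
      proof -
        obtain s t where st: "copies (p k) n s" "s \<preceq> e" "copies (p k) m t" "t \<preceq> f" using n(1) m(1) unfolding lower_def by metis
        obtain s' where s': "idem s'" "e * s' = s'" "s' * e = s'" "s \<asymp> s'"
          using below_subidem[OF copies_idem[OF st(1)] ef(1) st(2)] by metis
        obtain t' where t': "idem t'" "f * t' = t'" "t' * f = t'" "t \<asymp> t'"
          using below_subidem[OF copies_idem[OF st(3)] ef(2) st(4)] by metis
        have o: "s' * t' = 0" "t' * s' = 0" using mult_zero_via_orth[OF s'(3) t'(2) ef(3)] mult_zero_via_orth[OF t'(3) s'(2) ef(4)] .
        have "copies (p k) (n + m) (s' + t')"
          using copies_add[OF copies_transfer[OF st(3) t'(4)] copies_transfer[OF st(1) s'(4)] o] .
        moreover have "s' + t' \<preceq> e + f"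
          using below_add[OF s'(1) t'(1) ef(1,2) subidem_below[OF s'(1) ef(1) s'(2)] subidem_below[OF t'(1) ef(2) t'(2)] o ef(3,4)] .
        ultimately show ?thesis unfolding lower_def by metis
      qed
      then have 2: "real (n + m) / 2 ^ k \<le> \<rho> (e + f)" using ge[OF _ eA(3)] by blast
      have 3: "\<rho> (e + f) \<le> real (Suc n + Suc m) / 2 ^ k"
      \<comment> \<open>If so many pieces do not fit into the unit, the bound is at least 1 and
        holds trivially.\<close>
      proof (cases "Suc n + Suc m \<le> 2 ^ k")
        case True
        obtain s where s: "copies (p k) (Suc n) s" "e \<preceq> s" using not_lower[OF n(2) _ eA(1)] True by auto
        obtain t where t: "copies (p k) (Suc m) t" "f \<preceq> t" using not_lower[OF m(2) _ eA(2)] True by auto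
        obtain w where w: "copies (p k) (Suc n + Suc m) w" using pieces[OF True] by metis
        obtain a b where ab: "w = a + b" "a * b = 0" "b * a = 0" "copies (p k) (Suc n) a" "copies (p k) (Suc m) b"
          using copies_split[OF w] by metis
        have "e \<preceq> a" using below_trans[OF s(2) eqv_below[OF copies_eqv[OF s(1) ab(4)]]] .
        moreover have "f \<preceq> b" using below_trans[OF t(2) eqv_below[OF copies_eqv[OF t(1) ab(5)]]] .
        ultimately have "e + f \<preceq> w" unfolding ab(1)
          using below_add[OF ef(1,2) copies_idem[OF ab(4)] copies_idem[OF ab(5)] _ _ ef(3,4) ab(2,3)] by simp
        then show ?thesis using le[OF _ w] by blast
      next
        case False
        then have "real (2 ^ k) \<le> real (Suc n + Suc m)" by (simp only: of_nat_le_iff)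
        then have "1 \<le> real (Suc n + Suc m) / 2 ^ k" by (simp add: field_simps)
        then show ?thesis using \<rho>1[OF eA(3)] by linarith
      qed
      show ?thesis using b 2 3 by (simp add: add_divide_distrib)
    qed
    show ?thesis by (rule antisym; rule small[of _ _ 2]) (use 1 in auto)
  qed
  have positive: "a = 0" if a: "a \<in> A" "\<rho> a = 0" for a
  proof -
    obtain e where e: "idem e" "e \<preceq> a" "a \<preceq> e" using idem_equivalent[OF a(1)] .
    \<comment> \<open>Rank zero means that not even one copy of \<open>p (Suc k)\<close> fits below
      \<open>a\<close>, so \<open>e\<close> fits below such a copy, and that is equivalent to
      \<open>h k\<close>.\<close>
    have "e \<preceq> h k" for k
    proof -
      have "(0::real) < real 1 / 2 ^ Suc k" by simp
      then have "\<not> lower (Suc k) 1 a" using ge[of "Suc k" 1 a] a by linarith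
      then obtain t where t: "copies (p (Suc k)) 1 t" "a \<preceq> t" using not_lower[OF _ _ a(1), of "Suc k" 1] by auto
      have "t \<asymp> h k" using eqv_trans[OF copies_eqv[OF t(1) copies_one[OF p(2)]] p(7)] .
      then show ?thesis using below_trans[OF e(2) below_trans[OF t(2) eqv_below]] by simp
    qed
    then have "\<exists>b. idem b \<and> h k * b = b \<and> b * h k = b \<and> e \<asymp> b" for k using below_subidem[OF e(1) p(3)] by metis
    then obtain b where b: "\<And>k. idem (b k)" "\<And>k. h k * b k = b k" "\<And>k. b k * h k = b k" "\<And>k. e \<asymp> b k" by metis
    have ph: "p k * h k = h k" "h k * p k = h k" for k
      using p(5,6)[of k] idem_mult[OF p(3)] p(4)[of k] by (simp_all add: distrib_left distrib_right)
    have pp: "p k * p (Suc k) = p (Suc k)" "p (Suc k) * p k = p (Suc k)" for k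
      using p(5,6)[of k] idem_mult[OF p(2)] p(4)[of k] by (simp_all add: distrib_left distrib_right)
    have hp: "h i * p (Suc (i + k)) = 0 \<and> p (Suc (i + k)) * h i = 0" for i k
    proof (induction k)
      case 0 then show ?case using p(5,6) by simp
    next
      case (Suc k)
      have "h i * p (Suc (i + Suc k)) = h i * p (Suc (i + k)) * p (Suc (Suc (i + k)))" by (simp add: mult.assoc pp)
      moreover have "p (Suc (i + Suc k)) * h i = p (Suc (Suc (i + k))) * (p (Suc (i + k)) * h i)" by (simp add: mult.assoc[symmetric] pp)
      ultimately show ?case using Suc by simp
    qed
    have lt: "b i * b j = 0 \<and> b j * b i = 0" if "i < j" for i j
    proof -
      obtain k where k: "j = Suc (i + k)" using \<open>i < j\<close> less_iff_Suc_add by auto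
      have "h i * h j = 0" "h j * h i = 0"
        using mult_zero_via_orth[of "h i" "h i" "p j" "h j"] mult_zero_via_orth[of "h j" "p j" "h i" "h i"]
          idem_mult[OF p(3)[of i]] ph[of j] hp[of i k] k by simp_all
      then show ?thesis using mult_zero_via_orth[OF b(3) b(2)] by auto
    qed
    have "b 0 = 0"
    proof (rule no_infinite_copies[OF b(1)])
      show "b i * b j = 0" if "i \<noteq> j" for i j using lt[of i j] lt[of j i] that by (cases "i < j") auto
      show "b i \<asymp> b (Suc i)" for i using eqv_trans[OF eqv_sym[OF b(4)] b(4)] .
    qed
    then have "e = 0" using b(4)[of 0] by (auto elim!: eqvE)
    then show "a = 0" using e(3) below_zero by simp
  qed
  have lower01: "lower 0 1 u" unfolding lower_def using copies_one[of u] p(1) below_refl[of u] by auto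
  have rank: "is_rank \<rho>" unfolding is_rank_def
  proof (intro conjI ballI allI impI)
    show "\<rho> u = 1" using ge[OF lower01] \<rho>1[of u] by simp
  qed (use \<rho>0 \<rho>1 \<rho>mono[OF below_mult_right] \<rho>mono[OF below_mult_left] additive positive in auto)
  have uniq: "\<rho>' a = \<rho> a" if r: "is_rank \<rho>'" "a \<in> A" for \<rho>' a
  proof -
    have pk: "\<rho>' (p k) = 1 / 2 ^ k" for k
      using rank_copies[OF unit r(1), of k] is_rankD(3)[OF r(1)] by (simp add: field_simps)
    have 1: "\<rho>' a \<le> \<rho> a + 1 / 2 ^ k \<and> \<rho> a \<le> \<rho>' a + 1 / 2 ^ k" for k
    proof -
      obtain n where n: "lower k n a" "\<not> lower k (Suc n) a" using max[OF r(2)] by metis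
      have b: "real n / 2 ^ k \<le> \<rho> a" "\<rho> a \<le> real (Suc n) / 2 ^ k" using ge[OF n(1) r(2)] le'[OF n(2) r(2)] .
      obtain s where s: "copies (p k) n s" "s \<preceq> a" using n(1) unfolding lower_def by metis
      have 2: "real n / 2 ^ k \<le> \<rho>' a" using rank_below[OF r(1) s(2) r(2)] rank_copies[OF s(1) r(1)] pk[of k] by simp
      have 3: "\<rho>' a \<le> real (Suc n) / 2 ^ k"
      proof (cases "Suc n \<le> 2 ^ k")
        case True
        obtain t where t: "copies (p k) (Suc n) t" "a \<preceq> t" using not_lower[OF n(2) True r(2)] by metis
        then show ?thesis using rank_below[OF r(1) t(2)] rank_copies[OF t(1) r(1)] pk[of k] copies_idem[OF t(1)] by auto
      next
        case False
        then have "real (2 ^ k) \<le> real (Suc n)" by (simp only: of_nat_le_iff)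
        then have "1 \<le> real (Suc n) / 2 ^ k" by (simp add: field_simps)
        then show ?thesis using is_rankD(2)[OF r] by linarith
      qed
      show ?thesis using b 2 3 by (simp add: add_divide_distrib)
    qed
    show ?thesis by (rule antisym; rule small[of _ _ 1]) (use 1 in auto)
  qed
  show ?thesis using rank uniq by blast
qed

theorem rank_exists_unique: "\<exists>\<rho>. is_rank \<rho> \<and> (\<forall>\<rho>'. is_rank \<rho>' \<longrightarrow> (\<forall>a\<in>A. \<rho>' a = \<rho> a))"
proof (cases "\<exists>m. atom m")
  case True then show ?thesis using atomic_rank by metis
next
  case False then show ?thesis using nonatomic_rank by blast
qed

end

section \<open>Transvections\<close>

context unital_subring
begin

definition corner :: "'b \<Rightarrow> 'b \<Rightarrow> bool" where
  "corner e x \<longleftrightarrow> x \<in> A \<and> e * x = x \<and> x * e = x"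

text \<open>The inverse is an explicit argument because inverses with respect to different corners
  occur side by side.\<close>

definition corner_inverse :: "'b \<Rightarrow> 'b \<Rightarrow> 'b \<Rightarrow> bool" where
  "corner_inverse e a b \<longleftrightarrow> corner e a \<and> corner e b \<and> a * b = e \<and> b * a = e"

lemma cornerD: "corner e x \<Longrightarrow> x \<in> A" "corner e x \<Longrightarrow> e * x = x" "corner e x \<Longrightarrow> x * e = x"
  by (simp_all add: corner_def)

lemma corner_self: "idem e \<Longrightarrow> corner e e"
  by (simp add: corner_def idem_mult)

lemma corner_zero: "corner e 0"
  by (simp add: corner_def)

lemma corner_add: "corner e x \<Longrightarrow> corner e y \<Longrightarrow> corner e (x + y)"
  by (simp add: corner_def distrib_left distrib_right)

lemma corner_uminus: "corner e x \<Longrightarrow> corner e (- x)"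
  by (simp add: corner_def)

lemma corner_mult: "corner e x \<Longrightarrow> corner e y \<Longrightarrow> corner e (x * y)"
  by (simp add: corner_def mult.assoc mult_assoc_subst[of e x x])

lemma corner_mult_zero: "corner e x \<Longrightarrow> corner f y \<Longrightarrow> e * f = 0 \<Longrightarrow> x * y = 0"
  by (rule mult_zero_via_orth[of x e f y]) (simp_all add: corner_def)

lemma corner_oplus:
  assumes "corner e x" "corner f y" "idem e" "idem f" "e * f = 0" "f * e = 0"
  shows "corner (e + f) (x + y)"
proof -
  have "e * y = 0" "y * e = 0" "f * x = 0" "x * f = 0"
    using corner_mult_zero corner_self assms by metis+
  then show ?thesis using assms(1,2) by (simp add: corner_def distrib_left distrib_right)
qed

lemma oplus_mult:
  assumes "corner e x" "corner e x'" "corner f y" "corner f y'" "e * f = 0" "f * e = 0"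
  shows "(x + y) * (x' + y') = x * x' + y * y'"
  using corner_mult_zero[OF assms(1,4,5)] corner_mult_zero[OF assms(3,2,6)]
  by (simp add: distrib_left distrib_right)

lemma corner_inverse_oplus:
  assumes "corner_inverse e a a'" "corner_inverse f b b'" "idem e" "idem f" "e * f = 0" "f * e = 0"
  shows "corner_inverse (e + f) (a + b) (a' + b')"
  using assms corner_oplus oplus_mult[of e a a' f b b'] oplus_mult[of e a' a f b' b] unfolding corner_inverse_def by simp

lemma corner_inverse_self: "idem e \<Longrightarrow> corner_inverse e e e"
  by (simp add: corner_inverse_def corner_self idem_mult)

lemma corner_inverse_sym: "corner_inverse e a b \<Longrightarrow> corner_inverse e b a"
  by (simp add: corner_inverse_def)

lemma corner_inverse_mult:
  assumes "corner_inverse e a a'" "corner_inverse e b b'"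
  shows "corner_inverse e (a * b) (b' * a')"
proof -
  have "a * b * (b' * a') = a * (b * b') * a'" "b' * a' * (a * b) = b' * (a' * a) * b" by (simp_all only: mult.assoc)
  then show ?thesis using assms by (simp add: corner_inverse_def corner_mult cornerD)
qed

lemma corner_inverse_transport:
  assumes "corner_inverse e a a'" "x \<in> A" "y \<in> A" "x * y = e" "y * x = f" "x * f = x" "f * y = y"
  shows "corner_inverse f (y * a * x) (y * a' * x)"
proof -
  note c = assms(1)[unfolded corner_inverse_def]
  have "y * a * x * (y * a' * x) = y * a * (x * y) * a' * x" "y * a' * x * (y * a * x) = y * a' * (x * y) * a * x"
    by (simp_all only: mult.assoc)
  moreover have "a * (x * y) = a" "a' * (x * y) = a'" using c assms(4) by (simp_all add: corner_def)
  ultimately have 1: "y * a * x * (y * a' * x) = y * (a * a') * x" "y * a' * x * (y * a * x) = y * (a' * a) * x"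
    by (simp_all add: mult.assoc)
  have "y * e * x = (y * x) * (y * x)" using assms(4) by (simp add: mult.assoc mult_assoc_subst[OF assms(4)])
  also have "\<dots> = f" using assms(5-7) by (metis mult.assoc)
  finally have 2: "y * e * x = f" .
  have 3: "f * (y * z * x) = y * z * x" "y * z * x * f = y * z * x" for z
    using assms(6,7) mult_assoc_subst[OF assms(7)] by (simp_all add: mult.assoc)
  show ?thesis using 1 2 3 c assms(2,3) by (auto simp: corner_inverse_def corner_def)
qed

text \<open>Trivial factors with \<open>z = 0\<close> are allowed. Lengths are thereby upper bounds,
  and products on different corners can be padded to a common length.\<close>

inductive tprod :: "'b \<Rightarrow> nat \<Rightarrow> 'b \<Rightarrow> bool" for e where
  zero: "tprod e 0 e"
| Suc: "tprod e n x \<Longrightarrow> corner e z \<Longrightarrow> z * z = 0 \<Longrightarrow> tprod e (Suc n) (x * (e + z))"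

lemma tprod_corner: "tprod e n x \<Longrightarrow> idem e \<Longrightarrow> corner e x"
  by (induction rule: tprod.induct) (auto intro: corner_mult corner_add corner_self)

lemma tprod_mult: "tprod e m y \<Longrightarrow> tprod e n x \<Longrightarrow> idem e \<Longrightarrow> tprod e (n + m) (x * y)"
proof (induction rule: tprod.induct)
  case zero then show ?case using cornerD(3)[OF tprod_corner] by simp
next
  case (Suc m y z) then show ?case using tprod.Suc[of e "n + m" "x * y" z] by (simp add: mult.assoc)
qed

lemma tprod_single: "idem e \<Longrightarrow> corner e z \<Longrightarrow> z * z = 0 \<Longrightarrow> tprod e 1 (e + z)"
  using tprod.Suc[OF tprod.zero, of e z] by (simp add: distrib_left idem_mult cornerD)

lemma tprod_one: "idem e \<Longrightarrow> tprod e n e"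
proof (induction n)
  case (Suc n) then show ?case using tprod.Suc[of e n e 0] by (simp add: corner_zero idem_mult)
qed (rule tprod.zero)

lemma tprod_mono: "tprod e n x \<Longrightarrow> idem e \<Longrightarrow> n \<le> m \<Longrightarrow> tprod e m x"
  using tprod_mult[OF tprod_one[of e "m - n"], of n x] cornerD(3)[OF tprod_corner] by simp

text \<open>Factors on orthogonal corners are merged pairwise, so lengths do not add up. The uniform
  bound on the number of transvections rests on this.\<close>

lemma tprod_oplus:
  assumes "idem e" "idem f" "e * f = 0" "f * e = 0"
  shows "tprod e n x \<Longrightarrow> tprod f n y \<Longrightarrow> tprod (e + f) n (x + y)"
proof (induction n arbitrary: x y)
  case 0
  then have "x = e" "y = f" by (auto elim: tprod.cases)
  then show ?case by (simp add: tprod.zero)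
next
  case (Suc n)
  from Suc.prems(1) obtain x' z where x: "x = x' * (e + z)" "tprod e n x'" "corner e z" "z * z = 0"
    by (auto elim: tprod.cases)
  from Suc.prems(2) obtain y' w where y: "y = y' * (f + w)" "tprod f n y'" "corner f w" "w * w = 0"
    by (auto elim: tprod.cases)
  have "tprod (e + f) (Suc n) ((x' + y') * (e + f + (z + w)))"
  proof (rule tprod.Suc)
    show "tprod (e + f) n (x' + y')" using Suc.IH x y by simp
    show "corner (e + f) (z + w)" using corner_oplus x y assms by simp
    show "(z + w) * (z + w) = 0" using oplus_mult[OF x(3,3) y(3,3)] assms x y by simp
  qed
  moreover have "(x' + y') * (e + z + (f + w)) = x + y"
    unfolding x(1) y(1)
    by (rule oplus_mult[OF tprod_corner[OF x(2) assms(1)] corner_add[OF corner_self[OF assms(1)] x(3)]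
          tprod_corner[OF y(2) assms(2)] corner_add[OF corner_self[OF assms(2)] y(3)] assms(3,4)])
  ultimately show ?case by (simp add: add_ac)
qed

lemma tprod_conj:
  assumes "corner_inverse e g h" "idem e"
  shows "tprod e n x \<Longrightarrow> tprod e n (g * x * h)"
proof (induction rule: tprod.induct)
  case zero
  have "g * e * h = e" using assms(1) by (simp add: corner_inverse_def cornerD)
  then show ?case by (simp add: tprod.zero)
next
  case (Suc n x z)
  note c = assms(1)[unfolded corner_inverse_def]
  have xe: "x * e = x" using cornerD(3)[OF tprod_corner[OF Suc.hyps(1) assms(2)]] .
  have hg: "h * g = e" using c by simp
  have "(g * z * h) * (g * z * h) = g * (z * (h * g) * z) * h" by (simp only: mult.assoc)
  also have "\<dots> = 0" using Suc.hyps cornerD(3)[OF Suc.hyps(2)] hg by simp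
  finally have sq: "(g * z * h) * (g * z * h) = 0" .
  have "(g * x * h) * (e + g * z * h) = g * x * (h * e) + g * (x * (h * g)) * z * h"
    by (simp add: distrib_left mult.assoc)
  also have "\<dots> = g * (x * (e + z)) * h" using hg xe c by (simp add: cornerD distrib_left distrib_right mult.assoc)
  finally have "(g * x * h) * (e + g * z * h) = g * (x * (e + z)) * h" .
  moreover have "tprod e (Suc n) ((g * x * h) * (e + g * z * h))"
    using Suc c sq by (intro tprod.Suc corner_mult) auto
  ultimately show ?case by simp
qed

text \<open>With \<open>x\<close> and \<open>y\<close> as off-diagonal matrix units and
  \<open>b\<close> the inverse of \<open>a\<close>, this is the antidiagonal 2 by 2 matrix with
  entries \<open>a\<close> and \<open>- b\<close>, written as E12(a) E21(-b) E12(a).\<close>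

lemma three_transvections:
  assumes "idem f" "idem f'" "f * f' = 0" "f' * f = 0" "x \<in> A" "y \<in> A" "x * y = f" "y * x = f'"
    "f * x = x" "x * f' = x" "f' * y = y" "y * f = y" "corner_inverse f a b"
  shows "tprod (f + f') 3 (a * x - y * b)"
proof -
  have a: "a \<in> A" "b \<in> A" "f * a = a" "a * f = a" "f * b = b" "b * f = b" "a * b = f" "b * a = f"
    using assms(13) by (simp_all add: corner_inverse_def corner_def)
  have z: "x * a = 0" "x * x = 0" "y * y = 0" "b * y = 0" "f' * a = 0" "f' * x = 0" "a * f' = 0" "f * y = 0" "x * f = 0" "y * f' = 0" "b * f' = 0"
    using mult_zero_via_orth[OF assms(10) a(3) assms(4)] mult_zero_via_orth[OF assms(10,9) assms(4)]
      mult_zero_via_orth[OF assms(12,11,3)] mult_zero_via_orth[OF a(6) assms(11,3)]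
      mult_zero_via_orth[OF idem_mult[OF assms(2)] a(3) assms(4)] mult_zero_via_orth[OF idem_mult[OF assms(2)] assms(9,4)]
      mult_zero_via_orth[OF a(4) idem_mult[OF assms(2)] assms(3)] mult_zero_via_orth[OF idem_mult[OF assms(1)] assms(11,3)]
      mult_zero_via_orth[OF assms(10) idem_mult[OF assms(1)] assms(4)] mult_zero_via_orth[OF assms(12) idem_mult[OF assms(2)] assms(3)]
      mult_zero_via_orth[OF a(6) idem_mult[OF assms(2)] assms(3)]
    by simp_all
  note R = a(3-8) z assms(3,4,7-12) idem_mult[OF assms(1)] idem_mult[OF assms(2)]
  note RR = R R[THEN mult_assoc_subst]
  let ?g = "f + f'"
  have g: "idem ?g" using assms by (intro idem_add)
  have 1: "tprod ?g 1 (?g + a * x)"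
    by (rule tprod_single[OF g]) (use a assms(5,6) in \<open>simp_all add: corner_def algebra_simps RR\<close>)
  have 2: "tprod ?g 1 (?g + - (y * b))"
    by (rule tprod_single[OF g]) (use a assms(5,6) in \<open>simp_all add: corner_def algebra_simps RR\<close>)
  have "tprod ?g (1 + 1 + 1) ((?g + a * x) * (?g + - (y * b)) * (?g + a * x))"
    by (rule tprod_mult[OF 1 tprod_mult[OF 2 1 g] g])
  moreover have "(?g + a * x) * (?g + - (y * b)) * (?g + a * x) = a * x - y * b"
    by (simp add: algebra_simps RR)
  ultimately show ?thesis by (simp add: numeral_3_eq_3)
qed

text \<open>The diagonal matrix with entries \<open>a\<close> and its inverse is a product of two
  antidiagonal matrices, belonging to the units \<open>a\<close> and \<open>- f\<close>. Each costs
  three transvections.\<close>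

lemma whitehead:
  assumes "idem f" "idem f'" "f * f' = 0" "f' * f = 0" "x \<in> A" "y \<in> A" "x * y = f" "y * x = f'"
    "f * x = x" "x * f' = x" "f' * y = y" "y * f = y" "corner_inverse f a b"
  shows "tprod (f + f') 6 (a + y * b * x)"
proof -
  have a: "a \<in> A" "b \<in> A" "f * a = a" "a * f = a" "f * b = b" "b * f = b" "a * b = f" "b * a = f"
    using assms(13) by (simp_all add: corner_inverse_def corner_def)
  have g: "idem (f + f')" using assms by (intro idem_add)
  have m: "corner_inverse f (- f) (- f)" using assms(1) by (simp add: corner_inverse_def corner_def idem_mult)
  have "tprod (f + f') (3 + 3) ((a * x - y * b) * ((- f) * x - y * (- f)))"
    by (rule tprod_mult[OF three_transvections[OF assms(1-12) m] three_transvections[OF assms] g])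
  moreover have "(a * x - y * b) * ((- f) * x - y * (- f)) = a + y * b * x"
  proof -
    have "x * x = 0" "b * y = 0" "y * y = 0"
      using mult_zero_via_orth[OF assms(10,9) assms(4)] mult_zero_via_orth[OF a(6) assms(11,3)] mult_zero_via_orth[OF assms(12,11,3)] by simp_all
    then show ?thesis using assms(7-12) a by (simp add: algebra_simps)
  qed
  ultimately show ?thesis by simp
qed

end

section \<open>Block decomposition of units\<close>

locale nonatomic_rank_subring = irreducible_continuous_subring A u for A :: "'b :: ring set" and u +
  fixes \<rho> :: "'b \<Rightarrow> real"
  assumes rank: "is_rank \<rho>" and nonatomic: "\<not> atom a"
begin

lemmas rank_nonneg = is_rankD(1)[OF rank]
  and rank_le_1 = is_rankD(2)[OF rank]
  and rank_unit = is_rankD(3)[OF rank]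
  and rank_mult_left = is_rankD(4)[OF rank]
  and rank_mult_right = is_rankD(5)[OF rank]
  and rank_add = is_rankD(6)[OF rank]
  and rank_eq_0 = is_rankD(7)[OF rank]

lemma rank_diff:
  assumes "idem e" "idem f" "e * f = f" "f * e = f"
  shows "\<rho> (e - f) = \<rho> e - \<rho> f"
  using rank_add[OF idem_diff(1)[OF assms] assms(2) idem_diff(2,3)[OF assms]] by simp

text \<open>By comparability one idempotent embeds into the other, and the complement of the image
  has rank zero.\<close>

lemma equal_rank_eqv:
  assumes "idem e" "idem f" "\<rho> e = \<rho> f"
  shows "e \<asymp> f"
proof -
  have 1: "e \<asymp> f" if ef: "idem e" "idem f" "\<rho> e = \<rho> f" "e \<preceq> f" for e f
  proof -
    obtain f' where f': "idem f'" "f * f' = f'" "f' * f = f'" "e \<asymp> f'" using below_subidem[OF ef(1,2,4)] .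
    have "\<rho> (f - f') = 0" using rank_diff[OF ef(2) f'(1-3)] rank_eqv[OF rank f'(4)] ef(3) by simp
    moreover have "f - f' \<in> A" using ef(2) f'(1) by auto
    ultimately have "f - f' = 0" using rank_eq_0 by blast
    then show ?thesis using f'(4) by simp
  qed
  show ?thesis using comparable[OF assms(1,2)] 1[OF assms] 1[OF assms(2,1) assms(3)[symmetric]] eqv_sym by metis
qed

lemma smaller_rank_subidem:
  assumes "idem e" "idem f" "\<rho> e \<le> \<rho> f"
  obtains f' where "idem f'" "f * f' = f'" "f' * f = f'" "e \<asymp> f'"
proof -
  have "e \<preceq> f"
  proof (rule ccontr)
    assume *: "\<not> e \<preceq> f"
    then have "f \<preceq> e" using comparable[OF assms(1,2)] by simp
    then have "\<rho> f \<le> \<rho> e" using rank_below[OF rank] assms(1) by simp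
    then have "e \<asymp> f" using equal_rank_eqv assms by simp
    then show False using * eqv_below by simp
  qed
  then show thesis using below_subidem[OF assms(1,2)] that by metis
qed

lemma half:
  assumes "idem e"
  obtains e1 e2 where "idem e1" "idem e2" "e1 * e2 = 0" "e2 * e1 = 0" "e = e1 + e2" "\<rho> e1 = \<rho> e / 2" "\<rho> e2 = \<rho> e / 2"
proof -
  obtain e1 e2 where e: "idem e1" "idem e2" "e1 * e2 = 0" "e2 * e1 = 0" "e = e1 + e2" "e1 \<asymp> e2"
    by (rule halving[OF nonatomic assms])
  have "\<rho> e1 = \<rho> e / 2" "\<rho> e2 = \<rho> e / 2"
    using rank_add[OF e(1-4)] rank_eqv[OF rank e(6)] unfolding e(5) by linarith+
  then show thesis by (rule that[OF e(1-5)])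
qed

text \<open>The row operation with \<open>k\<close> replaces the lower right block \<open>s\<close>
  by \<open>s + k * q\<close>, where \<open>q\<close> is the block above \<open>s\<close>. Kernel
  and cokernel of \<open>s\<close>, given by \<open>n\<close> and \<open>n'\<close>, have the same
  rank, so an isomorphism \<alpha> between them completes \<open>s\<close> to a unit. The inverse
  \<open>a'\<close> provides a \<open>k\<close> for which \<open>k * q\<close> agrees with \<alpha>
  on the kernel.\<close>

lemma exchange_unit:
  assumes f: "idem f" "idem f'" "f * f' = 0" "f' * f = 0" and a: "corner_inverse (f + f') a a'"
  obtains k w where "k \<in> A" "f' * k = k" "k * f = k" "corner_inverse f' (f' * (a + k * a) * f') w"
proof -
  define e where "e = f + f'"
  have aA: "a \<in> A" "a' \<in> A" "a * a' = e" "a' * a = e" "e * a = a" using a by (simp_all add: corner_inverse_def corner_def e_def)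
  note ff = idem_mult[OF f(1)] idem_mult[OF f(2)]
  define q s where "q = f * a * f'" and "s = f' * a * f'"
  have qs: "q \<in> A" "s \<in> A" using f aA by (auto simp: q_def s_def)
  have s: "f' * s = s" "s * f' = s" using ff(2) ff(2)[THEN mult_assoc_subst] by (simp_all add: s_def mult.assoc)
  obtain \<sigma>0 where s0: "\<sigma>0 \<in> A" "s * \<sigma>0 * s = s" "\<sigma>0 * s * \<sigma>0 = \<sigma>0" using quasi_inverse[OF qs(2)] .
  define \<sigma> where "\<sigma> = f' * \<sigma>0 * f'"
  have \<sigma>A: "\<sigma> \<in> A" using s0 f by (auto simp: \<sigma>_def)
  have \<sigma>: "f' * \<sigma> = \<sigma>" "\<sigma> * f' = \<sigma>" using ff(2) ff(2)[THEN mult_assoc_subst] by (simp_all add: \<sigma>_def mult.assoc)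
  have "s * \<sigma> * s = (s * f') * \<sigma>0 * (f' * s)" "\<sigma> * s * \<sigma> = f' * (\<sigma>0 * (f' * s * f') * \<sigma>0) * f'" by (simp_all only: \<sigma>_def mult.assoc)
  then have ss: "s * \<sigma> * s = s" "\<sigma> * s * \<sigma> = \<sigma>" using s s0 by (simp_all add: \<sigma>_def)
  have i: "idem (\<sigma> * s)" "idem (s * \<sigma>)" using quasi_inverse_idem[OF qs(2) \<sigma>A ss(1)] by auto
  define n n' where "n = f' - \<sigma> * s" and "n' = f' - s * \<sigma>"
  have le: "f' * (\<sigma> * s) = \<sigma> * s" "\<sigma> * s * f' = \<sigma> * s" "f' * (s * \<sigma>) = s * \<sigma>" "s * \<sigma> * f' = s * \<sigma>"
    using s \<sigma> s[THEN mult_assoc_subst] \<sigma>[THEN mult_assoc_subst] by (simp_all add: mult.assoc)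
  note n = idem_diff[OF f(2) i(1) le(1,2), folded n_def] and n' = idem_diff[OF f(2) i(2) le(3,4), folded n'_def]
  have "\<rho> n' = \<rho> n"
    using rank_diff[OF f(2) i(1) le(1,2)] rank_diff[OF f(2) i(2) le(3,4)] rank_eqv[OF rank quasi_inverse_eqv[OF qs(2) \<sigma>A ss(1)]]
    by (simp add: n_def n'_def)
  then have "n' \<asymp> n" using equal_rank_eqv[OF n'(1) n(1)] by simp
  then obtain \<alpha> \<beta> where ab: "\<alpha> \<in> A" "\<beta> \<in> A" "\<alpha> * \<beta> = n'" "\<beta> * \<alpha> = n" "n' * \<alpha> = \<alpha>" "\<alpha> * n = \<alpha>" "n * \<beta> = \<beta>" "\<beta> * n' = \<beta>"
    by (rule eqvE)
  have sn: "s * n = 0" "n' * s = 0" "n * \<sigma> = 0" "\<sigma> * n' = 0"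
    using ss s \<sigma> by (simp_all add: n_def n'_def left_diff_distrib right_diff_distrib mult.assoc)
  have \<sigma>\<alpha>: "\<sigma> * \<alpha> = 0" "s * \<beta> = 0" "\<alpha> * \<sigma> = 0" "\<beta> * s = 0"
  proof -
    have "\<sigma> * \<alpha> = (\<sigma> * n') * \<alpha>" "s * \<beta> = (s * n) * \<beta>" using ab(5,7) by (simp_all add: mult.assoc)
    moreover have "\<alpha> * \<sigma> = \<alpha> * (n * \<sigma>)" "\<beta> * s = \<beta> * (n' * s)" using ab(6,8) by (simp_all add: mult.assoc[symmetric])
    ultimately show "\<sigma> * \<alpha> = 0" "s * \<beta> = 0" "\<alpha> * \<sigma> = 0" "\<beta> * s = 0" using sn by simp_all
  qed
  have \<alpha>f: "f' * \<alpha> = \<alpha>" "\<alpha> * f' = \<alpha>" "f' * \<beta> = \<beta>" "\<beta> * f' = \<beta>"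
  proof -
    have "f' * \<alpha> = (f' * n') * \<alpha>" "f' * \<beta> = (f' * n) * \<beta>" using ab(5,7) by (simp_all add: mult.assoc)
    moreover have "\<alpha> * f' = \<alpha> * (n * f')" "\<beta> * f' = \<beta> * (n' * f')" using ab(6,8) by (simp_all add: mult.assoc[symmetric])
    ultimately show "f' * \<alpha> = \<alpha>" "\<alpha> * f' = \<alpha>" "f' * \<beta> = \<beta>" "\<beta> * f' = \<beta>" using n(4,5) n'(4,5) ab by simp_all
  qed
  \<comment> \<open>On \<open>n\<close> the block \<open>s\<close> vanishes, so \<open>a\<close>
    maps \<open>n\<close> into the corner \<open>f\<close> and \<open>a'\<close> brings it back;
    hence \<open>k * q * n\<close> equals \<alpha>.\<close>
  define k where "k = \<alpha> * f' * a' * f"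
  have kA: "k \<in> A" using ab f aA by (auto simp: k_def)
  have k: "f' * k = k" "k * f = k" "n' * k = k"
    using \<alpha>f(1)[THEN mult_assoc_subst] ab(5)[THEN mult_assoc_subst] ff(1) by (simp_all add: k_def mult.assoc)
  have kqn: "k * q * n = \<alpha>"
  proof -
    have fn: "f' * n = n" by (rule n(4))
    have "f' * (a * n) = s * n" using fn by (simp add: s_def mult.assoc)
    then have z: "f' * (a * n) = 0" using sn by simp
    have "a * n = e * (a * n)" using aA(5) by (simp add: mult.assoc[symmetric])
    also have "\<dots> = f * (a * n)" using z by (simp add: e_def distrib_right)
    finally have fan: "f * (a * n) = a * n" by simp
    have en: "e * n = n"
    proof -
      have "f * n = (f * f') * n" using fn by (simp add: mult.assoc)
      then show ?thesis using fn f(3) by (simp add: e_def distrib_right)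
    qed
    have "k * q * n = \<alpha> * (f' * (a' * (f * (f * (a * (f' * n))))))" by (simp add: k_def q_def mult.assoc)
    also have "\<dots> = \<alpha> * (f' * ((a' * a) * n))" using fn fan by (simp add: mult.assoc)
    also have "\<dots> = \<alpha>" using aA(4) en fn ab(6) by simp
    finally show ?thesis .
  qed
  have qf: "q * f' = q" using ff(2) by (simp add: q_def mult.assoc)
  have 1: "k * q = k * q * (n + \<sigma> * s)" using qf by (simp add: n_def mult.assoc)
  have 2: "k * q * (n + \<sigma> * s) = k * q * n + k * q * \<sigma> * s" by (simp only: distrib_left mult.assoc)
  have kq: "k * q = \<alpha> + k * q * \<sigma> * s" using trans[OF 1 2] unfolding kqn .
  define \<nu> where "\<nu> = k * q * \<sigma>"
  have \<nu>A: "\<nu> \<in> A" using kA qs \<sigma>A by (auto simp: \<nu>_def)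
  have \<nu>: "f' * \<nu> = \<nu>" "\<nu> * f' = \<nu>" "\<nu> * \<alpha> = 0"
    using k(1)[THEN mult_assoc_subst] \<sigma> \<sigma>\<alpha> by (simp_all add: \<nu>_def mult.assoc)
  have "\<sigma> * k = \<sigma> * (n' * k)" using k(3) by simp
  also have "\<dots> = 0" using sn(4) by (simp add: mult.assoc[symmetric])
  finally have "\<sigma> * k = 0" .
  then have \<nu>\<nu>: "\<nu> * \<nu> = 0" using mult_assoc_subst[of \<sigma> k 0] by (simp add: \<nu>_def mult.assoc)
  \<comment> \<open>Away from the kernel, \<open>k * q\<close> contributes only \<nu> * s. As
    \<open>k\<close> takes values in the cokernel, which \<sigma> kills, \<nu> squares to zero and
    \<open>f' + \<nu>\<close> is invertible.\<close>
  have v: "s + k * q = (f' + \<nu>) * (s + \<alpha>)"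
  proof -
    have "(f' + \<nu>) * (s + \<alpha>) = s + \<alpha> + \<nu> * s" using s \<alpha>f \<nu> by (simp add: distrib_left distrib_right)
    moreover have "k * q = \<alpha> + \<nu> * s" using kq unfolding \<nu>_def .
    ultimately show ?thesis by (simp only: add.assoc)
  qed
  have c1: "corner_inverse f' (f' + \<nu>) (f' - \<nu>)"
    using \<nu> \<nu>\<nu> \<nu>A ff f by (simp add: corner_inverse_def corner_def algebra_simps)
  have c2: "corner_inverse f' (s + \<alpha>) (\<sigma> + \<beta>)"
  proof -
    have "(s + \<alpha>) * (\<sigma> + \<beta>) = s * \<sigma> + n'" "(\<sigma> + \<beta>) * (s + \<alpha>) = \<sigma> * s + n"
      using \<sigma>\<alpha> ab by (simp_all add: distrib_left distrib_right)
    then have "(s + \<alpha>) * (\<sigma> + \<beta>) = f'" "(\<sigma> + \<beta>) * (s + \<alpha>) = f'" by (simp_all add: n_def n'_def)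
    then show ?thesis using s \<sigma> \<alpha>f qs \<sigma>A ab by (simp add: corner_inverse_def corner_def distrib_left distrib_right)
  qed
  have "f' * (a + k * a) * f' = s + f' * (k * a * f')" by (simp add: s_def distrib_left distrib_right mult.assoc)
  also have "f' * (k * a * f') = (f' * k) * f * a * f'" by (metis k(1,2) mult.assoc)
  also have "\<dots> = k * q" using k(1) by (simp add: q_def mult.assoc)
  finally have "f' * (a + k * a) * f' = (f' + \<nu>) * (s + \<alpha>)" using v by simp
  then show thesis using that[OF kA k(1,2)] corner_inverse_mult[OF c1 c2] by simp
qed

text \<open>Gaussian elimination along the block \<open>v\<close>, made invertible by
  \<open>exchange_unit\<close>, leaves the block diagonal unit with blocks \<open>d\<close> and
  \<open>v\<close>. A Whitehead element then trades \<open>v\<close> for the identity on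
  \<open>f'\<close> and a further factor on \<open>f\<close>, namely \<open>v\<close> transported by
  \<open>x\<close> and \<open>y\<close>.\<close>

lemma halve_unit:
  assumes f: "idem f" "idem f'" "f * f' = 0" "f' * f = 0" "\<rho> f = \<rho> f'" and a: "corner_inverse (f + f') a a'"
  obtains b b' t where "corner_inverse f b b'" "tprod (f + f') 9 t" "a = t * (b + f')"
proof -
  obtain x y where x: "x \<in> A" "y \<in> A" "x * y = f" "y * x = f'" "f * x = x" "x * f' = x" "f' * y = y" "y * f = y"
    using equal_rank_eqv[OF f(1,2,5)] by (rule eqvE)
  define e where "e = f + f'"
  note ff = idem_mult[OF f(1)] idem_mult[OF f(2)]
  have e: "idem e" unfolding e_def using f by (intro idem_add)
  have ef: "e * f = f" "f * e = f" "e * f' = f'" "f' * e = f'" using f ff by (simp_all add: e_def distrib_left distrib_right)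
  note ca = a[folded e_def]
  obtain k w where k: "k \<in> A" "f' * k = k" "k * f = k" and w: "corner_inverse f' (f' * (a + k * a) * f') w"
    using exchange_unit[OF f(1-4) a] .
  have kk: "k * k = 0" using mult_zero_via_orth[OF k(3) k(2) f(3)] .
  have ke: "corner e k"
  proof -
    have "e * k = (e * f') * k" "k * e = k * (f * e)" using k by (simp_all add: mult.assoc[symmetric]) (simp add: mult.assoc)
    then show ?thesis using k ef by (simp add: corner_def)
  qed
  define a1 where "a1 = (e + k) * a"
  have aA: "a \<in> A" "e * a = a" using ca by (simp_all add: corner_inverse_def corner_def)
  have a1: "a1 = a + k * a" using aA by (simp add: a1_def distrib_right)
  have cinv: "corner_inverse e (e + z) (e - z)" if "corner e z" "z * z = 0" for z
    using that e idem_mult[OF e] by (simp add: corner_inverse_def corner_def algebra_simps)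
  have c1: "corner_inverse e a1 (a' * (e - k))" unfolding a1_def by (rule corner_inverse_mult[OF cinv[OF ke kk] ca])
  define p q r v where "p = f * a1 * f" and "q = f * a1 * f'" and "r = f' * a1 * f" and "v = f' * a1 * f'"
  have a1A: "a1 \<in> A" "e * a1 = a1" "a1 * e = a1" using c1 by (simp_all add: corner_inverse_def corner_def)
  have A: "p \<in> A" "q \<in> A" "r \<in> A" "v \<in> A" using a1A f by (auto simp: p_def q_def r_def v_def)
  have "e * a1 * e = p + q + r + v" by (simp add: e_def p_def q_def r_def v_def distrib_left distrib_right add_ac)
  then have blocks: "a1 = p + q + r + v" using a1A by simp
  have w': "w \<in> A" "f' * w = w" "w * f' = w" "v * w = f'" "w * v = f'"
    using w by (simp_all add: corner_inverse_def corner_def v_def a1)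
  have fb: "f * p = p" "p * f = p" "f * q = q" "q * f' = q" "f' * r = r" "r * f = r" "f' * v = v" "v * f' = v"
    using ff ff[THEN mult_assoc_subst] by (simp_all add: p_def q_def r_def v_def mult.assoc)
  have z: "f' * p = 0" "p * f' = 0" "f' * q = 0" "q * f = 0" "f * r = 0" "r * f' = 0" "f * v = 0" "v * f = 0" "f * w = 0" "w * f = 0"
    using mult_zero_via_orth[OF ff(2) fb(1) f(4)] mult_zero_via_orth[OF fb(2) ff(2) f(3)]
     mult_zero_via_orth[OF ff(2) fb(3) f(4)] mult_zero_via_orth[OF fb(4) ff(1) f(4)]
     mult_zero_via_orth[OF ff(1) fb(5) f(3)] mult_zero_via_orth[OF fb(6) ff(2) f(3)]
     mult_zero_via_orth[OF ff(1) fb(7) f(3)] mult_zero_via_orth[OF fb(8) ff(1) f(4)]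
     mult_zero_via_orth[OF ff(1) w'(2) f(3)] mult_zero_via_orth[OF w'(3) ff(1) f(4)] by simp_all
  \<comment> \<open>The Schur complement of \<open>v\<close>.\<close>
  define d where "d = p - q * w * r"
  have dA: "d \<in> A" using A w' by (auto simp: d_def)
  have d: "f * d = d" "d * f = d" "f' * d = 0" "d * f' = 0"
    using fb z fb[THEN mult_assoc_subst] z[THEN mult_assoc_subst] by (simp_all add: d_def left_diff_distrib right_diff_distrib mult.assoc)
  have zz: "w * d = 0" "d * w = 0" "q * d = 0" "w * p = 0" "r * w = 0" "w * q = 0" "r * v = 0" "r * r = 0" "q * q = 0" "d * v = 0" "v * d = 0"
    using mult_zero_via_orth[OF w'(3) d(1) f(4)] mult_zero_via_orth[OF d(2) w'(2) f(3)] mult_zero_via_orth[OF fb(4) d(1) f(4)]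
      mult_zero_via_orth[OF w'(3) fb(1) f(4)] mult_zero_via_orth[OF fb(6) w'(2) f(3)] mult_zero_via_orth[OF w'(3) fb(3) f(4)]
      mult_zero_via_orth[OF fb(6) fb(7) f(3)] mult_zero_via_orth[OF fb(6) fb(5) f(3)] mult_zero_via_orth[OF fb(4) fb(3) f(4)]
      mult_zero_via_orth[OF d(2) fb(7) f(3)] mult_zero_via_orth[OF fb(8) d(1) f(4)] by simp_all
  define L1 R1 where "L1 = q * w" and "R1 = w * r"
  have L1: "corner e L1" "L1 * L1 = 0" and R1: "corner e R1" "R1 * R1 = 0"
    unfolding L1_def R1_def e_def using A w' fb z zz w'(2,3)[THEN mult_assoc_subst] fb[THEN mult_assoc_subst] z[THEN mult_assoc_subst] zz[THEN mult_assoc_subst]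
    by (simp_all add: corner_def distrib_left distrib_right mult.assoc)
  have ed: "e * d = d" "d * e = d" "e * v = v" "v * e = v" using d fb z by (simp_all add: e_def distrib_left distrib_right)
  have fact: "a1 = (e + L1) * (d + v) * (e + R1)"
  proof -
    have "(e + L1) * (d + v) = d + v + q"
      using ed zz w' zz[THEN mult_assoc_subst] fb by (simp add: L1_def distrib_left distrib_right mult.assoc)
    moreover have "(d + v + q) * (e + R1) = d + v + q + r + q * w * r"
    proof -
      have "q * e = q" using fb z by (simp add: e_def distrib_left)
      then show ?thesis using ed zz zz[THEN mult_assoc_subst] mult_assoc_subst[OF w'(4), of r] fb
        by (simp add: R1_def distrib_left distrib_right mult.assoc)
    qed
    ultimately show ?thesis using blocks by (simp add: d_def)
  qed
  define Y Yi where "Y = d + v" and "Yi = (e + R1) * (a' * (e - k)) * (e + L1)"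
  have cY: "corner_inverse e Y Yi"
  proof -
    have "corner_inverse e ((e - L1) * a1 * (e - R1)) ((e + R1) * ((a' * (e - k)) * (e + L1)))"
      by (intro corner_inverse_mult c1 corner_inverse_sym[OF cinv] L1 R1)
    moreover have "(e - L1) * a1 * (e - R1) = Y"
    proof -
      have 1: "(e - L1) * (e + L1) = e" "(e + R1) * (e - R1) = e"
        using cinv[OF L1] cinv[OF R1] by (simp_all add: corner_inverse_def)
      have "(e - L1) * a1 * (e - R1) = ((e - L1) * (e + L1)) * (d + v) * ((e + R1) * (e - R1))"
        unfolding fact by (simp only: mult.assoc)
      also have "\<dots> = e * (d + v) * e" by (simp only: 1)
      also have "\<dots> = Y" using ed by (simp add: Y_def distrib_left distrib_right)
      finally show ?thesis .
    qed
    ultimately show ?thesis by (simp add: Yi_def mult.assoc)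
  qed
  \<comment> \<open>\<open>Y\<close> commutes with \<open>f\<close>, so the compression of its
    inverse to the corner of \<open>f\<close> inverts \<open>d\<close>.\<close>
  define di where "di = f * Yi * f"
  have Yi: "Yi \<in> A" "Y * Yi = e" "Yi * Y = e" using cY by (simp_all add: corner_inverse_def corner_def)
  have fY: "f * Y = d" "Y * f = d" using d z by (simp_all add: Y_def distrib_left distrib_right)
  have cd: "corner_inverse f d di"
  proof -
    have "d * di = f * (Y * Yi) * f" "di * d = f * (Yi * Y) * f"
      using d(1,2)[THEN mult_assoc_subst] fY by (simp_all add: di_def mult.assoc[symmetric]) (simp_all add: mult.assoc d fY)
    then show ?thesis using Yi d dA f ff ff[THEN mult_assoc_subst] ef by (simp add: corner_inverse_def corner_def di_def mult.assoc)
  qed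
  have cv: "corner_inverse f' v w" using w by (simp add: v_def a1)
  have cxv: "corner_inverse f (x * v * y) (x * w * y)"
    by (rule corner_inverse_transport[OF cv x(2,1,4,3) x(8,5)])
  define b b' where "b = d * (x * v * y)" and "b' = (x * w * y) * di"
  have cb: "corner_inverse f b b'" unfolding b_def b'_def by (rule corner_inverse_mult[OF cd cxv])
  define W where "W = x * w * y + v"
  have W: "tprod e 6 W"
  proof -
    have "y * (x * v * y) * x = (y * x) * v * (y * x)" by (simp only: mult.assoc)
    then have "y * (x * v * y) * x = v" using x fb by simp
    then show ?thesis using whitehead[OF f(1-4) x corner_inverse_sym[OF cxv]] by (simp add: W_def e_def)
  qed
  define B B' where "B = b + f'" and "B' = b' + f'"
  have cB: "corner_inverse e B B'" unfolding B_def B'_def e_def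
    by (rule corner_inverse_oplus[OF cb corner_inverse_self[OF f(2)] f(1-4)])
  have BW: "B * W = d + v"
  proof -
    have "corner f b" "corner f (x * w * y)" using cb cxv by (simp_all add: corner_inverse_def)
    moreover have "corner f' f'" "corner f' v" using corner_self[OF f(2)] cv by (simp_all add: corner_inverse_def)
    ultimately have "B * W = b * (x * w * y) + f' * v" unfolding B_def W_def by (rule oplus_mult) (use f in auto)
    moreover have "b * (x * w * y) = d * ((x * v * y) * (x * w * y))" by (simp only: b_def mult.assoc)
    ultimately show ?thesis using cxv d fb by (simp add: corner_inverse_def)
  qed
  define t1 where "t1 = W * (e + R1)"
  have t1: "tprod e (6 + 1) t1" unfolding t1_def by (rule tprod_mult[OF tprod_single[OF e R1] W e])
  define t0 where "t0 = (e + - k) * (e + L1)"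
  have "corner e (- k)" "(- k) * (- k) = 0" using ke kk by (simp_all add: corner_uminus)
  then have t0: "tprod e (1 + 1) t0" unfolding t0_def by (intro tprod_mult tprod_single e L1)
  have at: "a = t0 * B * t1"
  proof -
    have "(e - k) * a1 = ((e - k) * (e + k)) * a" by (simp only: a1_def mult.assoc)
    also have "\<dots> = a" using cinv[OF ke kk] aA by (simp add: corner_inverse_def)
    finally have "a = (e - k) * ((e + L1) * (d + v) * (e + R1))" using fact by simp
    also have "\<dots> = t0 * (B * W) * (e + R1)" unfolding BW t0_def by (simp add: mult.assoc)
    finally show ?thesis by (simp only: t1_def mult.assoc)
  qed
  show thesis
  proof (rule that[OF cb])
    \<comment> \<open>Conjugation by \<open>B\<close> carries the seven transvections on its right
      over to its left.\<close>
    have "tprod e (2 + 7) (t0 * (B * t1 * B'))" using tprod_mult[OF tprod_conj[OF cB e t1] t0 e] by simp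
    then show "tprod (f + f') 9 (t0 * (B * t1 * B'))" by (simp add: e_def)
    have "t0 * (B * t1 * B') * (b + f') = t0 * B * (t1 * (B' * B))" by (simp only: B_def mult.assoc)
    also have "\<dots> = a" using cB cornerD(3)[OF tprod_corner[OF t1 e]] at by (simp add: corner_inverse_def)
    finally show "a = t0 * (B * t1 * B') * (b + f')" by simp
  qed
qed

end

section \<open>Approximation of units by products of transvections\<close>

context unital_subring
begin

definition orth :: "'b \<Rightarrow> 'b \<Rightarrow> bool" where
  "orth e f \<longleftrightarrow> e * f = 0 \<and> f * e = 0"

lemma orthD: "orth e f \<Longrightarrow> e * f = 0" "orth e f \<Longrightarrow> f * e = 0"
  by (simp_all add: orth_def)

lemma orth_sym: "orth e f \<Longrightarrow> orth f e"
  by (simp add: orth_def)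

lemma orth_add: "orth a c \<Longrightarrow> orth b c \<Longrightarrow> orth (a + b) c" "orth c a \<Longrightarrow> orth c b \<Longrightarrow> orth c (a + b)"
  by (simp_all add: orth_def distrib_left distrib_right)

lemma orth_parts:
  assumes "orth (f + f') c" "idem f" "idem f'" "orth f f'"
  shows "orth f c" "orth f' c"
  using orth_summand[of f f' c] orth_summand[of f' f c] assms by (simp_all add: orth_def add.commute)

lemma orth_idem_add: "idem e \<Longrightarrow> idem f \<Longrightarrow> orth e f \<Longrightarrow> idem (e + f)"
  by (simp add: orth_def idem_add)

end

context nonatomic_rank_subring
begin

text \<open>The idempotents \<open>e'\<close> and \<open>c\<close> are spare room. Halving gives
  \<open>a = t * (d + f')\<close> with \<open>d\<close> on \<open>f\<close>. Copies
  \<open>a1\<close> and \<tau> of \<open>d\<close> are placed on \<open>b1\<close> inside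
  \<open>e'\<close> and on \<open>c1\<close> inside \<open>c\<close>. Two Whitehead elements, with
  blocks \<open>d\<close> and the inverse of \<tau> on \<open>f + c1\<close>, and \<tau> and the
  inverse of \<open>a1\<close> on \<open>c1 + b1\<close>, leave the inverse of \<open>a1\<close> as
  the only debt. The induction hypothesis on \<open>b1\<close>, \<open>b'\<close>, \<open>c2\<close>
  approximates \<open>a1\<close> and so cancels it. In the first two factors this level occupies
  \<open>e + c1\<close> and the later ones \<open>b1 + b' + c2\<close>; in the third they occupy
  \<open>c1 + b1\<close> and \<open>b' + c2\<close>. All levels therefore merge. For this
  \<open>Y\<close> has to avoid \<open>e\<close>, and the inverse takes the detour over
  \<open>c1\<close>.\<close>

lemma swindle:
  assumes "idem e" "idem e'" "idem c" "orth e e'" "orth e c" "orth e' c" "\<rho> e' = \<rho> e" "\<rho> c = \<rho> e"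
    "corner_inverse e a a'"
  shows "\<exists>F V Y. tprod (e + e' + c) 9 F \<and> tprod (e + e' + c) 9 V \<and> tprod (e' + c) 9 Y \<and>
           \<rho> (a + e' + c - F * V * (e + Y)) \<le> \<rho> e / 2 ^ m"
  using assms
proof (induction m arbitrary: e e' c a a')
  case 0
  \<comment> \<open>With no steps left, \<open>a\<close> is replaced by \<open>e\<close>; the
    difference lives on \<open>e\<close>.\<close>
  let ?g = "e + e' + c"
  have i: "idem (e' + c)" using 0 by (intro orth_idem_add)
  have g: "idem ?g" using 0 by (intro orth_idem_add orth_add)
  have a: "a \<in> A" "e * a = a" using 0(9) by (simp_all add: corner_inverse_def corner_def)
  have "?g * ?g * (e + (e' + c)) = ?g" using idem_mult[OF g] by (simp add: add.assoc)
  then have "a + e' + c - ?g * ?g * (e + (e' + c)) = e * (a - e)" using a idem_mult[OF 0(1)] by (simp add: right_diff_distrib)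
  moreover have "\<rho> (e * (a - e)) \<le> \<rho> e" using rank_mult_left a 0(1) by simp
  ultimately have "\<rho> (a + e' + c - ?g * ?g * (e + (e' + c))) \<le> \<rho> e / 2 ^ 0" by simp
  then show ?case using tprod_one[OF g, of 9] tprod_one[OF i, of 9] by blast
next
  case (Suc m)
  obtain f f' where f: "idem f" "idem f'" "f * f' = 0" "f' * f = 0" "e = f + f'" "\<rho> f = \<rho> e / 2" "\<rho> f' = \<rho> e / 2"
    by (rule half[OF Suc.prems(1)])
  obtain b1 b' where b: "idem b1" "idem b'" "b1 * b' = 0" "b' * b1 = 0" "e' = b1 + b'" "\<rho> b1 = \<rho> e' / 2" "\<rho> b' = \<rho> e' / 2"
    by (rule half[OF Suc.prems(2)])
  obtain c1 c2 where c: "idem c1" "idem c2" "c1 * c2 = 0" "c2 * c1 = 0" "c = c1 + c2" "\<rho> c1 = \<rho> c / 2" "\<rho> c2 = \<rho> c / 2"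
    by (rule half[OF Suc.prems(3)])
  have ff: "orth f f'" and bb: "orth b1 b'" and cc: "orth c1 c2" using f b c by (simp_all add: orth_def)
  have eb: "orth e b1" "orth e b'" using orth_parts[OF _ b(1,2) bb, of e] Suc.prems(4) orth_sym b(5) by auto
  have ec: "orth e c1" "orth e c2" using orth_parts[OF _ c(1,2) cc, of e] Suc.prems(5) orth_sym c(5) by auto
  have fb: "orth f b1" "orth f b'" "orth f' b1" "orth f' b'" using orth_parts[OF _ f(1,2) ff] eb f(5) by auto
  have fc: "orth f c1" "orth f c2" "orth f' c1" "orth f' c2" using orth_parts[OF _ f(1,2) ff] ec f(5) by auto
  have "orth e' c1" "orth e' c2" using orth_parts[OF _ c(1,2) cc, of e'] Suc.prems(6) orth_sym c(5) by auto
  then have bc: "orth b1 c1" "orth b' c1" "orth b1 c2" "orth b' c2" using orth_parts[OF _ b(1,2) bb] b(5) by auto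
  have ci: "corner_inverse (f + f') a a'" using Suc.prems(9) f(5) by simp
  obtain d d' t where d: "corner_inverse f d d'" "tprod (f + f') 9 t" "a = t * (d + f')"
    by (rule halve_unit[OF f(1-4) _ ci]) (use f in auto)
  have "f \<asymp> b1" using equal_rank_eqv[OF f(1) b(1)] f b Suc.prems by simp
  then obtain x1 y1 where x1: "x1 \<in> A" "y1 \<in> A" "x1 * y1 = f" "y1 * x1 = b1" "f * x1 = x1" "x1 * b1 = x1" "b1 * y1 = y1" "y1 * f = y1"
    by (rule eqvE)
  have "f \<asymp> c1" using equal_rank_eqv[OF f(1) c(1)] f c Suc.prems by simp
  then obtain x2 y2 where x2: "x2 \<in> A" "y2 \<in> A" "x2 * y2 = f" "y2 * x2 = c1" "f * x2 = x2" "x2 * c1 = x2" "c1 * y2 = y2" "y2 * f = y2"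
    by (rule eqvE)
  define a1 a1' \<tau> \<tau>' where "a1 = y1 * d * x1" and "a1' = y1 * d' * x1" and "\<tau> = y2 * d * x2" and "\<tau>' = y2 * d' * x2"
  have ca1: "corner_inverse b1 a1 a1'" unfolding a1_def a1'_def
    by (rule corner_inverse_transport[OF d(1) x1(1,2,3,4,6,7)])
  have c\<tau>: "corner_inverse c1 \<tau> \<tau>'" unfolding \<tau>_def \<tau>'_def
    by (rule corner_inverse_transport[OF d(1) x2(1,2,3,4,6,7)])
  have r: "\<rho> b' = \<rho> b1" "\<rho> c2 = \<rho> b1" "\<rho> b1 = \<rho> e / 2" using b c Suc.prems by simp_all
  obtain F V Y where IH: "tprod (b1 + b' + c2) 9 F" "tprod (b1 + b' + c2) 9 V" "tprod (b' + c2) 9 Y"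
     "\<rho> (a1 + b' + c2 - F * V * (b1 + Y)) \<le> \<rho> b1 / 2 ^ m"
    using Suc.IH[OF b(1,2) c(2) bb bc(3,4) r(1,2) ca1] by metis
  have w1: "tprod (f + c1) 6 (d + \<tau>')" unfolding \<tau>'_def
    by (rule whitehead[OF f(1) c(1) orthD[OF fc(1)] x2 d(1)])
  have w2: "tprod (c1 + b1) 6 (\<tau> + a1')"
  proof -
    have 1: "y1 * x2 * \<tau>' * (y2 * x1) = a1'"
    proof -
      have "y1 * x2 * \<tau>' * (y2 * x1) = y1 * (x2 * y2) * d' * (x2 * y2) * x1" by (simp only: \<tau>'_def mult.assoc)
      also have "\<dots> = y1 * (f * d' * f) * x1" by (simp only: x2 mult.assoc)
      also have "f * d' * f = d'" using d(1) by (simp add: corner_inverse_def corner_def)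
      finally show ?thesis by (simp only: a1'_def)
    qed
    have 2: "y2 * x1 * (y1 * x2) = c1" "y1 * x2 * (y2 * x1) = b1"
    proof -
      have "y2 * x1 * (y1 * x2) = y2 * ((x1 * y1) * x2)" "y1 * x2 * (y2 * x1) = y1 * ((x2 * y2) * x1)" by (simp_all only: mult.assoc)
      then show "y2 * x1 * (y1 * x2) = c1" "y1 * x2 * (y2 * x1) = b1" using x1 x2 by simp_all
    qed
    have 3: "c1 * (y2 * x1) = y2 * x1" "y2 * x1 * b1 = y2 * x1" "b1 * (y1 * x2) = y1 * x2" "y1 * x2 * c1 = y1 * x2"
      using x2(7)[THEN mult_assoc_subst] x1(7)[THEN mult_assoc_subst] x1(6) x2(6) by (simp_all add: mult.assoc)
    have "tprod (c1 + b1) 6 (\<tau> + (y1 * x2) * \<tau>' * (y2 * x1))"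
      by (rule whitehead[OF c(1) b(1) orthD(2,1)[OF bc(1)] _ _ 2 3 c\<tau>]) (use x1 x2 in auto)
    then show ?thesis unfolding 1 .
  qed
  let ?K = "e + c1" and ?H = "b1 + b' + c2"
  have idK: "idem ?K" using Suc.prems c ec by (intro orth_idem_add)
  have idbc: "idem (b' + c2)" using b c bc by (intro orth_idem_add)
  have idH: "idem ?H" using b c bb bc by (intro orth_idem_add orth_add)
  have KH: "orth ?K ?H" using eb ec bc cc orth_sym by (intro orth_add) auto
  have idfc: "idem (f + c1)" using f c fc by (intro orth_idem_add)
  have idcb: "idem (c1 + b1)" using b c bc orth_sym by (intro orth_idem_add) auto
  have ofc: "orth (f + c1) f'" using ff fc orth_sym by (intro orth_add) auto
  have ocb: "orth (c1 + b1) (b' + c2)" using bb bc cc orth_sym by (intro orth_add) auto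
  have tE: "tprod e 9 t" using d(2) f(5) by simp
  have 1: "tprod ?K 9 (t + c1)" by (rule tprod_oplus[OF Suc.prems(1) c(1) orthD[OF ec(1)] tE tprod_one[OF c(1)]])
  have "tprod (f + c1 + f') 9 (d + \<tau>' + f')"
    by (rule tprod_oplus[OF idfc f(2) orthD[OF ofc] tprod_mono[OF w1 idfc] tprod_one[OF f(2)]]) simp
  moreover have "f + c1 + f' = ?K" by (simp add: f(5) add_ac)
  ultimately have 2: "tprod ?K 9 (d + f' + \<tau>')" by (simp add: add_ac)
  have 3: "tprod (c1 + b1 + (b' + c2)) 9 (\<tau> + a1' + Y)"
    by (rule tprod_oplus[OF idcb idbc orthD[OF ocb] tprod_mono[OF w2 idcb] IH(3)]) simp
  have eq: "?K + ?H = e + e' + c" "c1 + b1 + (b' + c2) = e' + c" by (simp_all add: b(5) c(5) add_ac)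
  have t1: "tprod (e + e' + c) 9 (t + c1 + F)" "tprod (e + e' + c) 9 (d + f' + \<tau>' + V)"
    using tprod_oplus[OF idK idH orthD[OF KH] 1 IH(1)] tprod_oplus[OF idK idH orthD[OF KH] 2 IH(2)] unfolding eq by simp_all
  have t2: "tprod (e' + c) 9 (\<tau> + a1' + Y)" using 3 unfolding eq .
  have ca: "corner b1 a1" "corner b1 a1'" "a1 * a1' = b1" "corner c1 \<tau>" "corner c1 \<tau>'" "\<tau>' * \<tau> = c1"
    using ca1 c\<tau> by (simp_all add: corner_inverse_def)
  have cY: "corner (b' + c2) Y" by (rule tprod_corner[OF IH(3) idbc])
  have cF: "corner ?H F" "corner ?H V" by (rule tprod_corner[OF IH(1) idH], rule tprod_corner[OF IH(2) idH])
  have ce: "corner e t" "corner e a" using tprod_corner[OF tE Suc.prems(1)] Suc.prems(9) by (simp_all add: corner_inverse_def)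
  have cdf: "corner e (d + f')" unfolding f(5)
    using corner_oplus[OF _ corner_self[OF f(2)] f(1-4)] d(1) by (simp add: corner_inverse_def)
  have obc: "orth b1 (b' + c2)" using bb bc by (intro orth_add)
  have cH: "corner ?H (a1' + Y)" "corner ?H (b1 + Y)"
    using corner_oplus[OF ca(2) cY b(1) idbc orthD[OF obc]] corner_oplus[OF corner_self[OF b(1)] cY b(1) idbc orthD[OF obc]]
    by (simp_all add: add.assoc)
  have cK: "corner ?K (t + c1)" "corner ?K (d + f' + \<tau>')" "corner ?K (e + \<tau>)"
    using tprod_corner[OF 1 idK] tprod_corner[OF 2 idK] corner_oplus[OF corner_self[OF Suc.prems(1)] ca(4) Suc.prems(1) c(1) orthD[OF ec(1)]] by simp_all
  have "(t + c1 + F) * (d + f' + \<tau>' + V) * (e + (\<tau> + a1' + Y)) = ((t + c1) * (d + f' + \<tau>') + F * V) * ((e + \<tau>) + (a1' + Y))"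
    using oplus_mult[OF cK(1,2) cF orthD[OF KH]] by (simp add: add.assoc)
  also have "\<dots> = (t + c1) * (d + f' + \<tau>') * (e + \<tau>) + F * V * (a1' + Y)"
    by (rule oplus_mult[OF corner_mult[OF cK(1,2)] cK(3) corner_mult[OF cF] cH(1) orthD[OF KH]])
  also have "(t + c1) * (d + f' + \<tau>') = a + \<tau>'"
    using oplus_mult[OF ce(1) cdf corner_self[OF c(1)] ca(5) orthD[OF ec(1)]] d(3) cornerD(2)[OF ca(5)] by simp
  also have "(a + \<tau>') * (e + \<tau>) = a + c1"
    using oplus_mult[OF ce(2) corner_self[OF Suc.prems(1)] ca(5,4) orthD[OF ec(1)]] cornerD(3)[OF ce(2)] ca(6) by simp
  also have "a1' + Y = (b1 + Y) * (a1' + (b' + c2))"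
    using oplus_mult[OF corner_self[OF b(1)] ca(2) cY corner_self[OF idbc] orthD[OF obc]] cornerD(2)[OF ca(2)] cornerD(3)[OF cY] by simp
  finally have prod: "(t + c1 + F) * (d + f' + \<tau>' + V) * (e + (\<tau> + a1' + Y)) = a + c1 + F * V * ((b1 + Y) * (a1' + (b' + c2)))" .
  \<comment> \<open>Writing the identity on \<open>?H\<close> as \<open>a1\<close> times its
    inverse, up to the identity on the rest, exhibits the new error as the old one times a ring
    element, so its rank does not grow.\<close>
  have H: "?H = (a1 + (b' + c2)) * (a1' + (b' + c2))"
    using oplus_mult[OF ca(1,2) corner_self[OF idbc] corner_self[OF idbc] orthD[OF obc]] ca(3) idem_mult[OF idbc] by (simp add: add.assoc)
  have "a + e' + c - (t + c1 + F) * (d + f' + \<tau>' + V) * (e + (\<tau> + a1' + Y)) = ?H - F * V * ((b1 + Y) * (a1' + (b' + c2)))"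
    unfolding prod b(5) c(5) by (simp add: algebra_simps)
  also have "\<dots> = (a1 + b' + c2 - F * V * (b1 + Y)) * (a1' + (b' + c2))"
    by (subst H) (simp only: left_diff_distrib mult.assoc add.assoc)
  finally have eq2: "a + e' + c - (t + c1 + F) * (d + f' + \<tau>' + V) * (e + (\<tau> + a1' + Y)) = (a1 + b' + c2 - F * V * (b1 + Y)) * (a1' + (b' + c2))" .
  have "\<rho> (a + e' + c - (t + c1 + F) * (d + f' + \<tau>' + V) * (e + (\<tau> + a1' + Y))) \<le> \<rho> (a1 + b' + c2 - F * V * (b1 + Y))"
    unfolding eq2 using cornerD(1)[OF ca(1)] cornerD(1)[OF ca(2)] cornerD(1)[OF cF(1)] cornerD(1)[OF cF(2)] cornerD(1)[OF cY] b c
    by (intro rank_mult_left) auto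
  also have "\<dots> \<le> \<rho> e / 2 ^ Suc m" using IH(4) r(3) by simp
  finally show ?case using t1 t2 by blast
qed

text \<open>The tail of the swindle has rank at most \<open>1 / 2 ^ m\<close> while its length does not depend on \<open>m\<close>.\<close>

lemma unit_approximation:
  assumes "corner_inverse u g g'" "\<epsilon> > 0"
  obtains t where "tprod u 45 t" "\<rho> (g - t) < \<epsilon>"
proof -
  \<comment> \<open>Two halvings push the unit onto \<open>e2\<close>, of rank 1/4; this leaves
    \<open>e2'\<close> and \<open>c\<close>, of the same rank, as spare room for
    \<open>swindle\<close>.\<close>
  obtain e1 e1' where e1: "idem e1" "idem e1'" "e1 * e1' = 0" "e1' * e1 = 0" "u = e1 + e1'" "\<rho> e1 = \<rho> u / 2" "\<rho> e1' = \<rho> u / 2"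
    by (rule half[OF idem_unit])
  obtain e2 e2' where e2: "idem e2" "idem e2'" "e2 * e2' = 0" "e2' * e2 = 0" "e1 = e2 + e2'" "\<rho> e2 = \<rho> e1 / 2" "\<rho> e2' = \<rho> e1 / 2"
    by (rule half[OF e1(1)])
  obtain c c' where c: "idem c" "idem c'" "c * c' = 0" "c' * c = 0" "e1' = c + c'" "\<rho> c = \<rho> e1' / 2" "\<rho> c' = \<rho> e1' / 2"
    by (rule half[OF e1(2)])
  obtain a a' t1 where a: "corner_inverse e1 a a'" "tprod (e1 + e1') 9 t1" "g = t1 * (a + e1')"
    by (rule halve_unit[OF e1(1-4), of g g']) (use e1(5-7) assms(1) in auto)
  obtain b b' t2 where b: "corner_inverse e2 b b'" "tprod (e2 + e2') 9 t2" "a = t2 * (b + e2')"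
    by (rule halve_unit[OF e2(1-4), of a a']) (use e2(5-7) a(1) in auto)
  have oe: "orth e1 e1'" and oe2: "orth e2 e2'" and oc: "orth c c'" using e1 e2 c by (simp_all add: orth_def)
  have e1c: "orth e1 c" "orth e1 c'" using orth_parts[OF _ c(1,2) oc, of e1] oe orth_sym c(5) by auto
  have e2c: "orth e2 c" "orth e2' c" "orth e2 c'" "orth e2' c'" using orth_parts[OF _ e2(1,2) oe2] e1c e2(5) by auto
  have r: "\<rho> e2 = 1 / 4" "\<rho> e2' = \<rho> e2" "\<rho> c = \<rho> e2" using e1(6,7) e2(6,7) c(6,7) rank_unit by simp_all
  obtain m where m: "(1/2) ^ m < \<epsilon>" using real_arch_pow_inv[OF assms(2), of "1/2"] by auto
  obtain F V Y where F: "tprod (e2 + e2' + c) 9 F" "tprod (e2 + e2' + c) 9 V" "tprod (e2' + c) 9 Y"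
     "\<rho> (b + e2' + c - F * V * (e2 + Y)) \<le> \<rho> e2 / 2 ^ m"
    using swindle[OF e2(1,2) c(1) oe2 e2c(1,2) r(2,3) b(1), of m] by metis
  have "\<rho> e2 / 2 ^ m \<le> (1/2) ^ m" using r by (simp add: power_one_over field_simps)
  then have lt: "\<rho> (b + e2' + c - F * V * (e2 + Y)) < \<epsilon>" using F(4) m by linarith
  let ?G = "e2 + e2' + c"
  have idec: "idem (e2' + c)" using e2 c e2c by (intro orth_idem_add)
  have idG: "idem ?G" using e2 c oe2 e2c by (intro orth_idem_add orth_add)
  have oG: "orth ?G c'" using e2c oc by (intro orth_add)
  have Gu: "?G + c' = u" by (simp add: e1(5) e2(5) c(5) add_ac)
  have oec: "orth e2 (e2' + c)" using oe2 e2c by (intro orth_add)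
  have "tprod (e2 + (e2' + c)) 9 (e2 + Y)" by (rule tprod_oplus[OF e2(1) idec orthD[OF oec] tprod_one[OF e2(1)] F(3)])
  then have tY: "tprod ?G 9 (e2 + Y)" by (simp add: add.assoc)
  define t3 where "t3 = F * V * (e2 + Y)"
  have t3: "tprod ?G (9 + 9 + 9) t3" unfolding t3_def by (intro tprod_mult F tY idG)
  have t3c: "tprod u (9 + 9 + 9) (t3 + c')"
    using tprod_oplus[OF idG c(2) orthD[OF oG] t3 tprod_one[OF c(2)]] unfolding Gu .
  have t2': "tprod e1 9 t2" using b(2) e2(5) by simp
  have t2e: "tprod u 9 (t2 + e1')"
    using tprod_oplus[OF e1(1-4) t2' tprod_one[OF e1(2)]] e1(5) by simp
  have t1': "tprod u 9 t1" using a(2) e1(5) by simp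
  have cb: "corner e1 (b + e2')" unfolding e2(5)
    using corner_oplus[OF _ corner_self[OF e2(2)] e2(1-4)] b(1) by (simp add: corner_inverse_def)
  have "(t2 + e1') * (b + e2' + e1') = a + e1'"
    using oplus_mult[OF tprod_corner[OF t2' e1(1)] cb corner_self[OF e1(2)] corner_self[OF e1(2)] e1(3,4)] b(3) idem_mult[OF e1(2)] by simp
  then have g: "g = t1 * ((t2 + e1') * (b + e2' + e1'))" using a(3) by simp
  have "b + e2' + e1' - (t3 + c') = b + e2' + c - t3" unfolding c(5) by (simp add: algebra_simps)
  then have "g - t1 * ((t2 + e1') * (t3 + c')) = t1 * ((t2 + e1') * (b + e2' + c - t3))"
    unfolding g by (simp only: right_diff_distrib[symmetric])
  moreover have "\<rho> (t1 * ((t2 + e1') * (b + e2' + c - t3))) < \<epsilon>"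
  proof -
    have A: "t1 \<in> A" "t2 + e1' \<in> A" "b + e2' + c - t3 \<in> A"
      using cornerD(1)[OF tprod_corner[OF t1' idem_unit]] cornerD(1)[OF tprod_corner[OF t2e idem_unit]]
        cornerD(1)[OF tprod_corner[OF t3 idG]] cornerD(1)[OF cb] c by auto
    have "\<rho> (t1 * ((t2 + e1') * (b + e2' + c - t3))) \<le> \<rho> ((t2 + e1') * (b + e2' + c - t3))" using A by (intro rank_mult_right) auto
    also have "\<dots> \<le> \<rho> (b + e2' + c - t3)" using A by (intro rank_mult_right) auto
    finally show ?thesis using lt by (simp add: t3_def)
  qed
  moreover have "tprod u (9 + (9 + (9 + 9 + 9))) (t1 * ((t2 + e1') * (t3 + c')))"
    by (intro tprod_mult t1' t2e t3c idem_unit)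
  ultimately show thesis using that[of "t1 * ((t2 + e1') * (t3 + c'))"] by simp
qed

end

section \<open>Products of conjugates\<close>

context unital_subring
begin

text \<open>In applications \<open>g'\<close> is the inverse of \<open>g\<close>. Conjugating units
  come with their inverses, so that no group structure is needed at this stage.\<close>

inductive conj_products :: "'b \<Rightarrow> 'b \<Rightarrow> nat \<Rightarrow> 'b \<Rightarrow> bool" for g g' where
  zero: "conj_products g g' 0 u"
| left: "conj_products g g' n w \<Longrightarrow> corner_inverse u k k' \<Longrightarrow> conj_products g g' (Suc n) (w * (k * g * k'))"
| right: "conj_products g g' n w \<Longrightarrow> corner_inverse u k k' \<Longrightarrow> conj_products g g' (Suc n) (w * (k * g' * k'))"

lemma corner_unit: "corner u x \<longleftrightarrow> x \<in> A"
  by (auto simp: corner_def)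

lemma conj_products_in: "conj_products g g' n w \<Longrightarrow> g \<in> A \<Longrightarrow> g' \<in> A \<Longrightarrow> w \<in> A"
  by (induction rule: conj_products.induct) (auto simp: corner_inverse_def corner_unit)

lemma conj_products_mult:
  assumes "g \<in> A" "g' \<in> A" "conj_products g g' n w"
  shows "conj_products g g' m v \<Longrightarrow> conj_products g g' (n + m) (w * v)"
proof (induction rule: conj_products.induct)
  case zero then show ?case using assms conj_products_in by simp
next
  case (left m v k k') then show ?case using conj_products.left[of g g' "n + m" "w * v" k k'] by (simp add: mult.assoc)
next
  case (right m v k k') then show ?case using conj_products.right[of g g' "n + m" "w * v" k k'] by (simp add: mult.assoc)
qed

lemma conj_products_conj:
  assumes "g \<in> A" "g' \<in> A" "corner_inverse u h h'"
  shows "conj_products g g' n w \<Longrightarrow> conj_products g g' n (h * w * h')"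
proof -
  have h: "h \<in> A" "h' \<in> A" "h * h' = u" "h' * h = u" using assms(3) by (simp_all add: corner_inverse_def corner_unit)
  have step: "h * (w * (k * z * k')) * h' = (h * w * h') * ((h * k) * z * (k' * h'))" if "w \<in> A" for w k z k'
  proof -
    have "(h * w * h') * ((h * k) * z * (k' * h')) = h * (w * (h' * h)) * (k * z * (k' * h'))" by (simp only: mult.assoc)
    then show ?thesis using that h by (simp add: mult.assoc)
  qed
  show "conj_products g g' n w \<Longrightarrow> conj_products g g' n (h * w * h')"
  proof (induction rule: conj_products.induct)
    case zero then show ?case using conj_products.zero h by simp
  next
    case (left n w k k')
    then show ?case using conj_products.left[OF left.IH corner_inverse_mult[OF assms(3) left.hyps(2)]]
      by (simp only: step[OF conj_products_in[OF left.hyps(1) assms(1,2)]])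
  next
    case (right n w k k')
    then show ?case using conj_products.right[OF right.IH corner_inverse_mult[OF assms(3) right.hyps(2)]]
      by (simp only: step[OF conj_products_in[OF right.hyps(1) assms(1,2)]])
  qed
qed

lemma tprod_conj_products:
  assumes "g \<in> A" "g' \<in> A" "\<And>z. z \<in> A \<Longrightarrow> z * z = 0 \<Longrightarrow> conj_products g g' N (u + z)"
  shows "tprod u n t \<Longrightarrow> conj_products g g' (n * N) t"
proof (induction rule: tprod.induct)
  case zero then show ?case by (simp add: conj_products.zero)
next
  case (Suc n x z)
  have "conj_products g g' N (u + z)" using assms(3) Suc.hyps by (simp add: corner_unit)
  then show ?case using conj_products_mult[OF assms(1,2) Suc.IH] by (simp add: add.commute)
qed

end

section \<open>Square-zero elements\<close>

context regular_subring
begin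

text \<open>Subtracting \<open>z * v * v\<close> removes the part of a quasi-inverse
  \<open>v\<close> that spoils its square. The pair \<open>z\<close>, \<open>w\<close> then behaves
  like the matrix units E12 and E21.\<close>

lemma square_zero_partner:
  assumes "z \<in> A" "z * z = 0"
  obtains w where "w \<in> A" "z * w * z = z" "w * z * w = w" "w * w = 0"
proof -
  obtain v where v: "v \<in> A" "z * v * z = z" "v * z * v = v" using quasi_inverse[OF assms(1)] .
  note R = v(2,3)[simplified mult.assoc] assms(2)
  note RR = R R[THEN mult_assoc_subst, simplified mult.assoc]
  show thesis
  proof (rule that[of "v - z * v * v"])
    show "z * (v - z * v * v) * z = z" "(v - z * v * v) * z * (v - z * v * v) = v - z * v * v"
      "(v - z * v * v) * (v - z * v * v) = 0"
      by (simp_all add: left_diff_distrib right_diff_distrib mult.assoc RR)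
  qed (use v assms in auto)
qed

end

context nonatomic_rank_subring
begin

lemma partner_idem:
  assumes "z \<in> A" "w \<in> A" "z * w * z = z" "w * z * w = w" "z * z = 0" "w * w = 0"
  shows "idem (z * w)" "idem (w * z)" "z * w * (w * z) = 0" "w * z * (z * w) = 0" "\<rho> (z * w) = \<rho> z" "\<rho> (w * z) = \<rho> z"
proof -
  note R = assms(3,4)[simplified mult.assoc] assms(5,6)
  note RR = R R[THEN mult_assoc_subst, simplified mult.assoc]
  show "idem (z * w)" "idem (w * z)" using quasi_inverse_idem[OF assms(1-3)] .
  show "z * w * (w * z) = 0" "w * z * (z * w) = 0" by (simp_all add: mult.assoc RR)
  have "\<rho> z \<le> \<rho> (z * w)" using rank_mult_left[of "z * w" z] assms by simp
  then show *: "\<rho> (z * w) = \<rho> z" using rank_mult_left[of z w] assms by simp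
  show "\<rho> (w * z) = \<rho> z" using rank_eqv[OF rank quasi_inverse_eqv[OF assms(1-3)]] * by simp
qed

text \<open>Both orthogonal idempotents of \<open>partner_idem\<close> have the rank of
  \<open>z\<close>.\<close>

lemma square_zero_rank: assumes "z \<in> A" "z * z = 0" shows "\<rho> z \<le> 1 / 2"
proof -
  obtain w where w: "w \<in> A" "z * w * z = z" "w * z * w = w" "w * w = 0" by (rule square_zero_partner[OF assms])
  note p = partner_idem[OF assms(1) w(1-3) assms(2) w(4)]
  have "\<rho> (z * w + w * z) \<le> 1" using assms w by (intro rank_le_1) auto
  then show ?thesis using rank_add[OF p(1-4)] p by simp
qed

text \<open>Both elements have the normal form of a matrix unit E12 plus a zero block. The
  intertwiner has three summands: \<open>q\<close> matches the images, \<open>m\<close> matches the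
  partner idempotents as \<open>y\<close> and \<open>z\<close> dictate, and \<open>s\<close> matches
  the remaining complements, whose ranks agree.\<close>

lemma square_zero_conjugate:
  assumes z: "z \<in> A" "z * z = 0" and y: "y \<in> A" "y * y = 0" and "\<rho> z = \<rho> y"
  obtains h h' where "corner_inverse u h h'" "h * y * h' = z"
proof -
  obtain w where w: "w \<in> A" "z * w * z = z" "w * z * w = w" "w * w = 0" by (rule square_zero_partner[OF z])
  obtain v where v: "v \<in> A" "y * v * y = y" "v * y * v = v" "v * v = 0" by (rule square_zero_partner[OF y])
  define e f where "e = z * w" and "f = w * z"
  define e' f' where "e' = y * v" and "f' = v * y"
  note p = partner_idem[OF z(1) w(1-3) z(2) w(4), folded e_def f_def]
  note p' = partner_idem[OF y(1) v(1-3) y(2) v(4), folded e'_def f'_def]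
  have ef: "idem (e + f)" "idem (e' + f')" using p p' idem_add by auto
  have lu: "u * (e + f) = e + f" "(e + f) * u = e + f" "u * (e' + f') = e' + f'" "(e' + f') * u = e' + f'" using ef by auto
  have "e \<asymp> e'" using equal_rank_eqv[OF p(1) p'(1)] p p' assms(5) by simp
  then obtain q q' where q: "q \<in> A" "q' \<in> A" "q * q' = e" "q' * q = e'" "e * q = q" "q * e' = q" "e' * q' = q'" "q' * e = q'"
    by (rule eqvE)
  note c = idem_diff[OF idem_unit ef(1) lu(1,2)] and c' = idem_diff[OF idem_unit ef(2) lu(3,4)]
  have "\<rho> (u - (e + f)) = \<rho> (u - (e' + f'))"
    using rank_diff[OF idem_unit ef(1) lu(1,2)] rank_diff[OF idem_unit ef(2) lu(3,4)] rank_add[OF p(1-4)] rank_add[OF p'(1-4)] p p' assms(5) by simp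
  then have "u - (e + f) \<asymp> u - (e' + f')" using equal_rank_eqv[OF c(1) c'(1)] by simp
  then obtain s s' where s: "s \<in> A" "s' \<in> A" "s * s' = u - (e + f)" "s' * s = u - (e' + f')" "(u - (e + f)) * s = s" "s * (u - (e' + f')) = s"
     "(u - (e' + f')) * s' = s'" "s' * (u - (e + f)) = s'"
    by (rule eqvE)
  have zw: "e * z = z" "z * f = z" "f * w = w" "w * e = w" "z * e = 0" "f * z = 0" "e * w = 0" "w * f = 0"
    using w z by (simp_all add: e_def f_def mult.assoc mult_assoc_subst[OF z(2)] mult_assoc_subst[OF w(4)])
  have yv: "e' * y = y" "y * f' = y" "f' * v = v" "v * e' = v" "y * e' = 0" "f' * y = 0" "e' * v = 0" "v * f' = 0"
    using v y by (simp_all add: e'_def f'_def mult.assoc mult_assoc_subst[OF y(2)] mult_assoc_subst[OF v(4)])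
  have ef0: "e * (u - (e + f)) = 0" "f * (u - (e + f)) = 0" "(u - (e + f)) * e = 0" "(u - (e + f)) * f = 0"
    using p idem_mult[OF p(1)] idem_mult[OF p(2)] by (simp_all add: distrib_left distrib_right right_diff_distrib left_diff_distrib)
  have ef0': "e' * (u - (e' + f')) = 0" "f' * (u - (e' + f')) = 0" "(u - (e' + f')) * e' = 0" "(u - (e' + f')) * f' = 0"
    using p' idem_mult[OF p'(1)] idem_mult[OF p'(2)] by (simp_all add: distrib_left distrib_right right_diff_distrib left_diff_distrib)
  define m m' where "m = w * q * y" and "m' = v * q' * z"
  have m: "m \<in> A" "m' \<in> A" "f * m = m" "m * f' = m" "f' * m' = m'" "m' * f = m'"
    using q y v w z zw yv mult_assoc_subst[OF zw(3)] mult_assoc_subst[OF yv(3)] by (auto simp: m_def m'_def mult.assoc)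
  have mm: "m * m' = f" "m' * m = f'"
  proof -
    have "m * m' = w * (q * (y * v) * q') * z" "m' * m = v * (q' * (z * w) * q) * y" by (simp_all only: m_def m'_def mult.assoc)
    then have "m * m' = w * (q * e' * q') * z" "m' * m = v * (q' * e * q) * y" by (simp_all only: e_def e'_def)
    then show "m * m' = f" "m' * m = f'" using q zw yv by (simp_all add: f_def f'_def)
  qed
  have z1: "q * m' = 0" "m * q' = 0" "q * s' = 0" "m * s' = 0" "s * q' = 0" "s * m' = 0"
    using mult_zero_via_orth[OF q(6) m(5) p'(3)] mult_zero_via_orth[OF m(4) q(7) p'(4)] mult_zero_via_orth[OF q(6) s(7) ef0'(1)]
      mult_zero_via_orth[OF m(4) s(7) ef0'(2)] mult_zero_via_orth[OF s(6) q(7) ef0'(3)] mult_zero_via_orth[OF s(6) m(5) ef0'(4)] by simp_all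
  have z2: "q' * m = 0" "m' * q = 0" "q' * s = 0" "m' * s = 0" "s' * q = 0" "s' * m = 0"
    using mult_zero_via_orth[OF q(8) m(3) p(3)] mult_zero_via_orth[OF m(6) q(5) p(4)] mult_zero_via_orth[OF q(8) s(5) ef0(1)]
      mult_zero_via_orth[OF m(6) s(5) ef0(2)] mult_zero_via_orth[OF s(8) q(5) ef0(3)] mult_zero_via_orth[OF s(8) m(3) ef0(4)] by simp_all
  have "(q + m + s) * (q' + m' + s') = u" "(q' + m' + s') * (q + m + s) = u"
    using z1 z2 mm q(3,4) s(3,4) by (simp_all add: distrib_left distrib_right)
  then have h: "corner_inverse u (q + m + s) (q' + m' + s')" using q m s by (simp add: corner_inverse_def corner_unit)
  have "m * y = 0" "s * y = 0" using mult_zero_via_orth[OF m(4) yv(1) p'(4)] mult_zero_via_orth[OF s(6) yv(1) ef0'(3)] .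
  then have 1: "(q + m + s) * y = q * y" by (simp add: distrib_right)
  have "y * q' = 0" "y * s' = 0" using mult_zero_via_orth[OF yv(2) q(7) p'(4)] mult_zero_via_orth[OF yv(2) s(7) ef0'(2)] .
  then have "(q + m + s) * y * (q' + m' + s') = q * y * m'" unfolding 1 by (simp add: distrib_left mult.assoc)
  also have "\<dots> = q * (y * v) * q' * z" by (simp only: m'_def mult.assoc)
  also have "\<dots> = z" using q zw by (simp add: e'_def[symmetric])
  finally show thesis using that[OF h] by simp
qed

text \<open>By \<open>square_zero_conjugate\<close> a single square-zero element of rank
  \<open>s\<close> decides for all of that rank, with the same \<open>n\<close>.\<close>

definition square_zero_class :: "'b \<Rightarrow> 'b \<Rightarrow> nat \<Rightarrow> real \<Rightarrow> bool" where
  "square_zero_class g g' n s \<longleftrightarrow> (\<forall>z\<in>A. z * z = 0 \<longrightarrow> \<rho> z = s \<longrightarrow> conj_products g g' n (u + z))"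

text \<open>A square-zero element of rank \<open>t\<close> is the sum of two of rank \<open>s\<close> that annihilate each other and overlap in
  opposite copies of a square-zero element of rank \<open>s - t / 2\<close>.\<close>

lemma square_zero_class_step:
  assumes g: "g \<in> A" "g' \<in> A" and T: "square_zero_class g g' n s" and e0: "idem e0" "\<rho> e0 = s"
    and t: "0 \<le> t" "t \<le> 2 * s" "s + t / 2 \<le> 1 / 2"
  shows "square_zero_class g g' (n + n) t"
  unfolding square_zero_class_def
proof (intro ballI impI)
  fix z assume z: "z \<in> A" "z * z = 0" "\<rho> z = t"
  obtain w where w: "w \<in> A" "z * w * z = z" "w * z * w = w" "w * w = 0" by (rule square_zero_partner[OF z(1,2)])
  define e f where "e = z * w" and "f = w * z"
  note p = partner_idem[OF z(1) w(1-3) z(2) w(4), folded e_def f_def]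
  have zw: "e * z = z" "z * f = z" "f * w = w" "w * e = w" "z * e = 0" "f * z = 0" "e * w = 0" "w * f = 0"
    using w z by (simp_all add: e_def f_def mult.assoc mult_assoc_subst[OF z(2)] mult_assoc_subst[OF w(4)])
  obtain e1 e2 where e: "idem e1" "idem e2" "e1 * e2 = 0" "e2 * e1 = 0" "e = e1 + e2" "\<rho> e1 = \<rho> e / 2" "\<rho> e2 = \<rho> e / 2"
    by (rule half[OF p(1)])
  have re: "\<rho> e1 = t / 2" "\<rho> e2 = t / 2" using e p z by simp_all
  have "\<rho> e1 \<le> \<rho> e0" using re e0 t by simp
  then obtain e3 where e3: "idem e3" "e0 * e3 = e3" "e3 * e0 = e3" "e1 \<asymp> e3" using smaller_rank_subidem[OF e(1) e0(1)] by metis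
  \<comment> \<open>An idempotent of rank \<open>s - t / 2\<close>, obtained as a difference. The
    assumed \<open>e0\<close> spares an argument about which ranks occur.\<close>
  define h0 where "h0 = e0 - e3"
  note h0 = idem_diff(1)[OF e0(1) e3(1-3), folded h0_def]
  have rh: "\<rho> h0 = s - t / 2" unfolding h0_def using rank_diff[OF e0(1) e3(1-3)] rank_eqv[OF rank e3(4)] re e0 by simp
  have ef: "idem (e + f)" using p by (intro idem_add)
  have lu: "u * (e + f) = e + f" "(e + f) * u = e + f" using ef by auto
  define c where "c = u - (e + f)"
  note c = idem_diff[OF idem_unit ef lu, folded c_def]
  have ef0: "e * c = 0" "f * c = 0" "c * e = 0" "c * f = 0"
    using p idem_mult[OF p(1)] idem_mult[OF p(2)] by (simp_all add: c_def distrib_left distrib_right right_diff_distrib left_diff_distrib)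
  have rc: "\<rho> c = 1 - 2 * t" unfolding c_def
    using rank_diff[OF idem_unit ef lu] rank_add[OF p(1-4)] p z rank_unit by simp
  \<comment> \<open>The complement has rank 1 - 2 t, so it holds two orthogonal copies of
    \<open>h0\<close> precisely when \<open>s + t / 2 \<le> 1 / 2\<close>.\<close>
  have "\<rho> h0 \<le> \<rho> c" using rh rc t by linarith
  then obtain q1 where q1: "idem q1" "c * q1 = q1" "q1 * c = q1" "h0 \<asymp> q1" using smaller_rank_subidem[OF h0 c(1)] by metis
  note c1 = idem_diff[OF c(1) q1(1-3)]
  have "\<rho> h0 \<le> \<rho> (c - q1)" using rank_diff[OF c(1) q1(1-3)] rank_eqv[OF rank q1(4)] rh rc t by linarith
  then obtain q2 where q2: "idem q2" "(c - q1) * q2 = q2" "q2 * (c - q1) = q2" "h0 \<asymp> q2" using smaller_rank_subidem[OF h0 c1(1)] by metis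
  have qq: "q1 * q2 = 0" "q2 * q1 = 0"
    using mult_zero_via_orth[OF idem_mult[OF q1(1)] q2(2) c1(3)] mult_zero_via_orth[OF q2(3) idem_mult[OF q1(1)] c1(2)] .
  have "q1 \<asymp> q2" using eqv_trans[OF eqv_sym[OF q1(4)] q2(4)] .
  then obtain d d' where d: "d \<in> A" "d' \<in> A" "d * d' = q1" "d' * d = q2" "q1 * d = d" "d * q2 = d" "q2 * d' = d'" "d' * q1 = d'"
    by (rule eqvE)
  have cq2: "c * q2 = q2" "q2 * c = q2"
  proof -
    have "c * q2 = (c * (c - q1)) * q2" "q2 * c = q2 * ((c - q1) * c)" using q2(2,3) by (simp_all add: mult.assoc[symmetric]) (simp add: mult.assoc)
    then show "c * q2 = q2" "q2 * c = q2" using c1(4,5) q2(2,3) by simp_all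
  qed
  have cd: "c * d = d" "d * c = d" "c * d' = d'" "d' * c = d'"
  proof -
    have "c * d = (c * q1) * d" "c * d' = (c * q2) * d'" using d by (simp_all add: mult.assoc)
    moreover have "d * c = d * (q2 * c)" "d' * c = d' * (q1 * c)" using d by (simp_all add: mult.assoc[symmetric])
    ultimately show "c * d = d" "d * c = d" "c * d' = d'" "d' * c = d'" using cq2 q1 d by simp_all
  qed
  have ee: "e * e1 = e1" "e1 * e = e1" "e * e2 = e2" "e2 * e = e2"
    using idem_mult[OF e(1)] idem_mult[OF e(2)] e(3,4) by (simp_all add: e(5) distrib_left distrib_right)
  have zs: "z * d = 0" "z * d' = 0" "d * z = 0" "d * e1 = 0" "d * e2 = 0" "e1 * d = 0" "e2 * d = 0" "d * w = 0" "q1 * e1 = 0" "q1 * e2 = 0"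
      "z * e1 = 0" "z * e2 = 0" "d * d = 0" "e1 * q1 = 0" "e2 * q1 = 0"
    using mult_zero_via_orth[OF zw(2) cd(1) ef0(2)] mult_zero_via_orth[OF zw(2) cd(3) ef0(2)] mult_zero_via_orth[OF cd(2) zw(1) ef0(3)]
      mult_zero_via_orth[OF cd(2) ee(1) ef0(3)] mult_zero_via_orth[OF cd(2) ee(3) ef0(3)] mult_zero_via_orth[OF ee(2) cd(1) ef0(1)]
      mult_zero_via_orth[OF ee(4) cd(1) ef0(1)] mult_zero_via_orth[OF cd(2) zw(3) ef0(4)] mult_zero_via_orth[OF q1(3) ee(1) ef0(3)]
      mult_zero_via_orth[OF q1(3) ee(3) ef0(3)] mult_zero_via_orth[OF zw(2) ee(1) p(4)] mult_zero_via_orth[OF zw(2) ee(3) p(4)]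
      mult_zero_via_orth[OF d(6,5) qq(2)] mult_zero_via_orth[OF ee(2) q1(2) ef0(1)] mult_zero_via_orth[OF ee(4) q1(2) ef0(1)] by simp_all
  note R = zs ee e(3,4) d(3,5) idem_mult[OF e(1)] idem_mult[OF e(2)] e_def[symmetric]
  note RR = R R[THEN mult_assoc_subst]
  define m1 m2 where "m1 = e1 * z + d" and "m2 = e2 * z - d"
  have mA: "m1 \<in> A" "m2 \<in> A" using z d e by (auto simp: m1_def m2_def)
  have sq: "m1 * m1 = 0" "m2 * m2 = 0"
    by (simp_all add: m1_def m2_def distrib_left distrib_right left_diff_distrib right_diff_distrib mult.assoc RR)
  have r: "\<rho> m = \<rho> (h + q1)" if h: "idem h" "h * q1 = 0" "q1 * h = 0" "m \<in> A" "v \<in> A" "(h + q1) * m = m" "m * v = h + q1" for m h v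
    using rank_mult_left[of "h + q1" m] rank_mult_left[of m v] h q1 by auto
  have r1: "\<rho> m1 = s"
  proof -
    have "\<rho> m1 = \<rho> (e1 + q1)"
      by (rule r[OF e(1) _ _ mA(1), of "w * e1 + d'"])
        (use w e d in \<open>auto simp: m1_def distrib_left distrib_right mult.assoc RR\<close>)
    then show ?thesis using rank_add[OF e(1) q1(1)] zs rank_eqv[OF rank q1(4)] rh re by simp
  qed
  have r2: "\<rho> m2 = s"
  proof -
    have "\<rho> m2 = \<rho> (e2 + q1)"
      by (rule r[OF e(2) _ _ mA(2), of "w * e2 - d'"])
        (use w e d in \<open>auto simp: m2_def distrib_left distrib_right left_diff_distrib right_diff_distrib mult.assoc RR\<close>)
    then show ?thesis using rank_add[OF e(2) q1(1)] zs rank_eqv[OF rank q1(4)] rh re by simp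
  qed
  have "m1 * m2 = 0"
    by (simp add: m1_def m2_def distrib_left distrib_right left_diff_distrib right_diff_distrib mult.assoc RR)
  moreover have "m1 + m2 = z" using zw(1) by (simp add: m1_def m2_def e(5) distrib_right)
  ultimately have "(u + m1) * (u + m2) = u + z" using mA by (simp add: distrib_left distrib_right add.assoc)
  moreover have "conj_products g g' (n + n) ((u + m1) * (u + m2))"
    using conj_products_mult[OF g] T mA sq r1 r2 unfolding square_zero_class_def by simp
  ultimately show "conj_products g g' (n + n) (u + z)" by simp
qed

lemma small_rank: "idem e \<Longrightarrow> \<exists>f. idem f \<and> \<rho> f = \<rho> e / 2 ^ k"
proof (induction k)
  case 0 then show ?case by (intro exI[of _ e]) simp
next
  case (Suc k)
  then obtain f where f: "idem f" "\<rho> f = \<rho> e / 2 ^ k" by blast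
  obtain f1 f2 where "idem f1" "\<rho> f1 = \<rho> f / 2" using half[OF f(1)] by metis
  then show ?case using f by (intro exI[of _ f1]) simp
qed

text \<open>For orthogonal idempotents p and q the element p + p x q is idempotent, so
  \<open>g\<close> commutes with all off-diagonal elements. Halving the unit writes each diagonal
  block as a product of two of these.\<close>

lemma commutes_if_commutes_with_idems:
  assumes g: "g \<in> A" and comm: "\<And>e. idem e \<Longrightarrow> g * e = e * g" and k: "k \<in> A"
  shows "g * k = k * g"
proof -
  obtain e f where e: "idem e" "idem f" "e * f = 0" "f * e = 0" "u = e + f" "e \<asymp> f"
    by (rule halving[OF nonatomic idem_unit])
  have off: "g * (p * x * q) = p * x * q * g" if h: "idem p" "idem q" "p * q = 0" "q * p = 0" "x \<in> A" for p q x
  proof -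
    have "idem (p + p * x * q)"
    proof (rule idemI)
      show "p + p * x * q \<in> A" using h by auto
      show "(p + p * x * q) * (p + p * x * q) = p + p * x * q"
        using h idem_mult[OF h(1)] by (simp add: distrib_left distrib_right mult.assoc mult_assoc_subst[OF idem_mult[OF h(1)]] mult_assoc_subst[OF h(4)])
    qed
    then have "g * (p + p * x * q) = (p + p * x * q) * g" by (rule comm)
    then show ?thesis using comm[OF h(1)] by (simp add: distrib_left distrib_right)
  qed
  have mult: "g * (p * q) = p * q * g" if "g * p = p * g" "g * q = q * g" for p q
  proof -
    have "g * (p * q) = (g * p) * q" "p * q * g = p * (q * g)" by (simp_all only: mult.assoc)
    then show ?thesis using that by (simp add: mult.assoc)
  qed
  obtain x y where x: "x \<in> A" "y \<in> A" "x * y = e" "y * x = f" "e * x = x" "x * f = x" "f * y = y" "y * e = y"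
    using e(6) by (rule eqvE)
  have "g * ((e * (k * x) * f) * (f * y * e)) = (e * (k * x) * f) * (f * y * e) * g"
    by (intro mult off e) (use k x in auto)
  moreover have "(e * (k * x) * f) * (f * y * e) = e * k * e" using x by (simp add: mult.assoc)
  ultimately have 1: "g * (e * k * e) = e * k * e * g" by simp
  have "g * ((f * (k * y) * e) * (e * x * f)) = (f * (k * y) * e) * (e * x * f) * g"
    by (intro mult off e) (use k x in auto)
  moreover have "(f * (k * y) * e) * (e * x * f) = f * k * f" using x by (simp add: mult.assoc)
  ultimately have 2: "g * (f * k * f) = f * k * f * g" by simp
  have 3: "g * (e * k * f) = e * k * f * g" "g * (f * k * e) = f * k * e * g" using off e k by auto
  have "u * k * u = e * k * e + e * k * f + (f * k * e + f * k * f)"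
    unfolding e(5) by (simp only: distrib_left distrib_right add_ac)
  then have "g * (u * k * u) = (u * k * u) * g" by (simp only: distrib_left distrib_right 1 2 3)
  then show ?thesis using k by simp
qed

text \<open>The commutator of \<open>g\<close> with \<open>u + x\<close> is
  \<open>u + (w - x)\<close> for \<open>w = g * x * g'\<close>, provided that \<open>x\<close>
  annihilates \<open>x\<close>, \<open>g * x\<close> and \<open>g' * x\<close>. Hence
  \<open>x\<close> takes values in a small \<open>f1\<close> and vanishes on an idempotent
  \<open>q\<close> covering \<open>f1\<close> and its images under \<open>g\<close> and
  \<open>g'\<close>. Choosing \<open>f1\<close> so that \<open>g\<close> moves it to an independent
  position keeps \<open>w\<close> different from \<open>x\<close>.\<close>

lemma small_transvection:
  assumes gi: "corner_inverse u g g'" and k: "k \<in> A" "g * k \<noteq> k * g"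
  obtains z where "z \<in> A" "z * z = 0" "z \<noteq> 0" "\<rho> z \<le> 1 / 4" "conj_products g g' 2 (u + z)"
proof -
  have g: "g \<in> A" "g' \<in> A" "g * g' = u" "g' * g = u" using gi by (simp_all add: corner_inverse_def corner_unit)
  \<comment> \<open>Otherwise \<open>g\<close> would commute with every idempotent, hence with
    \<open>k\<close>.\<close>
  obtain e where e: "idem e" "(u - e) * g * e \<noteq> 0"
  proof -
    have "\<exists>e. idem e \<and> (u - e) * g * e \<noteq> 0"
    proof (rule ccontr)
      assume *: "\<nexists>e. idem e \<and> (u - e) * g * e \<noteq> 0"
      have "g * e = e * g" if i: "idem e" for e
      proof -
        have "(u - e) * g * e = 0" "(u - (u - e)) * g * (u - e) = 0" using * i idem_compl by blast+
        then show ?thesis using i g by (simp add: left_diff_distrib right_diff_distrib)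
      qed
      then show False using commutes_if_commutes_with_idems[OF g(1) _ k(1)] k(2) by blast
    qed
    then show thesis using that by blast
  qed
  define a where "a = (u - e) * g * e"
  have aA: "a \<in> A" using e g by (auto simp: a_def)
  obtain b0 where b0: "b0 \<in> A" "a * b0 * a = a" using regular[OF aA] by blast
  define b where "b = e * b0 * (u - e)"
  have bA: "b \<in> A" using b0 e by (auto simp: b_def)
  have ce: "(u - e) * e = 0" "(u - e) * (u - e) = u - e" using e idem_mult[OF idem_compl[OF e(1)]] idem_mult[OF e(1)] by (simp_all add: left_diff_distrib)
  have ae: "a * e = a" "(u - e) * a = a" using ce idem_mult[OF e(1)] by (simp_all add: a_def mult.assoc mult_assoc_subst[OF ce(2)])
  have "a * b * a = (a * e) * b0 * ((u - e) * a)" by (simp only: b_def mult.assoc)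
  then have aba: "a * b * a = a" using ae b0 by simp
  define f0 where "f0 = b * a"
  have f0: "idem f0" unfolding f0_def using quasi_inverse_idem[OF aA bA aba] by simp
  have eb: "e * b = b" "b * (u - e) = b" using ce idem_mult[OF e(1)] by (simp_all add: b_def mult.assoc mult_assoc_subst[OF idem_mult[OF e(1)]])
  have ef0: "e * f0 = f0" using eb by (simp add: f0_def mult_assoc_subst)
  have "a * f0 = a" using aba by (simp add: f0_def mult.assoc)
  then have "f0 \<noteq> 0" using e(2) by (auto simp: a_def)
  then have rf0: "\<rho> f0 > 0" using rank_eq_0[of f0] rank_nonneg[of f0] f0 by (cases "\<rho> f0 = 0") auto
  have bf0: "b * f0 = 0" using mult_zero_via_orth[OF eb(2) ef0 ce(1)] .
  have bgf0: "b * (g * f0) = f0"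
  proof -
    have "b * (g * f0) = b * ((u - e) * g * e) * f0" using eb(2)[THEN mult_assoc_subst] ef0 by (simp add: mult.assoc)
    also have "\<dots> = f0" using idem_mult[OF f0] by (simp add: a_def[symmetric] f0_def[symmetric])
    finally show ?thesis .
  qed
  \<comment> \<open>The factor 8 serves twice: \<open>q\<close> has rank at most 3/8, which leaves
    room for \<open>p\<close> outside it, and \<open>w - x\<close> has rank at most 1/4, as the
    later enlargement requires.\<close>
  obtain f2 where f2: "idem f2" "\<rho> f2 = \<rho> f0 / 2 ^ 3" using small_rank[OF f0] by blast
  obtain f1 where f1: "idem f1" "f0 * f1 = f1" "f1 * f0 = f1" "f2 \<asymp> f1"
    by (rule smaller_rank_subidem[OF f2(1) f0]) (use f2 rf0 in auto)
  have rf1: "\<rho> f1 = \<rho> f0 / 8" using rank_eqv[OF rank f1(4)] f2 by simp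
  have rf1': "\<rho> f1 \<le> 1 / 8" "\<rho> f1 > 0" using rf1 rf0 rank_le_1[of f0] f0 by auto
  have f1A: "f1 \<in> A" using f1 by auto
  have bf1: "b * f1 = 0" "b * (g * f1) = f1"
  proof -
    have "b * f1 = (b * f0) * f1" "b * (g * f1) = (b * (g * f0)) * f1" using f1(2) by (simp_all add: mult.assoc)
    then show "b * f1 = 0" "b * (g * f1) = f1" using bf0 bgf0 f1(2) by simp_all
  qed
  have gA: "g * f1 \<in> A" "g' * f1 \<in> A" using g f1A by auto
  have rg: "\<rho> (g * f1) \<le> 1 / 8" "\<rho> (g' * f1) \<le> 1 / 8"
    using rank_mult_right[OF g(1) f1A] rank_mult_right[OF g(2) f1A] rf1' by linarith+
  obtain q0 where q0: "idem q0" "q0 * f1 = f1" "q0 * (g * f1) = g * f1" "\<rho> q0 \<le> \<rho> f1 + \<rho> (g * f1)"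
    by (rule join_rank[OF rank f1A gA(1)])
  obtain q where q: "idem q" "q * q0 = q0" "q * (g' * f1) = g' * f1" "\<rho> q \<le> \<rho> q0 + \<rho> (g' * f1)"
    by (rule join_rank[OF rank idem_in[OF q0(1)] gA(2)])
  have qf: "q * f1 = f1" "q * (g * f1) = g * f1"
    using mult_assoc_subst[OF q(2), of f1] mult_assoc_subst[OF q(2), of "g * f1"] unfolding q0(2,3) .
  have uq: "u * q = q" "q * u = q" using q by auto
  note cq = idem_diff[OF idem_unit q(1) uq]
  have "\<rho> f1 \<le> \<rho> (u - q)" using rank_diff[OF idem_unit q(1) uq] rank_unit q(4) q0(4) rg rf1' by linarith
  then obtain p where p: "idem p" "(u - q) * p = p" "p * (u - q) = p" "f1 \<asymp> p" using smaller_rank_subidem[OF f1(1) cq(1)] by metis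
  obtain x y where x: "x \<in> A" "y \<in> A" "x * y = f1" "y * x = p" "f1 * x = x" "x * p = x" "p * y = y" "y * f1 = y"
    using p(4) by (rule eqvE)
  have "p * q = 0" using mult_zero_via_orth[OF p(3) idem_mult[OF q(1)] cq(2)] .
  then have xq: "x * q = 0" using x(6) by (metis mult.assoc mult_zero_right)
  have zero: "x * f1 = 0" "x * (g * f1) = 0" "x * (g' * f1) = 0"
  proof -
    have "x * f1 = x * (q * f1)" "x * (g * f1) = x * (q * (g * f1))" "x * (g' * f1) = x * (q * (g' * f1))" using qf q by simp_all
    then show "x * f1 = 0" "x * (g * f1) = 0" "x * (g' * f1) = 0" using xq[THEN mult_assoc_subst] by simp_all
  qed
  have xx: "x * x = 0" "x * (g * x) = 0" "x * (g' * x) = 0"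
  proof -
    have "x * x = (x * f1) * x" "x * (g * x) = (x * (g * f1)) * x" "x * (g' * x) = (x * (g' * f1)) * x" using x(5) by (simp_all add: mult.assoc)
    then show "x * x = 0" "x * (g * x) = 0" "x * (g' * x) = 0" using zero by simp_all
  qed
  define w where "w = g * x * g'"
  have wA: "w \<in> A" using g x by (auto simp: w_def)
  have ww: "w * w = 0" "w * x = 0" "x * w = 0"
  proof -
    have "w * w = g * (x * (g' * g) * x) * g'" "w * x = g * (x * (g' * x))" "x * w = (x * (g * x)) * g'" by (simp_all only: w_def mult.assoc)
    then show "w * w = 0" "w * x = 0" "x * w = 0" using xx g x by simp_all
  qed
  have "x \<noteq> 0" using x(3) rf1' rank_zero[OF rank] by auto
  \<comment> \<open>If they were equal, \<open>g\<close> would commute with \<open>x\<close>; but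
    \<open>b\<close> kills \<open>f1\<close> while it inverts \<open>g\<close> on
    \<open>f1\<close>.\<close>
  have "w \<noteq> x"
  proof
    assume "w = x"
    then have "g * x * (g' * g) = x * g" by (simp add: w_def mult.assoc[symmetric])
    then have gx: "g * x = x * g" using g x by simp
    have "x = b * (g * f1) * x" using bf1 x by simp
    also have "\<dots> = b * (g * x)" using x(5) by (simp add: mult.assoc)
    also have "\<dots> = (b * f1) * x * g" unfolding gx using x(5) by (simp add: mult.assoc mult_assoc_subst[OF x(5)])
    also have "\<dots> = 0" using bf1 by simp
    finally show False using \<open>x \<noteq> 0\<close> by simp
  qed
  have "\<rho> x \<le> \<rho> f1" using rank_mult_left[OF f1A x(1)] x(5) by simp
  moreover have "\<rho> w \<le> \<rho> x"
    using rank_mult_left[of "g * x" g'] rank_mult_right[OF g(1) x(1)] g x by (auto simp: w_def)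
  moreover have "\<rho> (w + - x) \<le> \<rho> w + \<rho> (- x)" using rank_subadditive[OF rank wA uminus_in[OF x(1)]] .
  ultimately have rz: "\<rho> (w - x) \<le> 1 / 4" using rank_uminus[OF rank x(1)] rf1' by simp
  have cu: "corner_inverse u u u" by (rule corner_inverse_self) simp
  have cx: "corner_inverse u (u + x) (u - x)" using x xx by (simp add: corner_inverse_def corner_unit algebra_simps)
  have "conj_products g g' (Suc (Suc 0)) (u * (u * g * u) * ((u + x) * g' * (u - x)))"
    by (intro conj_products.right conj_products.left conj_products.zero cu cx)
  moreover have "u * (u * g * u) * ((u + x) * g' * (u - x)) = u + (w - x)"
  proof -
    have "u * (u * g * u) * ((u + x) * g' * (u - x)) = (g * g' + w) * (u - x)"
      using g x mult_assoc_subst[OF g(3)] by (simp add: w_def distrib_left distrib_right mult.assoc right_diff_distrib)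
    then show ?thesis using g ww wA x by (simp add: distrib_right right_diff_distrib)
  qed
  ultimately have "conj_products g g' 2 (u + (w - x))" by (simp add: numeral_2_eq_2)
  then show thesis using that[of "w - x"] wA x ww xx \<open>w \<noteq> x\<close> rz by (simp add: left_diff_distrib right_diff_distrib)
qed

text \<open>One step leads from the rank of \<open>y\<close> to a dyadic rank of at most 1/4,
  doubling leads from there exactly to 1/4, and a last step from 1/4 to every rank up to 1/2, the
  largest that a square-zero element can have. For dyadic ranks, \<open>small_rank\<close> provides
  the idempotents that the steps ask for.\<close>

lemma all_transvections:
  assumes gi: "corner_inverse u g g'" and k: "k \<in> A" "g * k \<noteq> k * g"
  shows "\<exists>N. \<forall>z\<in>A. z * z = 0 \<longrightarrow> conj_products g g' N (u + z)"
proof -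
  have g: "g \<in> A" "g' \<in> A" using gi by (simp_all add: corner_inverse_def corner_unit)
  obtain y where y: "y \<in> A" "y * y = 0" "y \<noteq> 0" "\<rho> y \<le> 1 / 4" "conj_products g g' 2 (u + y)"
    by (rule small_transvection[OF assms])
  have T0: "square_zero_class g g' 2 (\<rho> y)" unfolding square_zero_class_def
  proof (intro ballI impI)
    fix z assume z: "z \<in> A" "z * z = 0" "\<rho> z = \<rho> y"
    obtain h h' where h: "corner_inverse u h h'" "h * y * h' = z" by (rule square_zero_conjugate[OF z(1,2) y(1,2) z(3)])
    have "h * (u + y) * h' = u + z" using h by (simp add: corner_inverse_def corner_unit distrib_left distrib_right)
    then show "conj_products g g' 2 (u + z)" using conj_products_conj[OF g h(1) y(5)] by simp
  qed
  have ry: "\<rho> y > 0" using rank_eq_0[OF y(1)] rank_nonneg[OF y(1)] y(3) by (cases "\<rho> y = 0") auto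
  obtain i where i: "(1/2) ^ i < \<rho> y" using real_arch_pow_inv[OF ry, of "1/2"] by auto
  obtain w where w: "w \<in> A" "y * w * y = y" "w * y * w = w" "w * w = 0" by (rule square_zero_partner[OF y(1,2)])
  have start: "\<exists>N. square_zero_class g g' N (1 / 2 ^ (i + 2))"
  proof -
    define \<delta> :: real where "\<delta> = 1 / 2 ^ (i + 2)"
    have "(1::real) \<le> 2 ^ i" "(1::real) \<le> 2 * 2 ^ i" using one_le_power[of "2::real" i] by linarith+
    then have "\<delta> \<le> (1/2) ^ i" "\<delta> \<le> 1 / 4" "0 \<le> \<delta>" by (simp_all add: \<delta>_def power_one_over field_simps)
    then have le: "0 \<le> \<delta>" "\<delta> \<le> 2 * \<rho> y" "\<rho> y + \<delta> / 2 \<le> 1 / 2" using i ry y(4) by linarith+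
    show ?thesis
      using square_zero_class_step[OF g T0 partner_idem(1,5)[OF y(1) w(1-3) y(2) w(4)] le] unfolding \<delta>_def by blast
  qed
  have "\<exists>N. square_zero_class g g' N (1 / 2 ^ 2)" using start
  proof (induction i)
    case (Suc i)
    then obtain N where N: "square_zero_class g g' N (1 / 2 ^ (Suc i + 2))" by blast
    obtain e where e: "idem e" "\<rho> e = 1 / 2 ^ (Suc i + 2)" using small_rank[OF idem_unit] rank_unit by metis
    have "(1::real) \<le> 2 ^ i" "(1::real) \<le> 2 * 2 ^ i" using one_le_power[of "2::real" i] by linarith+
    then have "(1::real) / 2 ^ (Suc i + 2) \<le> 1 / 4" by (simp add: field_simps)
    moreover have "(1::real) / 2 ^ (i + 2) = 2 * (1 / 2 ^ (Suc i + 2))" by simp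
    ultimately have "square_zero_class g g' (N + N) (1 / 2 ^ (i + 2))"
      by (intro square_zero_class_step[OF g N e]) simp_all
    then show ?case using Suc.IH by blast
  qed simp
  then obtain N where N: "square_zero_class g g' N (1 / 2 ^ 2)" by blast
  obtain e where e: "idem e" "\<rho> e = 1 / 2 ^ 2" using small_rank[OF idem_unit] rank_unit by metis
  have "conj_products g g' (N + N) (u + z)" if z: "z \<in> A" "z * z = 0" for z
  proof -
    have "square_zero_class g g' (N + N) (\<rho> z)"
      using square_zero_rank[OF z] rank_nonneg[OF z(1)] by (intro square_zero_class_step[OF g N e]) simp_all
    then show ?thesis using z unfolding square_zero_class_def by blast
  qed
  then show ?thesis by blast
qed

theorem bounded_normal_generation:
  assumes "corner_inverse u g g'" and "k \<in> A" "g * k \<noteq> k * g"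
  shows "\<exists>N. \<forall>h h' \<epsilon>. corner_inverse u h h' \<longrightarrow> \<epsilon> > 0 \<longrightarrow> (\<exists>t. conj_products g g' N t \<and> \<rho> (h - t) < \<epsilon>)"
proof -
  have g: "g \<in> A" "g' \<in> A" using assms(1) by (simp_all add: corner_inverse_def corner_unit)
  obtain N where N: "\<And>z. z \<in> A \<Longrightarrow> z * z = 0 \<Longrightarrow> conj_products g g' N (u + z)" using all_transvections[OF assms] by blast
  have "\<exists>t. conj_products g g' (45 * N) t \<and> \<rho> (h - t) < \<epsilon>" if h: "corner_inverse u h h'" "\<epsilon> > 0" for h h' \<epsilon>
  proof -
    obtain t where "tprod u 45 t" "\<rho> (h - t) < \<epsilon>" by (rule unit_approximation[OF h])
    then show ?thesis using tprod_conj_products[OF g N] by blast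
  qed
  then show ?thesis by blast
qed

end

section \<open>Quotients of topological groups\<close>

text \<open>A closed normal subgroup with a nontrivial element contains all products of conjugates
  of it and of its inverse, and with them the closure.\<close>

lemma topologically_simple_if_bounded_normal_generation:
  assumes "top_bounded_normal_generation G T"
  shows "topologically_simple G T"
proof -
  have tg: "topological_group G T"
    and gen: "\<And>g. g \<in> carrier G \<Longrightarrow> g \<noteq> \<one>\<^bsub>G\<^esub> \<Longrightarrow> \<exists>n. carrier G = T closure_of set_power G (conj_class G g \<union> conj_class G (inv\<^bsub>G\<^esub> g)) n"
    using assms by (auto simp: top_bounded_normal_generation_def)
  interpret group G using tg by (simp add: topological_group_def)
  have "N = carrier G" if N: "N \<lhd> G" "closedin T N" "N \<noteq> {\<one>\<^bsub>G\<^esub>}" for N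
  proof -
    interpret N: normal N G by (rule N(1))
    obtain g where g: "g \<in> N" "g \<noteq> \<one>\<^bsub>G\<^esub>" using N(3) N.one_closed by blast
    have gG: "g \<in> carrier G" using g N.subset by blast
    obtain n where n: "carrier G = T closure_of set_power G (conj_class G g \<union> conj_class G (inv\<^bsub>G\<^esub> g)) n"
      using gen[OF gG g(2)] by blast
    have conj: "conj_class G h \<subseteq> N" if "h \<in> N" for h
      using that N.inv_op_closed2 by (auto simp: conj_class_def)
    have "set_power G (conj_class G g \<union> conj_class G (inv\<^bsub>G\<^esub> g)) n \<subseteq> N"
    proof (induction n)
      case (Suc n)
      then show ?case using conj[OF g(1)] conj[OF N.m_inv_closed[OF g(1)]] N.m_closed
        by (auto simp: set_mult_def)
    qed simp
    then have "T closure_of set_power G (conj_class G g \<union> conj_class G (inv\<^bsub>G\<^esub> g)) n \<subseteq> N"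
      using N(2) closure_of_minimal by blast
    then show ?thesis using n N.subset by blast
  qed
  then show ?thesis using tg by (auto simp: topologically_simple_def)
qed

text \<open>Translations do not increase \<open>d\<close>, which makes the group operations
  continuous and the quotient map open. By openness the square of the quotient map is again a
  quotient map, and multiplication descends along it.\<close>

lemma quotient_topological_group:
  fixes G (structure)
  assumes G: "group G" and N: "N \<lhd> G" and top: "topspace T = carrier G"
    and op: "\<And>U. openin T U \<longleftrightarrow> U \<subseteq> carrier G \<and> (\<forall>x\<in>U. \<exists>\<epsilon>>0. \<forall>y\<in>carrier G. d x y < \<epsilon> \<longrightarrow> y \<in> U)"
    and zero: "\<And>x. x \<in> carrier G \<Longrightarrow> d x x = (0::real)"
    and sym: "\<And>x y. x \<in> carrier G \<Longrightarrow> y \<in> carrier G \<Longrightarrow> d x y = d y x"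
    and tri: "\<And>x y z. x \<in> carrier G \<Longrightarrow> y \<in> carrier G \<Longrightarrow> z \<in> carrier G \<Longrightarrow> d x z \<le> d x y + d y z"
    and left: "\<And>x y z. x \<in> carrier G \<Longrightarrow> y \<in> carrier G \<Longrightarrow> z \<in> carrier G \<Longrightarrow> d (z \<otimes> x) (z \<otimes> y) \<le> d x y"
    and right: "\<And>x y z. x \<in> carrier G \<Longrightarrow> y \<in> carrier G \<Longrightarrow> z \<in> carrier G \<Longrightarrow> d (x \<otimes> z) (y \<otimes> z) \<le> d x y"
  shows "topological_group (G Mod N) (quotient_topology T (\<lambda>g. N #> g))"
proof -
  interpret group G by (rule G)
  interpret N: normal N G by (rule N)
  define \<pi> where "\<pi> = (\<lambda>g. N #> g)"
  define Q where "Q = quotient_topology T \<pi>"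
  have quot: "quotient_map T Q \<pi>" unfolding Q_def by (rule quotient_map_quotient_topology)
  have topQ: "topspace Q = carrier (G Mod N)" by (simp add: Q_def top carrier_FactGroup \<pi>_def)
  have ball: "openin T {y \<in> carrier G. d x y < \<epsilon>}" if x: "x \<in> carrier G" for x \<epsilon>
    unfolding op
  proof (intro conjI ballI)
    fix y assume "y \<in> {y \<in> carrier G. d x y < \<epsilon>}"
    then have y: "y \<in> carrier G" "d x y < \<epsilon>" by auto
    show "\<exists>\<delta>>0. \<forall>z\<in>carrier G. d y z < \<delta> \<longrightarrow> z \<in> {y \<in> carrier G. d x y < \<epsilon>}"
    proof (intro exI[of _ "\<epsilon> - d x y"] conjI ballI impI)
      fix z assume "z \<in> carrier G" "d y z < \<epsilon> - d x y"
      then show "z \<in> {y \<in> carrier G. d x y < \<epsilon>}" using tri[OF x y(1), of z] by simp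
    qed (use y in simp)
  qed auto
  have pi_mult: "\<pi> (x \<otimes> y) = \<pi> x <#> \<pi> y" if "x \<in> carrier G" "y \<in> carrier G" for x y
    using N.rcos_sum[OF that] by (simp add: \<pi>_def)
  have pi_N: "\<pi> (n \<otimes> y) = \<pi> y" if "n \<in> N" "y \<in> carrier G" for n y
  proof -
    have n: "n \<in> carrier G" using that N.subset by blast
    have "\<pi> (n \<otimes> y) = (N #> n) #> y" unfolding \<pi>_def using coset_mult_assoc[OF N.subset n that(2)] by simp
    also have "N #> n = N" using coset_join2[OF n N.is_subgroup that(1)] .
    finally show ?thesis by (simp add: \<pi>_def)
  qed
  \<comment> \<open>A ball around \<open>y\<close> in \<open>U\<close> is carried to
    \<open>x = n \<otimes> y\<close> by translation, which changes neither distances nor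
    cosets.\<close>
  have open_pi: "openin Q (\<pi> ` U)" if U: "openin T U" for U
  proof -
    have "openin T {x \<in> carrier G. \<pi> x \<in> \<pi> ` U}" unfolding op
    proof (intro conjI ballI)
      fix x assume "x \<in> {x \<in> carrier G. \<pi> x \<in> \<pi> ` U}"
      then obtain y where x: "x \<in> carrier G" and y: "y \<in> U" "\<pi> x = \<pi> y" by auto
      have yG: "y \<in> carrier G" using U y op by blast
      have "x \<in> \<pi> x" unfolding \<pi>_def using rcos_self[OF x N.is_subgroup] .
      then obtain n where n: "n \<in> N" "x = n \<otimes> y" unfolding y(2) by (auto simp: \<pi>_def r_coset_def)
      have nG: "n \<in> carrier G" using n N.subset by blast
      obtain \<epsilon> where \<epsilon>: "\<epsilon> > 0" "\<forall>z\<in>carrier G. d y z < \<epsilon> \<longrightarrow> z \<in> U" using U y(1) unfolding op by blast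
      show "\<exists>\<epsilon>>0. \<forall>z\<in>carrier G. d x z < \<epsilon> \<longrightarrow> z \<in> {x \<in> carrier G. \<pi> x \<in> \<pi> ` U}"
      proof (intro exI[of _ \<epsilon>] conjI ballI impI)
        fix z assume z: "z \<in> carrier G" "d x z < \<epsilon>"
        have "inv n \<otimes> x = y" using n(2) nG yG by (simp add: m_assoc[symmetric])
        then have "d y (inv n \<otimes> z) < \<epsilon>" using left[OF x z(1) inv_closed[OF nG]] z(2) by simp
        then have "inv n \<otimes> z \<in> U" using \<epsilon>(2) nG z(1) by simp
        moreover have "\<pi> (inv n \<otimes> z) = \<pi> z" using pi_N[OF N.m_inv_closed[OF n(1)] z(1)] .
        ultimately show "z \<in> {x \<in> carrier G. \<pi> x \<in> \<pi> ` U}" using z(1) by (metis (mono_tags, lifting) imageI mem_Collect_eq)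
      qed (rule \<epsilon>(1))
    qed auto
    moreover have "\<pi> ` U \<subseteq> \<pi> ` topspace T" using U openin_subset by blast
    ultimately show ?thesis unfolding Q_def openin_quotient_topology by (simp add: top)
  qed
  have cont_mult: "continuous_map (prod_topology T T) T (\<lambda>(x, y). x \<otimes> y)"
    unfolding continuous_map_def
  proof (intro conjI allI impI)
    show "(\<lambda>(x, y). x \<otimes> y) \<in> topspace (prod_topology T T) \<rightarrow> topspace T" by (auto simp: top)
    fix W assume W: "openin T W"
    show "openin (prod_topology T T) {p \<in> topspace (prod_topology T T). (case p of (x, y) \<Rightarrow> x \<otimes> y) \<in> W}"
      unfolding openin_prod_topology_alt
    proof (intro allI impI)
      fix x y assume "(x, y) \<in> {p \<in> topspace (prod_topology T T). (case p of (x, y) \<Rightarrow> x \<otimes> y) \<in> W}"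
      then have xy: "x \<in> carrier G" "y \<in> carrier G" "x \<otimes> y \<in> W" by (auto simp: top)
      obtain \<epsilon> where \<epsilon>: "\<epsilon> > 0" "\<And>z. z \<in> carrier G \<Longrightarrow> d (x \<otimes> y) z < \<epsilon> \<Longrightarrow> z \<in> W" using W xy(3) unfolding op by blast
      let ?U = "\<lambda>x. {z \<in> carrier G. d x z < \<epsilon> / 2}"
      have "a \<otimes> b \<in> W" if "a \<in> ?U x" "b \<in> ?U y" for a b
      proof (rule \<epsilon>(2))
        have ab: "a \<in> carrier G" "b \<in> carrier G" "d x a < \<epsilon> / 2" "d y b < \<epsilon> / 2" using that by auto
        have "d (x \<otimes> y) (a \<otimes> b) \<le> d (x \<otimes> y) (a \<otimes> y) + d (a \<otimes> y) (a \<otimes> b)" using tri ab xy by simp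
        also have "\<dots> \<le> d x a + d y b" using left[OF xy(2) ab(2,1)] right[OF xy(1) ab(1) xy(2)] by simp
        finally show "d (x \<otimes> y) (a \<otimes> b) < \<epsilon>" using ab by simp
        show "a \<otimes> b \<in> carrier G" using ab by simp
      qed
      then have "?U x \<times> ?U y \<subseteq> {p \<in> topspace (prod_topology T T). (case p of (x, y) \<Rightarrow> x \<otimes> y) \<in> W}"
        by (auto simp: top)
      moreover have "x \<in> ?U x" "y \<in> ?U y" using xy zero \<epsilon>(1) by simp_all
      ultimately show "\<exists>U V. openin T U \<and> openin T V \<and> x \<in> U \<and> y \<in> V \<and> U \<times> V \<subseteq> {p \<in> topspace (prod_topology T T). (case p of (x, y) \<Rightarrow> x \<otimes> y) \<in> W}"
        using ball[OF xy(1)] ball[OF xy(2)] by (intro exI[of _ "?U x"] exI[of _ "?U y"] conjI)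
    qed
  qed
  have cont_inv: "continuous_map T T (\<lambda>x. inv x)"
    unfolding continuous_map_def
  proof (intro conjI allI impI)
    show "(\<lambda>x. inv x) \<in> topspace T \<rightarrow> topspace T" by (auto simp: top)
    fix W assume W: "openin T W"
    show "openin T {x \<in> topspace T. inv x \<in> W}" unfolding op
    proof (intro conjI ballI)
      show "{x \<in> topspace T. inv x \<in> W} \<subseteq> carrier G" by (auto simp: top)
      fix x assume "x \<in> {x \<in> topspace T. inv x \<in> W}"
      then have x: "x \<in> carrier G" "inv x \<in> W" by (auto simp: top)
      obtain \<epsilon> where \<epsilon>: "\<epsilon> > 0" "\<And>z. z \<in> carrier G \<Longrightarrow> d (inv x) z < \<epsilon> \<Longrightarrow> z \<in> W" using W x(2) unfolding op by blast
      have "inv y \<in> W" if y: "y \<in> carrier G" "d x y < \<epsilon>" for y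
      proof (rule \<epsilon>(2))
        \<comment> \<open>Translating by \<open>inv x\<close> on the left and by
          \<open>inv y\<close> on the right turns the distance of \<open>x\<close> and
          \<open>y\<close> into that of their inverses.\<close>
        have "d (inv x \<otimes> y) (inv x \<otimes> x) \<le> d y x" using left[OF y(1) x(1), of "inv x"] x by simp
        moreover have "d (inv x \<otimes> y \<otimes> inv y) (inv x \<otimes> x \<otimes> inv y) \<le> d (inv x \<otimes> y) (inv x \<otimes> x)" using right[of "inv x \<otimes> y" "inv x \<otimes> x" "inv y"] x y by simp
        moreover have "inv x \<otimes> y \<otimes> inv y = inv x" "inv x \<otimes> x \<otimes> inv y = inv y" using x y by (simp_all add: m_assoc)
        ultimately show "d (inv x) (inv y) < \<epsilon>" using sym[OF x(1) y(1)] y(2) by simp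
        show "inv y \<in> carrier G" using y by simp
      qed
      then show "\<exists>\<epsilon>>0. \<forall>y\<in>carrier G. d x y < \<epsilon> \<longrightarrow> y \<in> {x \<in> topspace T. inv x \<in> W}" using \<epsilon>(1) by (auto simp: top)
    qed
  qed
  have quot2: "quotient_map (prod_topology T T) (prod_topology Q Q) (\<lambda>(x, y). (\<pi> x, \<pi> y))"
  proof (rule continuous_open_imp_quotient_map)
    have "continuous_map T Q \<pi>" using quot quotient_imp_continuous_map by blast
    then show "continuous_map (prod_topology T T) (prod_topology Q Q) (\<lambda>(x, y). (\<pi> x, \<pi> y))"
      by (simp add: continuous_map_prod_top)
    show "(\<lambda>(x, y). (\<pi> x, \<pi> y)) ` topspace (prod_topology T T) = topspace (prod_topology Q Q)"
      using quotient_imp_surjective_map[OF quot] by (simp add: image_paired_Times)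
    show "open_map (prod_topology T T) (prod_topology Q Q) (\<lambda>(x, y). (\<pi> x, \<pi> y))"
      unfolding open_map_def
    proof (intro allI impI)
      fix W assume W: "openin (prod_topology T T) W"
      show "openin (prod_topology Q Q) ((\<lambda>(x, y). (\<pi> x, \<pi> y)) ` W)" unfolding openin_prod_topology_alt
      proof (intro allI impI)
        fix a b assume "(a, b) \<in> (\<lambda>(x, y). (\<pi> x, \<pi> y)) ` W"
        then obtain x y where xy: "(x, y) \<in> W" "a = \<pi> x" "b = \<pi> y" by auto
        obtain U V where U: "openin T U" "openin T V" "x \<in> U" "y \<in> V" "U \<times> V \<subseteq> W"
          using W xy(1) unfolding openin_prod_topology_alt by metis
        have "\<pi> ` U \<times> \<pi> ` V \<subseteq> (\<lambda>(x, y). (\<pi> x, \<pi> y)) ` W" using U(5) by force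
        then show "\<exists>U V. openin Q U \<and> openin Q V \<and> a \<in> U \<and> b \<in> V \<and> U \<times> V \<subseteq> (\<lambda>(x, y). (\<pi> x, \<pi> y)) ` W"
          using open_pi[OF U(1)] open_pi[OF U(2)] U(3,4) xy by (intro exI[of _ "\<pi> ` U"] exI[of _ "\<pi> ` V"] conjI) auto
      qed
    qed
  qed
  have pi_cont: "continuous_map T Q \<pi>" using quot quotient_imp_continuous_map by blast
  have "continuous_map (prod_topology T T) Q ((\<lambda>(a, b). a <#> b) \<circ> (\<lambda>(x, y). (\<pi> x, \<pi> y)))"
    by (rule continuous_map_eq[OF continuous_map_compose[OF cont_mult pi_cont]]) (auto simp: top pi_mult)
  then have 1: "continuous_map (prod_topology Q Q) Q (\<lambda>(a, b). a <#> b)" by (rule continuous_compose_quotient_map[OF quot2])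
  have "inv\<^bsub>G Mod N\<^esub> (\<pi> x) = \<pi> (inv x)" if x: "x \<in> carrier G" for x
  proof (rule group.inv_equality[OF N.factorgroup_is_group])
    have "\<pi> (inv x) <#> \<pi> x = \<pi> \<one>" using pi_mult[of "inv x" x] x by simp
    then show "\<pi> (inv x) \<otimes>\<^bsub>G Mod N\<^esub> \<pi> x = \<one>\<^bsub>G Mod N\<^esub>" using coset_join2[OF one_closed N.is_subgroup N.one_closed] by (simp add: \<pi>_def)
  qed (use x in \<open>auto simp: carrier_FactGroup \<pi>_def\<close>)
  then have "continuous_map T Q ((\<lambda>a. inv\<^bsub>G Mod N\<^esub> a) \<circ> \<pi>)"
    by (intro continuous_map_eq[OF continuous_map_compose[OF cont_inv pi_cont]]) (auto simp: top)
  then have 2: "continuous_map Q Q (\<lambda>a. inv\<^bsub>G Mod N\<^esub> a)" by (rule continuous_compose_quotient_map[OF quot])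
  have "topological_group (G Mod N) Q"
    unfolding topological_group_def using N.factorgroup_is_group topQ 1 2 by simp
  then show ?thesis by (simp add: Q_def \<pi>_def)
qed

section \<open>Realisation inside a ring type\<close>

text \<open>
  The direct product of all rings with elements in \<open>'a\<close>. Every such ring is a direct factor
  of it, which gives access to the type class \<open>ring\<close>.
\<close>

typedef ('a, 'm) ring_family =
  "{f :: ('a, 'm) ring_scheme \<Rightarrow> 'a. \<forall>S. if ring S then f S \<in> carrier S else f S = undefined}"
  by (rule exI[of _ "\<lambda>S. if ring S then \<zero>\<^bsub>S\<^esub> else undefined"]) (simp add: ring.ring_simprules(2))

setup_lifting type_definition_ring_family

lift_definition component :: "('a, 'm) ring_family \<Rightarrow> ('a, 'm) ring_scheme \<Rightarrow> 'a" is "\<lambda>f. f" .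

lemma ring_family_eqI:
  assumes "\<And>S. ring S \<Longrightarrow> component f S = component g S"
  shows "f = g"
  using assms by transfer (metis ext)

lemma component_in: "ring S \<Longrightarrow> component f S \<in> carrier S"
  by transfer metis

instantiation ring_family :: (type, type) ring
begin

lift_definition zero_ring_family :: "('a, 'b) ring_family"
  is "\<lambda>S. if ring S then \<zero>\<^bsub>S\<^esub> else undefined"
  by (simp add: ring.ring_simprules(2))

lift_definition plus_ring_family :: "('a, 'b) ring_family \<Rightarrow> ('a, 'b) ring_family \<Rightarrow> ('a, 'b) ring_family"
  is "\<lambda>f g S. if ring S then f S \<oplus>\<^bsub>S\<^esub> g S else undefined"
  by (simp add: ring.ring_simprules(1))

lift_definition uminus_ring_family :: "('a, 'b) ring_family \<Rightarrow> ('a, 'b) ring_family"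
  is "\<lambda>f S. if ring S then \<ominus>\<^bsub>S\<^esub> f S else undefined"
  by (simp add: ring.ring_simprules(3))

lift_definition minus_ring_family :: "('a, 'b) ring_family \<Rightarrow> ('a, 'b) ring_family \<Rightarrow> ('a, 'b) ring_family"
  is "\<lambda>f g S. if ring S then f S \<ominus>\<^bsub>S\<^esub> g S else undefined"
  by (simp add: ring.ring_simprules(4))

lift_definition times_ring_family :: "('a, 'b) ring_family \<Rightarrow> ('a, 'b) ring_family \<Rightarrow> ('a, 'b) ring_family"
  is "\<lambda>f g S. if ring S then f S \<otimes>\<^bsub>S\<^esub> g S else undefined"
  by (simp add: ring.ring_simprules(5))

lemma component_simps:
  assumes "ring S"
  shows "component 0 S = \<zero>\<^bsub>S\<^esub>" "component (f + g) S = component f S \<oplus>\<^bsub>S\<^esub> component g S"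
    "component (- f) S = \<ominus>\<^bsub>S\<^esub> component f S" "component (f - g) S = component f S \<ominus>\<^bsub>S\<^esub> component g S"
    "component (f * g) S = component f S \<otimes>\<^bsub>S\<^esub> component g S"
  using assms by (transfer, simp)+

instance
proof
  fix a b c :: "('a, 'b) ring_family"
  show "a + b + c = a + (b + c)"
    by (rule ring_family_eqI) (simp add: component_simps component_in ring.ring_simprules(7))
  show "a + b = b + a"
    by (rule ring_family_eqI) (simp add: component_simps component_in ring.ring_simprules(10))
  show "0 + a = a"
    by (rule ring_family_eqI) (simp add: component_simps component_in ring.ring_simprules(8))
  show "- a + a = 0"
    by (rule ring_family_eqI) (simp add: component_simps component_in ring.ring_simprules(9))
  show "a - b = a + - b"
    by (rule ring_family_eqI) (simp add: component_simps component_in a_minus_def)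
  show "a * b * c = a * (b * c)"
    by (rule ring_family_eqI) (simp add: component_simps component_in ring.ring_simprules(11))
  show "(a + b) * c = a * c + b * c"
    by (rule ring_family_eqI) (simp add: component_simps component_in ring.ring_simprules(13))
  show "a * (b + c) = a * b + a * c"
    by (rule ring_family_eqI) (simp add: component_simps component_in ring.ring_simprules(23))
qed

end

text \<open>The inclusion of one factor of the direct product: it preserves all operations except
  the unit, whose image is only an idempotent.\<close>

definition embed :: "('a, 'm) ring_scheme \<Rightarrow> 'a \<Rightarrow> ('a, 'm) ring_family" where
  "embed R x = Abs_ring_family (\<lambda>S. if ring S then (if S = R then x else \<zero>\<^bsub>S\<^esub>) else undefined)"

context ring
begin

lemma component_embed:
  assumes "x \<in> carrier R" "ring S"
  shows "component (embed R x) S = (if S = R then x else \<zero>\<^bsub>S\<^esub>)"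
proof -
  have "(\<lambda>S. if ring S then (if S = R then x else \<zero>\<^bsub>S\<^esub>) else undefined) \<in>
      {f. \<forall>S. if ring S then f S \<in> carrier S else f S = undefined}"
    using assms(1) by (auto simp: ring.ring_simprules(2))
  then show ?thesis using assms(2) by (simp add: embed_def component.rep_eq Abs_ring_family_inverse)
qed

lemma embed_zero: "embed R \<zero> = 0"
  by (rule ring_family_eqI) (simp add: component_simps component_embed)

lemma embed_add: "x \<in> carrier R \<Longrightarrow> y \<in> carrier R \<Longrightarrow> embed R x + embed R y = embed R (x \<oplus> y)"
  by (rule ring_family_eqI) (simp add: component_simps component_embed ring.ring_simprules(2,8))

lemma embed_mult: "x \<in> carrier R \<Longrightarrow> y \<in> carrier R \<Longrightarrow> embed R x * embed R y = embed R (x \<otimes> y)"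
  by (rule ring_family_eqI) (simp add: component_simps component_embed ring.ring_simprules(2) ring.ring_simprules(24))

lemma embed_uminus:
  assumes "x \<in> carrier R"
  shows "- embed R x = embed R (\<ominus> x)"
proof (rule group_add_class.minus_unique)
  show "embed R x + embed R (\<ominus> x) = 0" using assms by (simp add: embed_add r_neg embed_zero)
qed

lemma embed_diff: "x \<in> carrier R \<Longrightarrow> y \<in> carrier R \<Longrightarrow> embed R x - embed R y = embed R (x \<ominus> y)"
  by (simp only: diff_conv_add_uminus embed_uminus embed_add a_inv_closed a_minus_def)

lemmas embed_hom = embed_add embed_mult embed_uminus embed_diff

lemma embed_eq_iff: "x \<in> carrier R \<Longrightarrow> y \<in> carrier R \<Longrightarrow> embed R x = embed R y \<longleftrightarrow> x = y"
  using component_embed[OF _ ring_axioms] by metis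

lemma unital_subring_embed: "unital_subring (embed R ` carrier R) (embed R \<one>)"
  by unfold_locales (auto simp: embed_hom)

end

section \<open>Irreducibility and central idempotents\<close>

lemma (in ring) ring_central_corner:
  assumes c: "c \<in> carrier R" "c \<otimes> c = c" and central: "\<And>x. x \<in> carrier R \<Longrightarrow> c \<otimes> x = x \<otimes> c"
  shows "ring (\<lparr>carrier = {x \<in> carrier R. c \<otimes> x = x}, monoid.mult = (\<otimes>), monoid.one = c, ring.zero = \<zero>, ring.add = (\<oplus>)\<rparr> :: 'a ring)"
proof (rule ringI)
  let ?S = "\<lparr>carrier = {x \<in> carrier R. c \<otimes> x = x}, monoid.mult = (\<otimes>), monoid.one = c, ring.zero = \<zero>, ring.add = (\<oplus>)\<rparr> :: 'a ring"
  show "abelian_group ?S"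
  proof (rule abelian_groupI)
    fix x assume "x \<in> carrier ?S"
    then have "\<ominus> x \<in> carrier ?S" "\<ominus> x \<oplus> x = \<zero>" using c by (auto simp: r_minus l_neg)
    then show "\<exists>y\<in>carrier ?S. y \<oplus>\<^bsub>?S\<^esub> x = \<zero>\<^bsub>?S\<^esub>" by auto
  qed (use c in \<open>auto simp: r_distr a_ac\<close>)
  show "monoid ?S"
  proof (rule monoidI)
    show "x \<otimes>\<^bsub>?S\<^esub> \<one>\<^bsub>?S\<^esub> = x" if "x \<in> carrier ?S" for x
      using that central[of x] by simp
    show "x \<otimes>\<^bsub>?S\<^esub> y \<in> carrier ?S" if "x \<in> carrier ?S" "y \<in> carrier ?S" for x y
      using that c m_assoc[of c x y] by simp
  qed (use c in \<open>auto simp: m_assoc\<close>)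
qed (use c in \<open>auto simp: l_distr r_distr\<close>)

text \<open>A nontrivial central idempotent splits the ring into the two corners of \<open>c\<close>
  and \<open>\<one> \<ominus> c\<close>. Their carriers are subsets of that of \<open>R\<close>, so
  they have the type that \<open>irreducible_ring\<close> quantifies over.\<close>

lemma (in ring) no_central_idempotent:
  assumes "irreducible_ring R" and c: "c \<in> carrier R" "c \<otimes> c = c" and central: "\<And>x. x \<in> carrier R \<Longrightarrow> c \<otimes> x = x \<otimes> c"
  shows "c = \<zero> \<or> c = \<one>"
proof (rule ccontr)
  assume ne: "\<not> (c = \<zero> \<or> c = \<one>)"
  define f where "f = \<one> \<ominus> c"
  have f: "f \<in> carrier R" "f \<otimes> f = f" and cf: "c \<oplus> f = \<one>" and o: "c \<otimes> f = \<zero>" "f \<otimes> c = \<zero>"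
    and fcentral: "\<And>x. x \<in> carrier R \<Longrightarrow> f \<otimes> x = x \<otimes> f"
  proof -
    show f: "f \<in> carrier R" using c by (simp add: f_def)
    show "c \<oplus> f = \<one>" using c by (simp add: f_def a_minus_def a_lcomm[of c] r_neg)
    show 1: "c \<otimes> f = \<zero>" "f \<otimes> c = \<zero>" using c by (simp_all add: f_def a_minus_def r_distr l_distr r_minus l_minus r_neg)
    show "f \<otimes> x = x \<otimes> f" if "x \<in> carrier R" for x
      using that c(1) central[OF that] by (simp add: f_def a_minus_def r_distr l_distr r_minus l_minus)
    have "f \<otimes> f = f \<otimes> \<one> \<ominus> f \<otimes> c" using c f by (simp add: f_def a_minus_def r_distr r_minus)
    then show "f \<otimes> f = f" using 1 f by (simp add: a_minus_def)
  qed
  define S where "S = (\<lparr>carrier = {x \<in> carrier R. c \<otimes> x = x}, monoid.mult = (\<otimes>), monoid.one = c, ring.zero = \<zero>, ring.add = (\<oplus>)\<rparr> :: 'a ring)"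
  define T where "T = (\<lparr>carrier = {x \<in> carrier R. f \<otimes> x = x}, monoid.mult = (\<otimes>), monoid.one = f, ring.zero = \<zero>, ring.add = (\<oplus>)\<rparr> :: 'a ring)"
  have ST: "ring S" "ring T" unfolding S_def T_def using ring_central_corner c f central fcentral by blast+
  have "f \<noteq> \<zero>" using cf c ne by auto
  then have nz: "carrier S \<noteq> {\<zero>\<^bsub>S\<^esub>}" "carrier T \<noteq> {\<zero>\<^bsub>T\<^esub>}" using c f ne by (auto simp: S_def T_def)
  have cc: "c \<otimes> (c \<otimes> x) = c \<otimes> x" "f \<otimes> (f \<otimes> x) = f \<otimes> x" "c \<otimes> (f \<otimes> x) = \<zero>" "f \<otimes> (c \<otimes> x) = \<zero>" if "x \<in> carrier R" for x
    using that c f o by (simp_all add: m_assoc[symmetric])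
  have split: "c \<otimes> x \<oplus> f \<otimes> x = x" if "x \<in> carrier R" for x
    using that c f cf by (simp add: l_distr[symmetric])
  have mult: "d \<otimes> (x \<otimes> y) = (d \<otimes> x) \<otimes> (d \<otimes> y)" if "x \<in> carrier R" "y \<in> carrier R" "d \<in> carrier R" "d \<otimes> d = d" "\<And>x. x \<in> carrier R \<Longrightarrow> d \<otimes> x = x \<otimes> d" for d x y
  proof -
    have "(d \<otimes> x) \<otimes> (d \<otimes> y) = d \<otimes> (x \<otimes> d) \<otimes> y" using that(1-3) by (simp add: m_assoc)
    also have "x \<otimes> d = d \<otimes> x" using that(5)[OF that(1)] by simp
    also have "d \<otimes> (d \<otimes> x) \<otimes> y = d \<otimes> d \<otimes> (x \<otimes> y)" using that(1-3) by (simp add: m_assoc)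
    finally show ?thesis using that(4) by simp
  qed
  have "(\<lambda>x. (c \<otimes> x, f \<otimes> x)) \<in> ring_iso R (RDirProd S T)"
  proof (rule ring_iso_memI)
    show "bij_betw (\<lambda>x. (c \<otimes> x, f \<otimes> x)) (carrier R) (carrier (RDirProd S T))"
    proof (rule bij_betw_byWitness[where f' = "\<lambda>(x, y). x \<oplus> y"])
      show "\<forall>p\<in>carrier (RDirProd S T). (\<lambda>x. (c \<otimes> x, f \<otimes> x)) (case p of (x, y) \<Rightarrow> x \<oplus> y) = p"
      proof (clarsimp simp: RDirProd_carrier S_def T_def, intro conjI)
        fix x y assume xy: "x \<in> carrier R" "c \<otimes> x = x" "y \<in> carrier R" "f \<otimes> y = y"
        then have "c \<otimes> y = \<zero>" "f \<otimes> x = \<zero>" using cc(3)[OF xy(3)] cc(4)[OF xy(1)] by simp_all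
        then show "c \<otimes> (x \<oplus> y) = x" "f \<otimes> (x \<oplus> y) = y" using xy c f by (simp_all add: r_distr)
      qed
    qed (use c f cc split in \<open>auto simp: RDirProd_carrier S_def T_def\<close>)
    fix x y assume xy: "x \<in> carrier R" "y \<in> carrier R"
    show "(c \<otimes> (x \<otimes> y), f \<otimes> (x \<otimes> y)) = (c \<otimes> x, f \<otimes> x) \<otimes>\<^bsub>RDirProd S T\<^esub> (c \<otimes> y, f \<otimes> y)"
      by (simp add: RDirProd_def DirProd_def monoid.defs S_def T_def mult[OF xy c central] mult[OF xy f fcentral])
    show "(c \<otimes> (x \<oplus> y), f \<otimes> (x \<oplus> y)) = (c \<otimes> x, f \<otimes> x) \<oplus>\<^bsub>RDirProd S T\<^esub> (c \<otimes> y, f \<otimes> y)"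
      using xy c f by (simp add: RDirProd_def DirProd_def monoid.defs S_def T_def r_distr)
  next
    fix x assume "x \<in> carrier R"
    then show "(c \<otimes> x, f \<otimes> x) \<in> carrier (RDirProd S T)"
      using c f cc[of x] by (simp add: RDirProd_carrier S_def T_def)
  next
    show "(c \<otimes> \<one>, f \<otimes> \<one>) = \<one>\<^bsub>RDirProd S T\<^esub>"
      using c f by (simp add: RDirProd_def DirProd_def monoid.defs S_def T_def)
  qed
  then have "R \<simeq> RDirProd S T" by (auto simp: is_ring_iso_def)
  then show False using assms(1) ST nz unfolding irreducible_ring_def by blast
qed

section \<open>Transport of continuity to the ring type\<close>

context
  fixes R :: "('a, 'm) ring_scheme" and P
  assumes cont: "continuous_ring R"
  defines "P \<equiv> principal_right_ideals R"
begin

lemma complete_right_ideal_lattice: "complete_lattice (right_ideal_lattice R)"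
  using cont by (simp add: continuous_ring_def Let_def)

interpretation CL: complete_lattice "right_ideal_lattice R"
  rewrites "carrier (right_ideal_lattice R) = P" and "le (right_ideal_lattice R) = (\<subseteq>)" and "eq (right_ideal_lattice R) = (=)"
  using complete_right_ideal_lattice by (simp_all add: right_ideal_lattice_def P_def)

lemma principal_sup:
  assumes "C \<subseteq> P" shows "\<exists>s\<in>P. (\<forall>I\<in>C. I \<subseteq> s) \<and> (\<forall>t\<in>P. (\<forall>I\<in>C. I \<subseteq> t) \<longrightarrow> s \<subseteq> t)"
proof (intro bexI[of _ "\<Squnion>\<^bsub>right_ideal_lattice R\<^esub> C"] conjI ballI impI)
  show "I \<subseteq> \<Squnion>\<^bsub>right_ideal_lattice R\<^esub> C" if "I \<in> C" for I using CL.sup_upper[OF assms that] .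
  show "\<Squnion>\<^bsub>right_ideal_lattice R\<^esub> C \<subseteq> t" if "t \<in> P" "\<forall>I\<in>C. I \<subseteq> t" for t
    using that by (intro CL.sup_least[OF assms]) auto
qed (rule CL.sup_closed[OF assms])

lemma principal_inf:
  assumes "C \<subseteq> P" shows "\<exists>s\<in>P. (\<forall>I\<in>C. s \<subseteq> I) \<and> (\<forall>t\<in>P. (\<forall>I\<in>C. t \<subseteq> I) \<longrightarrow> t \<subseteq> s)"
proof (intro bexI[of _ "\<Sqinter>\<^bsub>right_ideal_lattice R\<^esub> C"] conjI ballI impI)
  show "\<Sqinter>\<^bsub>right_ideal_lattice R\<^esub> C \<subseteq> I" if "I \<in> C" for I using CL.inf_lower[OF assms that] .
  show "t \<subseteq> \<Sqinter>\<^bsub>right_ideal_lattice R\<^esub> C" if "t \<in> P" "\<forall>I\<in>C. t \<subseteq> I" for t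
    using that by (intro CL.inf_greatest[OF assms]) auto
qed (rule CL.inf_closed[OF assms])

text \<open>\<open>s\<close> is only assumed to lie below all upper bounds in the lattice; this
  already compares it with the supremum operation, without identifying the two.\<close>

lemma principal_meet_sup:
  assumes C: "C \<subseteq> P" "chain\<^sub>\<subseteq> C" and s: "\<And>t. t \<in> P \<Longrightarrow> (\<And>I. I \<in> C \<Longrightarrow> I \<subseteq> t) \<Longrightarrow> s \<subseteq> t"
    and I: "I \<in> P" "t \<in> P" and below: "\<And>J K. J \<in> C \<Longrightarrow> K \<in> P \<Longrightarrow> K \<subseteq> I \<Longrightarrow> K \<subseteq> J \<Longrightarrow> K \<subseteq> t"
    and K: "K \<in> P" "K \<subseteq> I" "K \<subseteq> s"
  shows "K \<subseteq> t"
proof -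
  let ?L = "right_ideal_lattice R"
  have eq: "I \<sqinter>\<^bsub>?L\<^esub> \<Squnion>\<^bsub>?L\<^esub> C = \<Squnion>\<^bsub>?L\<^esub> {I \<sqinter>\<^bsub>?L\<^esub> J | J. J \<in> C}"
    using cont C I(1) by (simp add: continuous_ring_def Let_def P_def right_ideal_lattice_def)
  have "s \<subseteq> \<Squnion>\<^bsub>?L\<^esub> C" using CL.sup_closed[OF C(1)] CL.sup_upper[OF C(1)] by (intro s) auto
  then have le: "K \<subseteq> I \<sqinter>\<^bsub>?L\<^esub> \<Squnion>\<^bsub>?L\<^esub> C" using K I CL.sup_closed[OF C(1)] by (intro CL.meet_le) auto
  have "I \<sqinter>\<^bsub>?L\<^esub> \<Squnion>\<^bsub>?L\<^esub> C \<subseteq> t" unfolding eq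
  proof (rule CL.sup_least)
    show "{I \<sqinter>\<^bsub>?L\<^esub> J | J. J \<in> C} \<subseteq> P" using I(1) C(1) CL.meet_closed by blast
    fix M assume "M \<in> {I \<sqinter>\<^bsub>?L\<^esub> J | J. J \<in> C}"
    then obtain J where J: "J \<in> C" "M = I \<sqinter>\<^bsub>?L\<^esub> J" by blast
    then have JP: "J \<in> P" using C(1) by blast
    show "M \<subseteq> t" unfolding J(2)
      using below[OF J(1) CL.meet_closed[OF I(1) JP] CL.meet_left[OF I(1) JP] CL.meet_right[OF I(1) JP]] .
  qed (rule I(2))
  with le show ?thesis by (rule subset_trans)
qed

lemma principal_join_inf:
  assumes C: "C \<subseteq> P" "chain\<^sub>\<subseteq> C" and s: "\<And>t. t \<in> P \<Longrightarrow> (\<And>I. I \<in> C \<Longrightarrow> t \<subseteq> I) \<Longrightarrow> t \<subseteq> s"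
    and I: "I \<in> P" "t \<in> P" and above: "\<And>J K. J \<in> C \<Longrightarrow> K \<in> P \<Longrightarrow> I \<subseteq> K \<Longrightarrow> J \<subseteq> K \<Longrightarrow> t \<subseteq> K"
    and K: "K \<in> P" "I \<subseteq> K" "s \<subseteq> K"
  shows "t \<subseteq> K"
proof -
  let ?L = "right_ideal_lattice R"
  have eq: "I \<squnion>\<^bsub>?L\<^esub> \<Sqinter>\<^bsub>?L\<^esub> C = \<Sqinter>\<^bsub>?L\<^esub> {I \<squnion>\<^bsub>?L\<^esub> J | J. J \<in> C}"
    using cont C I(1) by (simp add: continuous_ring_def Let_def P_def right_ideal_lattice_def)
  have "\<Sqinter>\<^bsub>?L\<^esub> C \<subseteq> s" using CL.inf_closed[OF C(1)] CL.inf_lower[OF C(1)] by (intro s) auto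
  then have le: "I \<squnion>\<^bsub>?L\<^esub> \<Sqinter>\<^bsub>?L\<^esub> C \<subseteq> K" using K I CL.inf_closed[OF C(1)] by (intro CL.join_le) auto
  have "t \<subseteq> I \<squnion>\<^bsub>?L\<^esub> \<Sqinter>\<^bsub>?L\<^esub> C" unfolding eq
  proof (rule CL.inf_greatest)
    show "{I \<squnion>\<^bsub>?L\<^esub> J | J. J \<in> C} \<subseteq> P" using I(1) C(1) CL.join_closed by blast
    fix M assume "M \<in> {I \<squnion>\<^bsub>?L\<^esub> J | J. J \<in> C}"
    then obtain J where J: "J \<in> C" "M = I \<squnion>\<^bsub>?L\<^esub> J" by blast
    then have JP: "J \<in> P" using C(1) by blast
    show "t \<subseteq> M" unfolding J(2)
      using above[OF J(1) CL.join_closed[OF I(1) JP] CL.join_left[OF I(1) JP] CL.join_right[OF I(1) JP]] .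
  qed (rule I(2))
  then show ?thesis using le by (rule subset_trans)
qed

end

text \<open>Taking images under \<open>embed\<close> is an order isomorphism between the principal
  right ideals of \<open>R\<close> and those of the embedded copy, with inverse \<psi>; bounds and
  continuity are carried along it.\<close>

lemma continuous_subring_embed:
  fixes R :: "('a, 'm) ring_scheme"
  assumes cont: "continuous_ring R"
  shows "continuous_subring (embed R ` carrier R) (embed R \<one>\<^bsub>R\<^esub>)"
proof -
  have reg: "ring R" "\<And>a. a \<in> carrier R \<Longrightarrow> \<exists>b\<in>carrier R. a \<otimes>\<^bsub>R\<^esub> b \<otimes>\<^bsub>R\<^esub> a = a"
    using cont by (auto simp: continuous_ring_def regular_ring_def)
  interpret ring R by (rule reg(1))
  let ?E = "embed R"
  interpret U: regular_subring "?E ` carrier R" "?E \<one>\<^bsub>R\<^esub>"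
  proof (rule regular_subring.intro[OF unital_subring_embed], unfold_locales)
    fix a assume "a \<in> ?E ` carrier R"
    then obtain x where x: "x \<in> carrier R" "a = ?E x" by blast
    obtain b where b: "b \<in> carrier R" "x \<otimes>\<^bsub>R\<^esub> b \<otimes>\<^bsub>R\<^esub> x = x" using reg(2)[OF x(1)] by blast
    then show "\<exists>b\<in>?E ` carrier R. a * b * a = a" using x by (intro bexI[of _ "?E b"]) (auto simp: embed_mult)
  qed
  define P where "P = principal_right_ideals R"
  have right_ideal: "U.right_ideal (?E a) = ?E ` (a <#\<^bsub>R\<^esub> carrier R)" if "a \<in> carrier R" for a
  proof -
    have "U.right_ideal (?E a) = (\<lambda>y. ?E a * y) ` (?E ` carrier R)" by (auto simp: U.right_ideal_def)
    also have "\<dots> = (\<lambda>x. ?E (a \<otimes>\<^bsub>R\<^esub> x)) ` carrier R"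
      unfolding image_image using that by (intro image_cong) (simp_all add: embed_mult)
    also have "\<dots> = ?E ` (a <#\<^bsub>R\<^esub> carrier R)" by (auto simp: l_coset_def)
    finally show ?thesis .
  qed
  have L: "U.L = (`) ?E ` P"
    unfolding U.L_def P_def principal_right_ideals_def using right_ideal by (auto simp: image_iff)
  have Psub: "I \<subseteq> carrier R" if "I \<in> P" for I
    using that by (auto simp: P_def principal_right_ideals_def l_coset_def)
  define \<psi> where "\<psi> V = {x \<in> carrier R. ?E x \<in> V}" for V
  have \<psi>E: "\<psi> (?E ` I) = I" if "I \<in> P" for I
    using Psub[OF that] embed_eq_iff unfolding \<psi>_def by (auto simp: image_iff)
  have EL: "?E ` I \<in> U.L" if "I \<in> P" for I unfolding L using that by (rule imageI)
  have \<psi>P: "\<psi> V \<in> P" and E\<psi>: "?E ` \<psi> V = V" if V: "V \<in> U.L" for V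
  proof -
    obtain I where "I \<in> P" "V = ?E ` I" using V unfolding L by (elim imageE)
    then show "\<psi> V \<in> P" "?E ` \<psi> V = V" using \<psi>E by simp_all
  qed
  have \<psi>mono: "\<psi> V \<subseteq> \<psi> W" if "V \<subseteq> W" for V W using that by (auto simp: \<psi>_def)
  have \<psi>chain: "chain\<^sub>\<subseteq> (\<psi> ` C)" if C: "chain\<^sub>\<subseteq> C" for C
  proof -
    have "\<psi> V \<subseteq> \<psi> W \<or> \<psi> W \<subseteq> \<psi> V" if VW: "V \<in> C" "W \<in> C" for V W
    proof -
      have "V \<subseteq> W \<or> W \<subseteq> V" using C VW unfolding chain_subset_def by simp
      then show ?thesis using \<psi>mono[of V W] \<psi>mono[of W V] by (elim disjE) simp_all
    qed
    then show ?thesis unfolding chain_subset_def by simp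
  qed
  have \<psi>sub: "V \<subseteq> ?E ` I" if "V \<in> U.L" "\<psi> V \<subseteq> I" for V I using image_mono[OF that(2), of ?E] unfolding E\<psi>[OF that(1)] .
  have \<psi>sub': "V \<subseteq> W" if "V \<in> U.L" "W \<in> U.L" "\<psi> V \<subseteq> \<psi> W" for V W using \<psi>sub[OF that(1,3)] E\<psi>[OF that(2)] by simp
  have subE: "I \<subseteq> \<psi> W" if "I \<in> P" "?E ` I \<subseteq> W" for I W using \<psi>mono[OF that(2)] \<psi>E[OF that(1)] by simp
  have Esub: "?E ` I \<subseteq> W" if "W \<in> U.L" "I \<subseteq> \<psi> W" for I W using image_mono[OF that(2), of ?E] unfolding E\<psi>[OF that(1)] .
  show ?thesis
  proof unfold_locales
    fix C assume C: "C \<subseteq> U.L"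
    then have PC: "\<psi> ` C \<subseteq> P" using \<psi>P by (auto dest: subsetD)
    obtain s where s: "s \<in> P" "\<And>I. I \<in> \<psi> ` C \<Longrightarrow> I \<subseteq> s" "\<And>t. t \<in> P \<Longrightarrow> (\<forall>I\<in>\<psi> ` C. I \<subseteq> t) \<Longrightarrow> s \<subseteq> t"
      using principal_sup[OF cont PC[unfolded P_def]] unfolding P_def by metis
    have "U.is_lub C (?E ` s)" unfolding U.is_lub_def
    proof (intro conjI ballI impI)
      show "?E ` s \<in> U.L" by (rule EL[OF s(1)])
      show "I \<subseteq> ?E ` s" if "I \<in> C" for I using \<psi>sub[OF subsetD[OF C that] s(2)[OF imageI[OF that]]] .
      show "?E ` s \<subseteq> t" if "t \<in> U.L" "\<forall>I\<in>C. I \<subseteq> t" for t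
        using Esub[OF that(1) s(3)[OF \<psi>P[OF that(1)]]] \<psi>mono that(2) by (simp add: image_iff)
    qed
    then show "\<exists>s. U.is_lub C s" by blast
    obtain i where i: "i \<in> P" "\<And>I. I \<in> \<psi> ` C \<Longrightarrow> i \<subseteq> I" "\<And>t. t \<in> P \<Longrightarrow> (\<forall>I\<in>\<psi> ` C. t \<subseteq> I) \<Longrightarrow> t \<subseteq> i"
      using principal_inf[OF cont PC[unfolded P_def]] unfolding P_def by metis
    have "U.is_glb C (?E ` i)" unfolding U.is_glb_def
    proof (intro conjI ballI impI)
      show "?E ` i \<in> U.L" by (rule EL[OF i(1)])
      show "?E ` i \<subseteq> I" if "I \<in> C" for I using Esub[OF subsetD[OF C that] i(2)[OF imageI[OF that]]] .
      show "t \<subseteq> ?E ` i" if "t \<in> U.L" "\<forall>I\<in>C. t \<subseteq> I" for t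
        using \<psi>sub[OF that(1) i(3)[OF \<psi>P[OF that(1)]]] \<psi>mono that(2) by (simp add: image_iff)
    qed
    then show "\<exists>s. U.is_glb C s" by blast
  next
    fix C s I t K
    assume C: "C \<subseteq> U.L" "chain\<^sub>\<subseteq> C" and s: "U.is_lub C s" and I: "I \<in> U.L" "t \<in> U.L"
      and below: "\<And>J K. J \<in> C \<Longrightarrow> K \<in> U.L \<Longrightarrow> K \<subseteq> I \<Longrightarrow> K \<subseteq> J \<Longrightarrow> K \<subseteq> t"
      and K: "K \<in> U.L" "K \<subseteq> I" "K \<subseteq> s"
    have "\<psi> K \<subseteq> \<psi> t"
    proof (rule principal_meet_sup[OF cont, folded P_def])
      show "\<psi> ` C \<subseteq> P" using \<psi>P C(1) by (auto dest: subsetD)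
      show "chain\<^sub>\<subseteq> (\<psi> ` C)" by (rule \<psi>chain[OF C(2)])
      show "\<psi> s \<subseteq> t0" if t0: "t0 \<in> P" "\<And>I. I \<in> \<psi> ` C \<Longrightarrow> I \<subseteq> t0" for t0
      proof -
        have "J \<subseteq> ?E ` t0" if "J \<in> C" for J using \<psi>sub[OF subsetD[OF C(1) that] t0(2)[OF imageI[OF that]]] .
        then have "s \<subseteq> ?E ` t0" by (rule U.is_lub_least[OF s EL[OF t0(1)]])
        then show ?thesis using \<psi>mono[of s "?E ` t0"] \<psi>E[OF t0(1)] by simp
      qed
      show "\<psi> I \<in> P" "\<psi> t \<in> P" "\<psi> K \<in> P" using \<psi>P I K(1) by simp_all
      show "\<psi> K \<subseteq> \<psi> I" "\<psi> K \<subseteq> \<psi> s" using \<psi>mono K by simp_all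
      show "K0 \<subseteq> \<psi> t" if K0: "J \<in> \<psi> ` C" "K0 \<in> P" "K0 \<subseteq> \<psi> I" "K0 \<subseteq> J" for J K0
      proof -
        obtain J' where J': "J' \<in> C" "J = \<psi> J'" using K0(1) by (elim imageE)
        have "?E ` K0 \<subseteq> t"
          using below[OF J'(1) EL[OF K0(2)] Esub[OF I(1) K0(3)] Esub[OF subsetD[OF C(1) J'(1)] K0(4)[unfolded J'(2)]]] .
        then show ?thesis using subE[OF K0(2)] by simp
      qed
    qed
    then show "K \<subseteq> t" by (rule \<psi>sub'[OF K(1) I(2)])
  next
    fix C s I t K
    assume C: "C \<subseteq> U.L" "chain\<^sub>\<subseteq> C" and s: "U.is_glb C s" and I: "I \<in> U.L" "t \<in> U.L"
      and above: "\<And>J K. J \<in> C \<Longrightarrow> K \<in> U.L \<Longrightarrow> I \<subseteq> K \<Longrightarrow> J \<subseteq> K \<Longrightarrow> t \<subseteq> K"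
      and K: "K \<in> U.L" "I \<subseteq> K" "s \<subseteq> K"
    have "\<psi> t \<subseteq> \<psi> K"
    proof (rule principal_join_inf[OF cont, folded P_def])
      show "\<psi> ` C \<subseteq> P" using \<psi>P C(1) by (auto dest: subsetD)
      show "chain\<^sub>\<subseteq> (\<psi> ` C)" by (rule \<psi>chain[OF C(2)])
      show "t0 \<subseteq> \<psi> s" if t0: "t0 \<in> P" "\<And>I. I \<in> \<psi> ` C \<Longrightarrow> t0 \<subseteq> I" for t0
      proof -
        have "?E ` t0 \<subseteq> J" if "J \<in> C" for J using Esub[OF subsetD[OF C(1) that] t0(2)[OF imageI[OF that]]] .
        then have "?E ` t0 \<subseteq> s" by (rule U.is_glb_greatest[OF s EL[OF t0(1)]])
        then show ?thesis using subE[OF t0(1)] by simp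
      qed
      show "\<psi> I \<in> P" "\<psi> t \<in> P" "\<psi> K \<in> P" using \<psi>P I K(1) by simp_all
      show "\<psi> I \<subseteq> \<psi> K" "\<psi> s \<subseteq> \<psi> K" using \<psi>mono K by simp_all
      show "\<psi> t \<subseteq> K0" if K0: "J \<in> \<psi> ` C" "K0 \<in> P" "\<psi> I \<subseteq> K0" "J \<subseteq> K0" for J K0
      proof -
        obtain J' where J': "J' \<in> C" "J = \<psi> J'" using K0(1) by (elim imageE)
        have "t \<subseteq> ?E ` K0"
          using above[OF J'(1) EL[OF K0(2)] \<psi>sub[OF I(1) K0(3)] \<psi>sub[OF subsetD[OF C(1) J'(1)] K0(4)[unfolded J'(2)]]] .
        then show ?thesis using \<psi>mono[of t "?E ` K0"] \<psi>E[OF K0(2)] by simp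
      qed
    qed
    then show "t \<subseteq> K" by (rule \<psi>sub'[OF I(2) K(1)])
  qed
qed

lemma irreducible_continuous_subring_embed:
  fixes R :: "('a, 'm) ring_scheme"
  assumes cont: "continuous_ring R" and irr: "irreducible_ring R"
  shows "irreducible_continuous_subring (embed R ` carrier R) (embed R \<one>\<^bsub>R\<^esub>)"
proof -
  interpret ring R using cont by (simp add: continuous_ring_def regular_ring_def)
  interpret U: continuous_subring "embed R ` carrier R" "embed R \<one>\<^bsub>R\<^esub>" by (rule continuous_subring_embed[OF cont])
  show ?thesis
  proof unfold_locales
    have "carrier R \<noteq> {\<zero>\<^bsub>R\<^esub>}" using irr by (simp add: irreducible_ring_def)
    then have "\<one>\<^bsub>R\<^esub> \<noteq> \<zero>\<^bsub>R\<^esub>" using one_zeroD by blast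
    then show "embed R \<one>\<^bsub>R\<^esub> \<noteq> 0" using embed_eq_iff[of "\<one>\<^bsub>R\<^esub>" "\<zero>\<^bsub>R\<^esub>"] embed_zero by simp
    fix c assume c: "U.idem c" "\<And>x. x \<in> embed R ` carrier R \<Longrightarrow> c * x = x * c"
    then obtain c0 where c0: "c0 \<in> carrier R" "c = embed R c0" using U.idem_in by blast
    have "c0 \<otimes>\<^bsub>R\<^esub> c0 = c0" using U.idem_mult[OF c(1)] c0 by (simp add: embed_mult embed_eq_iff)
    moreover have "c0 \<otimes>\<^bsub>R\<^esub> x = x \<otimes>\<^bsub>R\<^esub> c0" if "x \<in> carrier R" for x
      using c(2)[of "embed R x"] that c0 by (simp add: embed_mult embed_eq_iff)
    ultimately have "c0 = \<zero>\<^bsub>R\<^esub> \<or> c0 = \<one>\<^bsub>R\<^esub>" by (rule no_central_idempotent[OF irr c0(1)])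
    then show "c = 0 \<or> c = embed R \<one>\<^bsub>R\<^esub>" using c0 embed_zero by auto
  qed
qed

section \<open>Transport of rank functions\<close>

lemma (in ring) rank_function_embed:
  assumes "unital_subring.is_rank (embed R ` carrier R) (embed R \<one>) \<rho>"
  shows "rank_function R (\<lambda>x\<in>carrier R. \<rho> (embed R x))"
proof -
  interpret U: unital_subring "embed R ` carrier R" "embed R \<one>" by (rule unital_subring_embed)
  note r = assms(1)
  show ?thesis unfolding rank_function_def
  proof (intro conjI ballI impI)
    show "(\<lambda>x\<in>carrier R. \<rho> (embed R x)) \<in> carrier R \<rightarrow>\<^sub>E {0..1}" using U.is_rankD(1,2)[OF r] by auto
    show "(\<lambda>x\<in>carrier R. \<rho> (embed R x)) \<one> = 1" using U.is_rankD(3)[OF r] by simp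
    fix a assume a: "a \<in> carrier R"
    show "a = \<zero>" if "(\<lambda>x\<in>carrier R. \<rho> (embed R x)) a = 0"
      using U.is_rankD(7)[OF r, of "embed R a"] that a embed_eq_iff[of a \<zero>] embed_zero by simp
    fix b assume b: "b \<in> carrier R"
    show "(\<lambda>x\<in>carrier R. \<rho> (embed R x)) (a \<otimes> b) \<le> min ((\<lambda>x\<in>carrier R. \<rho> (embed R x)) a) ((\<lambda>x\<in>carrier R. \<rho> (embed R x)) b)"
      using U.is_rankD(4,5)[OF r, of "embed R a" "embed R b"] a b by (simp add: embed_mult)
    show "(\<lambda>x\<in>carrier R. \<rho> (embed R x)) (a \<oplus> b) = (\<lambda>x\<in>carrier R. \<rho> (embed R x)) a + (\<lambda>x\<in>carrier R. \<rho> (embed R x)) b"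
      if h: "a \<otimes> a = a \<and> b \<otimes> b = b \<and> a \<otimes> b = \<zero> \<and> b \<otimes> a = \<zero>"
    proof -
      have "U.idem (embed R a)" "U.idem (embed R b)" "embed R a * embed R b = 0" "embed R b * embed R a = 0"
        using h a b by (auto intro!: U.idemI simp: embed_mult embed_zero)
      then show ?thesis using U.is_rankD(6)[OF r, of "embed R a" "embed R b"] a b by (simp add: embed_add)
    qed
  qed
qed

lemma (in ring) is_rank_inv_embed:
  assumes "rank_function R r"
  shows "unital_subring.is_rank (embed R ` carrier R) (embed R \<one>) (\<lambda>y. r (inv_into (carrier R) (embed R) y))"
proof -
  interpret U: unital_subring "embed R ` carrier R" "embed R \<one>" by (rule unital_subring_embed)
  have inj: "inj_on (embed R) (carrier R)" using embed_eq_iff by (auto intro: inj_onI)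
  have inv [simp]: "inv_into (carrier R) (embed R) (embed R x) = x" if "x \<in> carrier R" for x
    using inv_into_f_f[OF inj that] .
  have r: "r \<in> carrier R \<rightarrow>\<^sub>E {0..1}" "r \<one> = 1" "\<And>a b. a \<in> carrier R \<Longrightarrow> b \<in> carrier R \<Longrightarrow> r (a \<otimes> b) \<le> min (r a) (r b)"
    "\<And>e f. e \<in> carrier R \<Longrightarrow> f \<in> carrier R \<Longrightarrow> e \<otimes> e = e \<Longrightarrow> f \<otimes> f = f \<Longrightarrow> e \<otimes> f = \<zero> \<Longrightarrow> f \<otimes> e = \<zero> \<Longrightarrow> r (e \<oplus> f) = r e + r f"
    "\<And>a. a \<in> carrier R \<Longrightarrow> r a = 0 \<Longrightarrow> a = \<zero>"
    using assms unfolding rank_function_def by blast+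
  show ?thesis unfolding U.is_rank_def
  proof (intro conjI ballI allI impI)
    show "r (inv_into (carrier R) (embed R) (embed R \<one>)) = 1" using r(2) by simp
    fix a assume "a \<in> embed R ` carrier R"
    then obtain x where x: "x \<in> carrier R" "a = embed R x" by blast
    have "r x \<in> {0..1}" using PiE_mem[OF r(1) x(1)] .
    then show "0 \<le> r (inv_into (carrier R) (embed R) a)" "r (inv_into (carrier R) (embed R) a) \<le> 1" using x by simp_all
    show "a = 0" if "r (inv_into (carrier R) (embed R) a) = 0" using r(5)[OF x(1)] that x embed_zero by simp
    fix b assume "b \<in> embed R ` carrier R"
    then obtain y where y: "y \<in> carrier R" "b = embed R y" by blast
    show "r (inv_into (carrier R) (embed R) (a * b)) \<le> r (inv_into (carrier R) (embed R) a)"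
      "r (inv_into (carrier R) (embed R) (a * b)) \<le> r (inv_into (carrier R) (embed R) b)"
      using r(3)[OF x(1) y(1)] x y by (simp_all add: embed_mult)
  next
    fix e f assume h: "U.idem e" "U.idem f" "e * f = 0" "f * e = 0"
    obtain x where x: "x \<in> carrier R" "e = embed R x" using U.idem_in[OF h(1)] by blast
    obtain y where y: "y \<in> carrier R" "f = embed R y" using U.idem_in[OF h(2)] by blast
    have "x \<otimes> x = x" "y \<otimes> y = y" "x \<otimes> y = \<zero>" "y \<otimes> x = \<zero>"
      using U.idem_mult[OF h(1)] U.idem_mult[OF h(2)] h(3,4) x y by (simp_all add: embed_mult embed_eq_iff embed_zero[symmetric])
    then show "r (inv_into (carrier R) (embed R) (e + f)) = r (inv_into (carrier R) (embed R) e) + r (inv_into (carrier R) (embed R) f)"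
      using r(4)[OF x(1) y(1)] x y by (simp add: embed_add)
  qed
qed

text \<open>Extensionality turns uniqueness on the carrier into equality of functions, so the
  definite description behind \<open>rk\<close> is meaningful.\<close>

lemma rank_function_rk:
  assumes cont: "continuous_ring R" and irr: "irreducible_ring R"
  shows "rank_function R (rk R)"
proof -
  interpret ring R using cont by (simp add: continuous_ring_def regular_ring_def)
  interpret U: irreducible_continuous_subring "embed R ` carrier R" "embed R \<one>\<^bsub>R\<^esub>"
    by (rule irreducible_continuous_subring_embed[OF cont irr])
  obtain \<rho> where \<rho>: "U.is_rank \<rho>" "\<And>\<rho>' a. U.is_rank \<rho>' \<Longrightarrow> a \<in> embed R ` carrier R \<Longrightarrow> \<rho>' a = \<rho> a"
    using U.rank_exists_unique by blast
  have inj: "inj_on (embed R) (carrier R)" using embed_eq_iff by (auto intro: inj_onI)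
  have "\<exists>!r. rank_function R r"
  proof (rule ex1I[where P = "rank_function R" and a = "\<lambda>x\<in>carrier R. \<rho> (embed R x)"])
    show "rank_function R (\<lambda>x\<in>carrier R. \<rho> (embed R x))" by (rule rank_function_embed[OF \<rho>(1)])
    fix r assume r: "rank_function R r"
    show "r = (\<lambda>x\<in>carrier R. \<rho> (embed R x))"
    proof
      fix x
      show "r x = (\<lambda>x\<in>carrier R. \<rho> (embed R x)) x"
      proof (cases "x \<in> carrier R")
        case True
        then show ?thesis using \<rho>(2)[OF is_rank_inv_embed[OF r] imageI[OF True]] inv_into_f_f[OF inj True] by simp
      next
        case False
        have "r \<in> carrier R \<rightarrow>\<^sub>E {0..1}" using r by (simp add: rank_function_def)
        from PiE_arb[OF this False] show ?thesis using False by simp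
      qed
    qed
  qed
  then show ?thesis unfolding rk_def by (rule theI')
qed

section \<open>The projective unit group\<close>

lemma (in group) group_center_normal: "group_center G \<lhd> G"
  unfolding normal_inv_iff
proof (intro conjI ballI)
  show "subgroup (group_center G) G"
  proof (rule subgroupI)
    show "group_center G \<subseteq> carrier G" "group_center G \<noteq> {}" by (auto simp: group_center_def)
    show "inv a \<in> group_center G" if "a \<in> group_center G" for a
    proof -
      have a: "a \<in> carrier G" "\<And>g. g \<in> carrier G \<Longrightarrow> a \<otimes> g = g \<otimes> a" using that by (auto simp: group_center_def)
      have "inv a \<otimes> g = g \<otimes> inv a" if g: "g \<in> carrier G" for g
      proof -
        have "inv a \<otimes> (g \<otimes> a) \<otimes> inv a = inv a \<otimes> (a \<otimes> g) \<otimes> inv a" using a(2)[OF g] by simp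
        moreover have "inv a \<otimes> (g \<otimes> a) \<otimes> inv a = inv a \<otimes> g" using a(1) g by (simp add: m_assoc)
        moreover have "inv a \<otimes> (a \<otimes> g) \<otimes> inv a = g \<otimes> inv a" using a(1) g by (simp add: m_assoc[symmetric])
        ultimately show ?thesis by simp
      qed
      then show ?thesis using a(1) by (simp add: group_center_def)
    qed
    show "a \<otimes> b \<in> group_center G" if "a \<in> group_center G" "b \<in> group_center G" for a b
    proof -
      have ab: "a \<in> carrier G" "b \<in> carrier G" using that by (auto simp: group_center_def)
      have "a \<otimes> b \<otimes> g = g \<otimes> (a \<otimes> b)" if g: "g \<in> carrier G" for g
      proof -
        have "a \<otimes> b \<otimes> g = a \<otimes> (g \<otimes> b)" using \<open>b \<in> group_center G\<close> g ab by (simp add: group_center_def m_assoc)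
        also have "\<dots> = a \<otimes> g \<otimes> b" using g ab by (simp add: m_assoc)
        also have "a \<otimes> g = g \<otimes> a" using \<open>a \<in> group_center G\<close> g by (simp add: group_center_def)
        finally show ?thesis using g ab by (simp add: m_assoc)
      qed
      then show ?thesis using ab by (simp add: group_center_def)
    qed
  qed
next
  fix x h assume xh: "x \<in> carrier G" "h \<in> group_center G"
  then have "h \<in> carrier G" "x \<otimes> h = h \<otimes> x" by (auto simp: group_center_def)
  then have "x \<otimes> h \<otimes> inv x = h" using xh by (simp add: m_assoc)
  then show "x \<otimes> h \<otimes> inv x \<in> group_center G" using xh by simp
qed

theorem corollaryA:
  fixes R :: "('a, 'm) ring_scheme"
  assumes "continuous_ring R" and "irreducible_ring R" and "non_discrete_ring R"
  shows "top_bounded_normal_generation (PGL R) (PGL_topology R) \<and>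
         topologically_simple (PGL R) (PGL_topology R)"
proof -
  interpret R: ring R using assms(1) by (simp add: continuous_ring_def regular_ring_def)
  let ?E = "embed R"
  define \<rho> where "\<rho> y = rk R (inv_into (carrier R) ?E y)" for y
  interpret U: irreducible_continuous_subring "?E ` carrier R" "?E \<one>\<^bsub>R\<^esub>"
    by (rule irreducible_continuous_subring_embed[OF assms(1,2)])
  have rank: "U.is_rank \<rho>" unfolding \<rho>_def by (rule R.is_rank_inv_embed[OF rank_function_rk[OF assms(1,2)]])
  have inj: "inj_on ?E (carrier R)" using R.embed_eq_iff by (auto intro: inj_onI)
  define d where "d = rank_dist R"
  have d: "d x y = \<rho> (?E x - ?E y)" if "x \<in> carrier R" "y \<in> carrier R" for x y
    using that inv_into_f_f[OF inj, of "x \<ominus>\<^bsub>R\<^esub> y"] by (simp add: d_def rank_dist_def \<rho>_def R.embed_diff)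
  have inE: "?E x \<in> ?E ` carrier R" if "x \<in> carrier R" for x using that by simp
  have d_nonneg: "0 \<le> d x y" for x y
  proof (cases "x \<in> carrier R \<and> y \<in> carrier R")
    case True
    then show ?thesis using d U.is_rankD(1)[OF rank] U.diff_in[OF inE inE] by simp
  qed (auto simp: d_def rank_dist_def)
  have d_sym: "d x y = d y x" for x y
  proof (cases "x \<in> carrier R \<and> y \<in> carrier R")
    case True
    then show ?thesis using d U.rank_uminus[OF rank U.diff_in[OF inE inE], of x y] by simp
  qed (auto simp: d_def rank_dist_def)
  have d_zero: "d x y = 0 \<longleftrightarrow> x = y" if "x \<in> carrier R" "y \<in> carrier R" for x y
    using d[OF that] U.is_rankD(7)[OF rank U.diff_in[OF inE inE], OF that] U.rank_zero[OF rank] R.embed_eq_iff[OF that] by auto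
  have d_tri: "d x z \<le> d x y + d y z" if "x \<in> carrier R" "y \<in> carrier R" "z \<in> carrier R" for x y z
    using U.rank_subadditive[OF rank U.diff_in[OF inE inE] U.diff_in[OF inE inE], of x y y z] that d by simp
  have d_left: "d (z \<otimes>\<^bsub>R\<^esub> x) (z \<otimes>\<^bsub>R\<^esub> y) \<le> d x y" if "x \<in> carrier R" "y \<in> carrier R" "z \<in> carrier R" for x y z
    using U.is_rankD(5)[OF rank inE U.diff_in[OF inE inE], of z x y] that d by (simp add: right_diff_distrib R.embed_mult)
  have d_right: "d (x \<otimes>\<^bsub>R\<^esub> z) (y \<otimes>\<^bsub>R\<^esub> z) \<le> d x y" if "x \<in> carrier R" "y \<in> carrier R" "z \<in> carrier R" for x y z
    using U.is_rankD(4)[OF rank U.diff_in[OF inE inE] inE, of x y z] that d by (simp add: left_diff_distrib R.embed_mult)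
  interpret M: Metric_space "carrier R" d
    by unfold_locales (use d_nonneg d_sym d_zero d_tri in auto)
  have rt: "rank_topology R = M.mtopology" by (simp add: rank_topology_def d_def)
  \<comment> \<open>An atom would keep all nonzero ranks above a positive \<delta>, and every point
    would be open.\<close>
  have nonatomic: "\<not> U.atom a" for a
  proof
    assume "U.atom a"
    then obtain \<rho>' \<delta> where \<delta>: "\<delta> > 0" "\<And>\<rho>'' a. U.is_rank \<rho>'' \<Longrightarrow> a \<in> ?E ` carrier R \<Longrightarrow> \<rho>'' a = \<rho>' a"
      "\<And>a. a \<in> ?E ` carrier R \<Longrightarrow> a \<noteq> 0 \<Longrightarrow> \<delta> \<le> \<rho>' a" using U.atomic_rank by metis
    have far: "x = y" if "x \<in> carrier R" "y \<in> carrier R" "d x y < \<delta>" for x y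
      using \<delta>(2)[OF rank U.diff_in[OF inE inE], OF that(1,2)] \<delta>(3)[OF U.diff_in[OF inE inE], OF that(1,2)] d[OF that(1,2)] that(3)
        R.embed_eq_iff[OF that(1,2)] by fastforce
    have "openin M.mtopology S \<longleftrightarrow> S \<subseteq> carrier R" for S
      unfolding M.openin_mtopology using far \<delta>(1) by (auto simp: M.mball_def intro!: exI[of _ \<delta>])
    then have "rank_topology R = discrete_topology (carrier R)" unfolding rt topology_eq by (simp add: openin_discrete_topology)
    then show False using assms(3) by (simp add: non_discrete_ring_def)
  qed
  interpret V: nonatomic_rank_subring "?E ` carrier R" "?E \<one>\<^bsub>R\<^esub>" \<rho>
    by unfold_locales (use rank nonatomic in auto)
  define G where "G = GL R"
  have G: "group G" unfolding G_def by (rule R.units_group)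
  interpret G: group G by (rule G)
  have Gc: "carrier G = Units R" "monoid.mult G = monoid.mult R" "\<one>\<^bsub>G\<^esub> = \<one>\<^bsub>R\<^esub>"
    by (simp_all add: G_def units_of_carrier units_of_mult units_of_one)
  define Z where "Z = group_center G"
  have Znormal: "Z \<lhd> G" unfolding Z_def by (rule G.group_center_normal)
  then have Zsub: "subgroup Z G" by (rule normal_imp_subgroup)
  interpret N: normal Z G by (rule Znormal)
  define T where "T = GL_topology R"
  have Usub: "Units R \<subseteq> carrier R" using R.Units_closed by blast
  have topT: "topspace T = carrier G"
    using Usub by (auto simp: T_def GL_topology_def rt Gc G_def[symmetric])
  \<comment> \<open>This puts the subspace topology into the form in terms of balls that
    \<open>quotient_topological_group\<close> expects.\<close>
  have opT: "openin T S \<longleftrightarrow> S \<subseteq> carrier G \<and> (\<forall>x\<in>S. \<exists>\<epsilon>>0. \<forall>y\<in>carrier G. d x y < \<epsilon> \<longrightarrow> y \<in> S)" for S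
  proof
    assume "openin T S"
    then obtain W where W: "openin M.mtopology W" "S = W \<inter> carrier G"
      by (auto simp: T_def GL_topology_def rt openin_subtopology G_def[symmetric])
    show "S \<subseteq> carrier G \<and> (\<forall>x\<in>S. \<exists>\<epsilon>>0. \<forall>y\<in>carrier G. d x y < \<epsilon> \<longrightarrow> y \<in> S)"
    proof (intro conjI ballI)
      fix x assume x: "x \<in> S"
      then obtain \<epsilon> where \<epsilon>: "\<epsilon> > 0" "M.mball x \<epsilon> \<subseteq> W" using W unfolding M.openin_mtopology by blast
      have "y \<in> S" if "y \<in> carrier G" "d x y < \<epsilon>" for y
        using that \<epsilon>(2) x W(2) Usub Gc by (auto simp: M.mball_def)
      then show "\<exists>\<epsilon>>0. \<forall>y\<in>carrier G. d x y < \<epsilon> \<longrightarrow> y \<in> S" using \<epsilon>(1) by blast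
    qed (use W in simp)
  next
    assume S: "S \<subseteq> carrier G \<and> (\<forall>x\<in>S. \<exists>\<epsilon>>0. \<forall>y\<in>carrier G. d x y < \<epsilon> \<longrightarrow> y \<in> S)"
    then obtain \<epsilon> where \<epsilon>: "\<And>x. x \<in> S \<Longrightarrow> \<epsilon> x > 0" "\<And>x y. x \<in> S \<Longrightarrow> y \<in> carrier G \<Longrightarrow> d x y < \<epsilon> x \<Longrightarrow> y \<in> S" by metis
    have "openin M.mtopology (\<Union>x\<in>S. M.mball x (\<epsilon> x))" by (intro openin_Union) auto
    moreover have "S = (\<Union>x\<in>S. M.mball x (\<epsilon> x)) \<inter> carrier G"
    proof (intro equalityI subsetI IntI)
      fix x assume x: "x \<in> S"
      then have xc: "x \<in> carrier G" using S by blast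
      then have "x \<in> M.mball x (\<epsilon> x)" using Usub Gc(1) \<epsilon>(1)[OF x] by (simp add: subset_iff)
      then show "x \<in> (\<Union>x\<in>S. M.mball x (\<epsilon> x))" using x by (rule UN_I[rotated])
      show "x \<in> carrier G" by (rule xc)
    next
      fix y assume y: "y \<in> (\<Union>x\<in>S. M.mball x (\<epsilon> x)) \<inter> carrier G"
      then obtain x where "x \<in> S" "d x y < \<epsilon> x" by (auto simp: M.mball_def)
      then show "y \<in> S" using \<epsilon>(2)[of x y] y by simp
    qed
    ultimately show "openin T S" unfolding T_def GL_topology_def rt G_def[symmetric] openin_subtopology by blast
  qed
  define \<pi> where "\<pi> = (\<lambda>g. Z #>\<^bsub>G\<^esub> g)"
  have PGL: "PGL R = G Mod Z" "PGL_topology R = quotient_topology T \<pi>"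
    by (simp_all add: PGL_def PGL_topology_def G_def Z_def T_def \<pi>_def)
  have tg: "topological_group (PGL R) (PGL_topology R)"
    unfolding PGL \<pi>_def using Usub Gc
    by (intro quotient_topological_group[OF G Znormal topT opT])
       (use d_zero d_sym d_tri d_left d_right in \<open>auto simp: subset_iff\<close>)
  have PGLc: "carrier (PGL R) = \<pi> ` carrier G" by (simp add: PGL carrier_FactGroup \<pi>_def)
  have pi_mult: "\<pi> (x \<otimes>\<^bsub>G\<^esub> y) = \<pi> x \<otimes>\<^bsub>PGL R\<^esub> \<pi> y" if "x \<in> carrier G" "y \<in> carrier G" for x y
    using N.rcos_sum[OF that] by (simp add: \<pi>_def PGL)
  have pi_one: "\<pi> \<one>\<^bsub>G\<^esub> = \<one>\<^bsub>PGL R\<^esub>"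
    using G.coset_join2[OF G.one_closed Zsub N.one_closed] by (simp add: \<pi>_def PGL)
  have PGLg: "group (PGL R)" unfolding PGL by (rule N.factorgroup_is_group)
  have pi_inv: "inv\<^bsub>PGL R\<^esub> (\<pi> x) = \<pi> (inv\<^bsub>G\<^esub> x)" if x: "x \<in> carrier G" for x
    by (rule group.inv_equality[OF PGLg]) (use x pi_mult[symmetric] pi_one PGLc in auto)
  have corner_E: "U.corner_inverse (?E \<one>\<^bsub>R\<^esub>) (?E x) (?E (inv\<^bsub>G\<^esub> x))" if x: "x \<in> carrier G" for x
  proof -
    have "x \<otimes>\<^bsub>R\<^esub> inv\<^bsub>G\<^esub> x = \<one>\<^bsub>R\<^esub>" "inv\<^bsub>G\<^esub> x \<otimes>\<^bsub>R\<^esub> x = \<one>\<^bsub>R\<^esub>" using G.r_inv[OF x] G.l_inv[OF x] by (simp_all add: Gc)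
    moreover have "x \<in> carrier R" "inv\<^bsub>G\<^esub> x \<in> carrier R" using x G.inv_closed[OF x] Usub Gc by auto
    ultimately show ?thesis by (simp add: U.corner_inverse_def U.corner_unit R.embed_mult)
  qed
  have gen: "\<exists>n. carrier (PGL R) = PGL_topology R closure_of set_power (PGL R) (conj_class (PGL R) c \<union> conj_class (PGL R) (inv\<^bsub>PGL R\<^esub> c)) n"
    if c: "c \<in> carrier (PGL R) - {\<one>\<^bsub>PGL R\<^esub>}" for c
  proof -
    obtain g where g: "g \<in> carrier G" "c = \<pi> g" using c PGLc by blast
    have "g \<notin> Z"
    proof
      assume "g \<in> Z"
      then have "\<pi> g = Z" using G.coset_join2[OF g(1) Zsub] by (simp add: \<pi>_def)
      then show False using c g by (simp add: PGL)
    qed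
    then have "\<not> (\<forall>k\<in>carrier G. g \<otimes>\<^bsub>G\<^esub> k = k \<otimes>\<^bsub>G\<^esub> g)" using g(1) unfolding Z_def group_center_def by blast
    \<comment> \<open>The center is that of the unit group, so the witness is a unit;
      \<open>bounded_normal_generation\<close> accepts it as a mere ring element.\<close>
    then obtain k where k: "k \<in> carrier G" "g \<otimes>\<^bsub>G\<^esub> k \<noteq> k \<otimes>\<^bsub>G\<^esub> g" by blast
    have gR: "g \<in> carrier R" "k \<in> carrier R" "inv\<^bsub>G\<^esub> g \<in> carrier R" using g k G.inv_closed[OF g(1)] Usub Gc by auto
    have "?E g * ?E k \<noteq> ?E k * ?E g" using k(2) gR by (simp add: R.embed_mult R.embed_eq_iff Gc)
    then obtain n where n: "\<And>h h' \<epsilon>. U.corner_inverse (?E \<one>\<^bsub>R\<^esub>) h h' \<Longrightarrow> \<epsilon> > 0 \<Longrightarrow>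
        \<exists>t. U.conj_products (?E g) (?E (inv\<^bsub>G\<^esub> g)) n t \<and> \<rho> (h - t) < \<epsilon>"
      using V.bounded_normal_generation[OF corner_E[OF g(1)] inE[OF gR(2)]] by blast
    let ?S = "conj_class (PGL R) c \<union> conj_class (PGL R) (inv\<^bsub>PGL R\<^esub> c)"
    \<comment> \<open>Conjugates of \<open>g\<close> project to the class of \<open>c\<close> and
      conjugates of its inverse to the class of the inverse of \<open>c\<close>. The induction thus
      turns a factorisation in the ring into one in the quotient group.\<close>
    have prod: "\<exists>x\<in>carrier G. t = ?E x \<and> \<pi> x \<in> set_power (PGL R) ?S m"
      if "U.conj_products (?E g) (?E (inv\<^bsub>G\<^esub> g)) m t" for m t
    proof -
      have unit: "\<exists>x\<in>carrier G. k = ?E x \<and> k' = ?E (inv\<^bsub>G\<^esub> x)" if kk: "U.corner_inverse (?E \<one>\<^bsub>R\<^esub>) k k'" for k k'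
      proof -
        obtain x y where x: "x \<in> carrier R" "k = ?E x" and y: "y \<in> carrier R" "k' = ?E y"
          using kk by (auto simp: U.corner_inverse_def U.corner_unit)
        have "x \<otimes>\<^bsub>R\<^esub> y = \<one>\<^bsub>R\<^esub>" "y \<otimes>\<^bsub>R\<^esub> x = \<one>\<^bsub>R\<^esub>"
          using kk x y by (simp_all add: U.corner_inverse_def R.embed_mult R.embed_eq_iff)
        then have xy: "x \<in> carrier G" "y \<in> carrier G" using x y by (auto simp: Gc Units_def)
        have "inv\<^bsub>G\<^esub> x = y" by (rule G.inv_equality) (use xy \<open>y \<otimes>\<^bsub>R\<^esub> x = \<one>\<^bsub>R\<^esub>\<close> Gc in auto)
        then show ?thesis using x y xy by blast
      qed
      have step: "\<exists>x\<in>carrier G. w * (k * ?E z * k') = ?E x \<and> \<pi> x \<in> set_power (PGL R) ?S (Suc m)"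
        if w: "\<exists>x\<in>carrier G. w = ?E x \<and> \<pi> x \<in> set_power (PGL R) ?S m" and kk: "U.corner_inverse (?E \<one>\<^bsub>R\<^esub>) k k'"
          and z: "z \<in> carrier G" "conj_class (PGL R) (\<pi> z) \<subseteq> ?S" for w k k' z m
      proof -
        obtain x where x: "x \<in> carrier G" "w = ?E x" "\<pi> x \<in> set_power (PGL R) ?S m" using w by blast
        obtain y where y: "y \<in> carrier G" "k = ?E y" "k' = ?E (inv\<^bsub>G\<^esub> y)" using unit[OF kk] by blast
        have "\<pi> (y \<otimes>\<^bsub>G\<^esub> z \<otimes>\<^bsub>G\<^esub> inv\<^bsub>G\<^esub> y) = \<pi> y \<otimes>\<^bsub>PGL R\<^esub> \<pi> z \<otimes>\<^bsub>PGL R\<^esub> inv\<^bsub>PGL R\<^esub> (\<pi> y)"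
          using y(1) z(1) by (simp add: pi_mult pi_inv)
        then have "\<pi> (y \<otimes>\<^bsub>G\<^esub> z \<otimes>\<^bsub>G\<^esub> inv\<^bsub>G\<^esub> y) \<in> ?S" using z y(1) PGLc by (auto simp: conj_class_def)
        then have "\<pi> (x \<otimes>\<^bsub>G\<^esub> (y \<otimes>\<^bsub>G\<^esub> z \<otimes>\<^bsub>G\<^esub> inv\<^bsub>G\<^esub> y)) \<in> set_power (PGL R) ?S (Suc m)"
          using x y(1) z(1) by (auto simp: pi_mult set_mult_def)
        moreover have "w * (k * ?E z * k') = ?E (x \<otimes>\<^bsub>G\<^esub> (y \<otimes>\<^bsub>G\<^esub> z \<otimes>\<^bsub>G\<^esub> inv\<^bsub>G\<^esub> y))"
          using x(1,2) y z(1) G.inv_closed[OF y(1)] Usub by (simp add: Gc R.embed_mult subset_iff)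
        ultimately show ?thesis using x(1) y(1) z(1) by blast
      qed
      show ?thesis using that
      proof (induction rule: U.conj_products.induct)
        case zero
        then show ?case by (rule bexI[OF _ G.one_closed], unfold pi_one) (simp add: Gc(3))
      next
        case (left n w k k')
        then show ?case using step[OF left.IH left.hyps(2) g(1)] g(2) by blast
      next
        case (right n w k k')
        then show ?case using step[OF right.IH right.hyps(2) G.inv_closed[OF g(1)]] g pi_inv[OF g(1)] by auto
      qed
    qed
    have "carrier (PGL R) \<subseteq> PGL_topology R closure_of set_power (PGL R) ?S n"
    proof
      fix y assume "y \<in> carrier (PGL R)"
      then obtain h where h: "h \<in> carrier G" "y = \<pi> h" using PGLc by blast
      show "y \<in> PGL_topology R closure_of set_power (PGL R) ?S n" unfolding in_closure_of
      proof (intro conjI allI impI)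
        show "y \<in> topspace (PGL_topology R)" using h by (simp add: PGL topT)
        fix W assume W: "y \<in> W \<and> openin (PGL_topology R) W"
        \<comment> \<open>The preimage of \<open>W\<close> contains a rank ball around the
          representative \<open>h\<close>, and density of the products of conjugates yields one in
          this ball.\<close>
        then have "openin T {x \<in> carrier G. \<pi> x \<in> W}" by (simp add: PGL openin_quotient_topology topT)
        moreover have "h \<in> {x \<in> carrier G. \<pi> x \<in> W}" using W h by simp
        ultimately obtain \<epsilon> where \<epsilon>: "\<epsilon> > 0" "\<And>x. x \<in> carrier G \<Longrightarrow> d h x < \<epsilon> \<Longrightarrow> \<pi> x \<in> W" unfolding opT by blast
        obtain t where t: "U.conj_products (?E g) (?E (inv\<^bsub>G\<^esub> g)) n t" "\<rho> (?E h - t) < \<epsilon>" using n[OF corner_E[OF h(1)] \<epsilon>(1)] by blast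
        obtain x where x: "x \<in> carrier G" "t = ?E x" "\<pi> x \<in> set_power (PGL R) ?S n" using prod[OF t(1)] by blast
        have "h \<in> carrier R" "x \<in> carrier R" using h(1) x(1) Usub Gc(1) by blast+
        then have "d h x < \<epsilon>" using t(2) by (simp add: d x(2))
        then show "\<exists>y. y \<in> set_power (PGL R) ?S n \<and> y \<in> W" using \<epsilon>(2)[OF x(1)] x(3) by blast
      qed
    qed
    moreover have "topspace (PGL_topology R) = carrier (PGL R)" using tg by (simp add: topological_group_def)
    ultimately have "carrier (PGL R) = PGL_topology R closure_of set_power (PGL R) ?S n"
      by (metis closure_of_subset_topspace subset_antisym)
    then show ?thesis by (rule exI)
  qed
  have "top_bounded_normal_generation (PGL R) (PGL_topology R)"
    unfolding top_bounded_normal_generation_def by (intro conjI ballI tg gen)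
  then show ?thesis by (intro conjI topologically_simple_if_bounded_normal_generation)
qed

end
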